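(* Let $N\in\mathbb N$, let $\lambda_1,\dots,\lambda_N\in[0,1]$, and let $\phi_1,\dots,\phi_N:\mathbb N\to\mathbb Z$. Suppose that $(n_k)_{k\in\mathbb N}$ is a strictly increasing sequence in $\mathbb N$ such that for any $\vec\xi=(\xi_1,\dots,\xi_N)\in\{0,1\}^N$ there exists an aperiodic $T_{\vec\xi}\in\mathrm{Aut}([0,1],\mathcal B,\mu)$ with the property that for each $j\in\{1,\dots,N\}$ and any $A,B\in\mathcal B$, $$\lim_{k\to\infty}\mu(A\cap T_{\vec\xi}^{-\phi_j(n_k)}B)=(1-\xi_j)\mu(A\cap B)+\xi_j\mu(A)\mu(B).$$ Then the set of all $T\in\mathrm{Aut}([0,1],\mathcal B,\mu)$ for which there exists a strictly increasing sequence $(k_\ell)_{\ell\in\mathbb N}$ in $\mathbb N$ such that for every $j\in\{1,\dots,N\}$ and all $A,B\in\mathcal B$, $$\lim_{\ell\to\infty}\mu(A\cap T^{-\phi_j(n_{k_\ell})}B)=(1-\lambda_j)\mu(A\cap B)+\lambda_j\mu(A)\mu(B),$$ is a dense $G_\delta$ subset of $\mathrm{Aut}([0,1],\mathcal B,\mu)$.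
   Context: $\mathbb N=\{1,2,\dots\}$. $\mathcal B$ is the Borel $\sigma$-algebra of $[0,1]$ and $\mu$ is Lebesgue measure. $\mathrm{Aut}([0,1],\mathcal B,\mu)$ is the set of invertible $\mu$-preserving transformations $T:[0,1]\to[0,1]$ (as usual identified when they agree $\mu$-a.e.), endowed with the weak topology: $T_n\to T$ if and only if $\|T_nf-Tf\|_{L^2}\to0$ for each $f\in L^2(\mu)$, where $Tf=f\circ T$. This topology is completely metrizable. A transformation $T\in\mathrm{Aut}([0,1],\mathcal B,\mu)$ is aperiodic if the set of $x\in[0,1]$ for which there exists an $n\in\mathbb N$ with $T^nx=x$ has $\mu$-measure zero. *)

theory Defs
  imports "HOL-Analysis.Analysis"
begin

definition leb01 :: "real measure" where
  "leb01 = restrict_space lborel {0..1}"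

lemma space_leb01 [simp]: "space leb01 = {0..1}"
  by (simp add: leb01_def space_restrict_space)

lemma emeasure_space_leb01: "emeasure leb01 (space leb01) = 1"
  by (simp add: leb01_def emeasure_restrict_space space_restrict_space)


section \<open>Invertible measure-preserving transformations\<close>

text \<open>
  Representatives are bimeasurable bijections of the unit interval.  A transformation that is
  invertible only modulo null sets agrees almost everywhere with one of these, so
  the quotient taken below is not affected by this choice.
  Values outside the unit interval are irrelevant.
\<close>

definition mpt :: "(real \<Rightarrow> real) set" where
  "mpt = {T. bij_betw T {0..1} {0..1} \<and> T \<in> measurable leb01 leb01 \<and>
             inv_into {0..1} T \<in> measurable leb01 leb01 \<and> distr leb01 leb01 T = leb01}"

definition mpt_eq :: "(real \<Rightarrow> real) \<Rightarrow> (real \<Rightarrow> real) \<Rightarrow> bool" where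
  "mpt_eq S T \<longleftrightarrow> S \<in> mpt \<and> T \<in> mpt \<and> (AE x in leb01. S x = T x)"

lemma id_in_mpt: "(\<lambda>x. x) \<in> mpt"
proof -
  have "inv_into {0..1} (\<lambda>x. x) \<in> measurable leb01 leb01 \<longleftrightarrow>
        (\<lambda>x. x) \<in> measurable leb01 leb01"
    by (rule measurable_cong) (simp add: inv_into_f_eq inj_on_def)
  then show ?thesis
    by (auto simp: mpt_def bij_betw_def inj_on_def distr_id)
qed

quotient_type aut = "real \<Rightarrow> real" / partial: mpt_eq
proof (rule part_equivpI)
  show "\<exists>T. mpt_eq T T"
    using id_in_mpt by (auto simp: mpt_eq_def)
  show "symp mpt_eq"
    by (auto intro!: sympI simp: mpt_eq_def elim: AE_mp)
  show "transp mpt_eq"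
  proof (rule transpI)
    fix R S T assume "mpt_eq R S" "mpt_eq S T"
    then show "mpt_eq R T"
      unfolding mpt_eq_def by (auto elim: AE_mp)
  qed
qed

definition int_iter :: "(real \<Rightarrow> real) \<Rightarrow> int \<Rightarrow> real \<Rightarrow> real" where
  "int_iter T m = (if 0 \<le> m then T ^^ nat m else inv_into {0..1} T ^^ nat (- m))"

text \<open>The set \<open>T\<^sup>-\<^sup>m B\<close>, i.e. the preimage of \<open>B\<close> under the possibly negative power \<open>T\<^sup>m\<close>.\<close>

definition preimage_iter :: "(real \<Rightarrow> real) \<Rightarrow> int \<Rightarrow> real set \<Rightarrow> real set" where
  "preimage_iter T m B = {x \<in> {0..1}. int_iter T m x \<in> B}"


subsection \<open>Independence of the representative\<close>

definition pres :: "(real \<Rightarrow> real) \<Rightarrow> bool" where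
  "pres T \<longleftrightarrow> T \<in> measurable leb01 leb01 \<and> distr leb01 leb01 T = leb01"

lemma pres_id: "pres (\<lambda>x. x)"
  by (simp add: pres_def distr_id)

lemma pres_comp: "pres S \<Longrightarrow> pres T \<Longrightarrow> pres (S \<circ> T)"
  unfolding pres_def by (metis distr_distr measurable_comp)

lemma pres_funpow: "pres T \<Longrightarrow> pres (T ^^ n)"
  by (induction n) (auto simp: pres_comp pres_id id_def)

lemma pres_AE:
  assumes "pres T" "AE x in leb01. P x"
  shows "AE x in leb01. P (T x)"
proof -
  have T: "T \<in> measurable leb01 leb01" "distr leb01 leb01 T = leb01"
    using assms(1) by (auto simp: pres_def)
  show ?thesis
    by (rule AE_distrD[OF T(1)]) (subst T(2), rule assms(2))
qed

lemma mpt_pres: "T \<in> mpt \<Longrightarrow> pres T"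
  by (simp add: mpt_def pres_def)

lemma mpt_inv_pres:
  assumes "T \<in> mpt"
  shows "pres (inv_into {0..1} T)"
proof -
  let ?U = "inv_into {0..1} T"
  have T: "bij_betw T {0..1} {0..1}" "T \<in> measurable leb01 leb01"
      "?U \<in> measurable leb01 leb01" "distr leb01 leb01 T = leb01"
    using assms by (auto simp: mpt_def)
  have "distr leb01 leb01 ?U = distr (distr leb01 leb01 T) leb01 ?U"
    by (simp add: T(4))
  also have "\<dots> = distr leb01 leb01 (?U \<circ> T)"
    by (rule distr_distr[OF T(3,2)])
  also have "\<dots> = distr leb01 leb01 (\<lambda>x. x)"
    by (rule distr_cong) (use T(1) in \<open>auto simp: bij_betw_inv_into_left\<close>)
  also have "\<dots> = leb01"
    by (simp add: distr_id)
  finally show ?thesis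
    using T(3) by (simp add: pres_def)
qed

lemma mpt_eq_funpow:
  assumes "pres S" "pres T" "AE x in leb01. S x = T x"
  shows "AE x in leb01. (S ^^ n) x = (T ^^ n) x"
proof (induction n)
  case (Suc n)
  have "AE x in leb01. S ((T ^^ n) x) = T ((T ^^ n) x)"
    by (rule pres_AE[OF pres_funpow[OF assms(2)] assms(3)])
  with Suc show ?case
    by eventually_elim simp
qed simp

lemma mpt_eq_inv:
  assumes "mpt_eq S T"
  shows "AE x in leb01. inv_into {0..1} S x = inv_into {0..1} T x"
proof -
  have ST: "S \<in> mpt" "T \<in> mpt" "AE x in leb01. S x = T x"
    using assms by (auto simp: mpt_eq_def)
  have bij: "bij_betw S {0..1} {0..1}" "bij_betw T {0..1} {0..1}"
    using ST by (auto simp: mpt_def)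
  have "AE y in leb01. S (inv_into {0..1} S y) = T (inv_into {0..1} S y)"
    by (rule pres_AE[OF mpt_inv_pres[OF ST(1)] ST(3)])
  moreover have "AE y in leb01. y \<in> {0..1}"
    using AE_space[of leb01] by simp
  ultimately show ?thesis
  proof eventually_elim
    case (elim y)
    let ?x = "inv_into {0..1} S y"
    have "?x \<in> {0..1}" and "S ?x = y"
      using bij(1) elim(2) inv_into_into[of y S "{0..1}"] f_inv_into_f[of y S "{0..1}"]
      by (simp_all add: bij_betw_def)
    then have "inv_into {0..1} T (T ?x) = ?x"
      using bij(2) by (simp add: bij_betw_inv_into_left)
    with elim(1) \<open>S ?x = y\<close> show ?case
      by simp
  qed
qed

lemma mpt_int_iter_pres: "T \<in> mpt \<Longrightarrow> pres (int_iter T m)"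
  by (simp add: int_iter_def mpt_pres mpt_inv_pres pres_funpow)

lemma mpt_eq_int_iter:
  assumes "mpt_eq S T"
  shows "AE x in leb01. int_iter S m x = int_iter T m x"
proof -
  have ST: "S \<in> mpt" "T \<in> mpt" "AE x in leb01. S x = T x"
    using assms by (auto simp: mpt_eq_def)
  show ?thesis
    unfolding int_iter_def
    using mpt_eq_funpow[OF mpt_pres mpt_pres, OF ST, of "nat m"]
      mpt_eq_funpow[OF mpt_inv_pres mpt_inv_pres, OF ST(1,2) mpt_eq_inv[OF assms], of "nat (- m)"]
    by simp
qed

lemma preimage_iter_sets:
  assumes "T \<in> mpt" "B \<in> sets leb01"
  shows "preimage_iter T m B \<in> sets leb01"
proof -
  have "int_iter T m -` B \<inter> space leb01 \<in> sets leb01"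
    by (rule measurable_sets[OF _ assms(2)])
      (use mpt_int_iter_pres[OF assms(1)] in \<open>auto simp: pres_def\<close>)
  moreover have "int_iter T m -` B \<inter> space leb01 = preimage_iter T m B"
    by (auto simp: preimage_iter_def)
  ultimately show ?thesis
    by simp
qed

lemma measure_preimage_iter_cong:
  assumes "mpt_eq S T" "A \<in> sets leb01" "B \<in> sets leb01"
  shows "measure leb01 (A \<inter> preimage_iter S m B) = measure leb01 (A \<inter> preimage_iter T m B)"
proof (rule measure_eq_AE)
  show "AE x in leb01. x \<in> A \<inter> preimage_iter S m B \<longleftrightarrow> x \<in> A \<inter> preimage_iter T m B"
    using mpt_eq_int_iter[OF assms(1), of m]
    by eventually_elim (simp add: preimage_iter_def)
qed (use assms in \<open>auto intro!: sets.Int preimage_iter_sets simp: mpt_eq_def\<close>)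

lemma periodic_points_sets:
  assumes "T \<in> mpt"
  shows "{x \<in> {0..1}. \<exists>n\<ge>1. (T ^^ n) x = x} \<in> sets leb01"
proof -
  have "{x \<in> space leb01. (T ^^ n) x = x} \<in> sets leb01" for n
  proof -
    have "(\<lambda>x. x) \<in> borel_measurable leb01"
      by (simp add: leb01_def measurable_restrict_space1)
    moreover have "T ^^ n \<in> borel_measurable leb01"
    proof -
      have "T ^^ n \<in> measurable leb01 leb01"
        using pres_funpow[OF mpt_pres[OF assms]] by (simp add: pres_def)
      from measurable_comp[OF this \<open>(\<lambda>x. x) \<in> borel_measurable leb01\<close>] show ?thesis
        by (simp add: comp_def)
    qed
    ultimately show ?thesis
      by measurable
  qed
  then have "(\<Union>n\<in>{1..}. {x \<in> space leb01. (T ^^ n) x = x}) \<in> sets leb01"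
    by (intro sets.countable_UN'') auto
  moreover have "(\<Union>n\<in>{1..}. {x \<in> space leb01. (T ^^ n) x = x}) =
      {x \<in> {0..1}. \<exists>n\<ge>1. (T ^^ n) x = x}"
    by auto
  ultimately show ?thesis
    by simp
qed

lemma periodic_points_null_cong:
  assumes "mpt_eq S T" "{x \<in> {0..1}. \<exists>n\<ge>1. (S ^^ n) x = x} \<in> null_sets leb01"
  shows "{x \<in> {0..1}. \<exists>n\<ge>1. (T ^^ n) x = x} \<in> null_sets leb01"
proof -
  have "AE x in leb01. \<forall>n. (S ^^ n) x = (T ^^ n) x"
    unfolding AE_all_countable
    using assms(1) mpt_eq_funpow[OF mpt_pres mpt_pres] unfolding mpt_eq_def by blast
  moreover have "AE x in leb01. x \<notin> {x \<in> {0..1}. \<exists>n\<ge>1. (S ^^ n) x = x}"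
    by (rule AE_not_in[OF assms(2)])
  ultimately have "AE x in leb01. x \<notin> {x \<in> {0..1}. \<exists>n\<ge>1. (T ^^ n) x = x}"
    by eventually_elim simp
  moreover have "{x \<in> {0..1}. \<exists>n\<ge>1. (T ^^ n) x = x} \<in> sets leb01"
    using assms(1) by (intro periodic_points_sets) (simp add: mpt_eq_def)
  ultimately show ?thesis
    using AE_iff_null_sets by blast
qed


section \<open>Aperiodicity and limits of correlations\<close>

lift_definition aperiodic :: "aut \<Rightarrow> bool" is
  "\<lambda>T. {x \<in> {0..1}. \<exists>n\<ge>1. (T ^^ n) x = x} \<in> null_sets leb01"
proof -
  fix S T assume ST: "mpt_eq S T"
  then have TS: "mpt_eq T S"
    by (auto simp: mpt_eq_def elim: AE_mp)
  show "({x \<in> {0..1}. \<exists>n\<ge>1. (S ^^ n) x = x} \<in> null_sets leb01) =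
        ({x \<in> {0..1}. \<exists>n\<ge>1. (T ^^ n) x = x} \<in> null_sets leb01)"
    using periodic_points_null_cong[OF ST] periodic_points_null_cong[OF TS] by blast
qed

text \<open>\<open>mixes_along T m c\<close>: along the exponents \<open>m k\<close>, the correlations of \<open>T\<close> converge to the
  convex combination, with weight \<open>c\<close>, of those of the identity and of a mixing map.\<close>

lift_definition mixes_along :: "aut \<Rightarrow> (nat \<Rightarrow> int) \<Rightarrow> real \<Rightarrow> bool" is
  "\<lambda>T m c. \<forall>A\<in>sets leb01. \<forall>B\<in>sets leb01.
     (\<lambda>k. measure leb01 (A \<inter> preimage_iter T (m k) B)) \<longlonglongrightarrow>
       (1 - c) * measure leb01 (A \<inter> B) + c * (measure leb01 A * measure leb01 B)"
  by (simp add: measure_preimage_iter_cong cong: ball_cong)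


section \<open>The weak topology\<close>

definition L2 :: "(real \<Rightarrow> real) set" where
  "L2 = {f \<in> borel_measurable leb01. integrable leb01 (\<lambda>x. (f x)\<^sup>2)}"

text \<open>
  The nonnegative integral depends only on the almost-everywhere class of its argument even
  without measurability, which is what lifting to \<open>aut\<close> requires.
\<close>

definition L2norm :: "(real \<Rightarrow> real) \<Rightarrow> real" where
  "L2norm f = sqrt (enn2real (\<integral>\<^sup>+ x. ennreal ((f x)\<^sup>2) \<partial>leb01))"

lemma L2norm_eq: "f \<in> L2 \<Longrightarrow> L2norm f = sqrt (LINT x|leb01. (f x)\<^sup>2)"
  unfolding L2norm_def L2_def
  by (subst nn_integral_eq_integral) auto

text \<open>The distance of \<open>S f = f \<circ> S\<close> and \<open>T f = f \<circ> T\<close> in \<open>L\<^sup>2\<close>.\<close>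

lift_definition koopman_dist :: "(real \<Rightarrow> real) \<Rightarrow> aut \<Rightarrow> aut \<Rightarrow> real" is
  "\<lambda>f S T. L2norm (\<lambda>x. f (S x) - f (T x))"
proof -
  fix f S S' T T' assume "mpt_eq S S'" "mpt_eq T T'"
  then have "AE x in leb01. S x = S' x" "AE x in leb01. T x = T' x"
    by (auto simp: mpt_eq_def)
  then have "AE x in leb01. ennreal ((f (S x) - f (T x))\<^sup>2) = ennreal ((f (S' x) - f (T' x))\<^sup>2)"
    by eventually_elim simp
  then show "L2norm (\<lambda>x. f (S x) - f (T x)) = L2norm (\<lambda>x. f (S' x) - f (T' x))"
    unfolding L2norm_def by (subst nn_integral_cong_AE) auto
qed

instantiation aut :: topological_space
begin

text \<open>
  The coarsest topology for which all orbit maps \<open>T \<mapsto> f \<circ> T\<close> into \<open>L\<^sup>2\<close> are continuous;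
  see \<open>tendsto_aut_iff\<close> below for convergence.  Complex-valued \<open>f\<close> would give the same topology.
\<close>

definition open_aut :: "aut set \<Rightarrow> bool" where
  "open_aut = generate_topology {{S. koopman_dist f S T < e} |f T e. f \<in> L2 \<and> 0 < e}"

instance
  using topological_space_generate_topology
  by intro_classes (auto simp: open_aut_def class.topological_space_def)

end

lemma L2_triangle:
  assumes "g \<in> L2" "h \<in> L2"
  shows "L2norm (\<lambda>x. g x + h x) \<le> L2norm g + L2norm h"
proof -
  have meas [measurable]: "g \<in> borel_measurable leb01" "h \<in> borel_measurable leb01"
    and int: "integrable leb01 (\<lambda>x. (g x)\<^sup>2)" "integrable leb01 (\<lambda>x. (h x)\<^sup>2)"
    using assms by (auto simp: L2_def)
  have gh: "integrable leb01 (\<lambda>x. g x * h x)"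
  proof (rule Bochner_Integration.integrable_bound)
    show "integrable leb01 (\<lambda>x. (g x)\<^sup>2 + (h x)\<^sup>2)"
      using int by simp
    have "\<bar>a * b\<bar> \<le> a\<^sup>2 + b\<^sup>2" for a b :: real
    proof -
      have "2 * \<bar>a\<bar> * \<bar>b\<bar> \<le> a\<^sup>2 + b\<^sup>2"
        using sum_squares_bound[of "\<bar>a\<bar>" "\<bar>b\<bar>"] by simp
      moreover have "0 \<le> \<bar>a\<bar> * \<bar>b\<bar>"
        by simp
      ultimately show ?thesis
        unfolding abs_mult by linarith
    qed
    then show "AE x in leb01. norm (g x * h x) \<le> norm ((g x)\<^sup>2 + (h x)\<^sup>2)"
      by simp
  qed measurable
  have sq: "(g x + h x)\<^sup>2 = (g x)\<^sup>2 + 2 * (g x * h x) + (h x)\<^sup>2" for x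
    by (simp add: power2_sum)
  have "(\<lambda>x. g x + h x) \<in> L2"
    using int gh by (simp add: L2_def sq)
  note n = L2norm_eq[OF this] L2norm_eq[OF assms(1)] L2norm_eq[OF assms(2)]
  define a b c where "a = (LINT x|leb01. (g x)\<^sup>2)" and "b = (LINT x|leb01. (h x)\<^sup>2)"
    and "c = (LINT x|leb01. g x * h x)"
  have ab: "0 \<le> a" "0 \<le> b"
    by (simp_all add: a_def b_def)
  have eq: "(LINT x|leb01. (g x + h x)\<^sup>2) = a + 2 * c + b"
    using int gh by (simp add: sq a_def b_def c_def)
  have quad: "0 \<le> s\<^sup>2 * a - 2 * s * t * c + t\<^sup>2 * b" for s t
  proof -
    have "0 \<le> (LINT x|leb01. (s * g x - t * h x)\<^sup>2)"
      by simp
    also have "(\<lambda>x. (s * g x - t * h x)\<^sup>2) =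
        (\<lambda>x. s\<^sup>2 * (g x)\<^sup>2 - 2 * s * t * (g x * h x) + t\<^sup>2 * (h x)\<^sup>2)"
      by (auto simp: power2_diff power_mult_distrib)
    also have "(LINT x|leb01. s\<^sup>2 * (g x)\<^sup>2 - 2 * s * t * (g x * h x) + t\<^sup>2 * (h x)\<^sup>2) =
        s\<^sup>2 * a - 2 * s * t * c + t\<^sup>2 * b"
      using int gh by (simp add: a_def b_def c_def)
    finally show ?thesis .
  qed
  have "c \<le> sqrt a * sqrt b"
  proof (cases "a = 0 \<or> b = 0")
    case False
    then have pos: "0 < sqrt a" "0 < sqrt b"
      using ab by auto
    have "0 \<le> b * a - 2 * sqrt b * sqrt a * c + a * b"
      using quad[of "sqrt b" "sqrt a"] ab by simp
    then have "(sqrt a * sqrt b) * c \<le> (sqrt a * sqrt b) * (sqrt a * sqrt b)"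
      using ab by (simp add: algebra_simps)
    then show ?thesis
      using pos by simp
  next
    case True
    have "c \<le> 0"
    proof (rule ccontr)
      assume "\<not> c \<le> 0"
      then have c: "0 < c" by simp
      from True show False
      proof
        assume "a = 0"
        then show False
          using quad[of "(b + 1) / c" 1] c ab by simp
      next
        assume "b = 0"
        then show False
          using quad[of 1 "(a + 1) / c"] c ab by simp
      qed
    qed
    with ab True show ?thesis
      by auto
  qed
  then have "a + 2 * c + b \<le> (sqrt a + sqrt b)\<^sup>2"
    using ab by (simp add: power2_sum)
  then show ?thesis
    unfolding n eq a_def[symmetric] b_def[symmetric] by (intro real_le_lsqrt) (use ab in auto)
qed

lemma L2_comp_diff:
  assumes "f \<in> L2" "S \<in> mpt" "T \<in> mpt"
  shows "(\<lambda>x. f (S x) - f (T x)) \<in> L2"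
proof -
  have *: "(\<lambda>x. f (U x)) \<in> L2" if "U \<in> mpt" for U
  proof -
    have U: "U \<in> measurable leb01 leb01" "distr leb01 leb01 U = leb01"
      using that by (auto simp: mpt_def)
    have "integrable leb01 (\<lambda>x. (f (U x))\<^sup>2)"
      using assms(1) U by (subst integrable_distr_eq[OF U(1), symmetric]) (auto simp: L2_def)
    then show ?thesis
      using assms(1) measurable_compose[OF U(1)] by (auto simp: L2_def)
  qed
  let ?g = "\<lambda>x. f (S x)" and ?h = "\<lambda>x. f (T x)"
  have gh: "?g \<in> L2" "?h \<in> L2"
    using * assms by auto
  then have [measurable]: "?g \<in> borel_measurable leb01" "?h \<in> borel_measurable leb01"
    by (auto simp: L2_def)
  have "integrable leb01 (\<lambda>x. (?g x - ?h x)\<^sup>2)"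
  proof (rule Bochner_Integration.integrable_bound)
    show "integrable leb01 (\<lambda>x. 2 * (?g x)\<^sup>2 + 2 * (?h x)\<^sup>2)"
      using gh by (simp add: L2_def)
    have "(a - b)\<^sup>2 \<le> 2 * a\<^sup>2 + 2 * b\<^sup>2" for a b :: real
      using zero_le_power2[of "a + b"] unfolding power2_diff power2_sum by linarith
    then show "AE x in leb01. norm ((?g x - ?h x)\<^sup>2) \<le> norm (2 * (?g x)\<^sup>2 + 2 * (?h x)\<^sup>2)"
      by simp
  qed measurable
  then show ?thesis
    by (simp add: L2_def)
qed

lemma koopman_dist_triangle:
  "f \<in> L2 \<Longrightarrow> koopman_dist f R T \<le> koopman_dist f R S + koopman_dist f S T"
proof transfer
  fix f R T S
  assume "f \<in> L2" "mpt_eq R R" "mpt_eq T T" "mpt_eq S S"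
  then show "L2norm (\<lambda>x. f (R x) - f (T x)) \<le>
      L2norm (\<lambda>x. f (R x) - f (S x)) + L2norm (\<lambda>x. f (S x) - f (T x))"
    using L2_triangle[OF L2_comp_diff L2_comp_diff, of f R S f S T]
    by (simp add: mpt_eq_def)
qed

lemma koopman_dist_self [simp]: "koopman_dist f T T = 0"
  by transfer (simp add: L2norm_def)

lemma koopman_dist_nonneg [simp]: "0 \<le> koopman_dist f S T"
  by transfer (simp add: L2norm_def)

lemma tendsto_aut_iff:
  "((X \<longlongrightarrow> T) F) \<longleftrightarrow> (\<forall>f\<in>L2. ((\<lambda>i. koopman_dist f (X i) T) \<longlongrightarrow> 0) F)" for T :: aut
proof -
  let ?B = "{{S. koopman_dist f S T < e} |f T e. f \<in> L2 \<and> 0 < e}"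
  have "(X \<longlongrightarrow> T) F \<longleftrightarrow> (\<forall>U\<in>?B. T \<in> U \<longrightarrow> (\<forall>\<^sub>F i in F. X i \<in> U))"
    by (subst nhds_generated_topology[OF open_aut_def])
      (auto simp: filterlim_INF filterlim_principal)
  also have "\<dots> \<longleftrightarrow> (\<forall>f\<in>L2. \<forall>e>0. \<forall>\<^sub>F i in F. koopman_dist f (X i) T < e)" (is "?L \<longleftrightarrow> ?R")
  proof
    assume L: ?L
    show ?R
    proof (intro ballI allI impI)
      fix f and e :: real assume "f \<in> L2" "0 < e"
      then have "{S. koopman_dist f S T < e} \<in> ?B"
        by blast
      from bspec[OF L this] \<open>0 < e\<close> show "\<forall>\<^sub>F i in F. koopman_dist f (X i) T < e"
        by simp
    qed
  next
    assume R: ?R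
    show ?L
    proof (intro ballI impI)
      fix U assume "U \<in> ?B" "T \<in> U"
      then obtain f S e where f: "f \<in> L2" and U: "U = {R. koopman_dist f R S < e}"
          and lt: "koopman_dist f T S < e"
        by blast
      have "\<forall>\<^sub>F i in F. koopman_dist f (X i) T < e - koopman_dist f T S"
        using R f lt by simp
      then show "\<forall>\<^sub>F i in F. X i \<in> U"
      proof eventually_elim
        case (elim i)
        then show ?case
          using koopman_dist_triangle[OF f, of "X i" S T] by (simp add: U)
      qed
    qed
  qed
  also have "\<dots> \<longleftrightarrow> (\<forall>f\<in>L2. ((\<lambda>i. koopman_dist f (X i) T) \<longlongrightarrow> 0) F)"
    by (simp add: tendsto_iff)
  finally show ?thesis .
qed

end

theory Submission
  imports Defs
begin

text \<open>
  By rearranging pieces of the interval one gets a transformation \<open>W\<close> that preserves a partition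
  into sets of measure \<open>p\<^sub>\<xi>\<close> and acts on each of them as a copy of \<open>T\<^sub>\<xi>\<close>; here \<open>\<xi>\<close> is the random
  pattern \<open>\<xi>\<^sub>j = 1\<close> iff \<open>x < \<lambda>\<^sub>j\<close>, with \<open>x\<close> uniform.  For sets \<open>A\<close>, \<open>B\<close> independent of
  this partition the correlations of \<open>W\<close> along \<open>\<phi>\<^sub>j(n\<^sub>k)\<close> converge to the weighted average over \<open>\<xi>\<close>
  of the limits for \<open>T\<^sub>\<xi>\<close>, which is the desired limit.  Matching Rokhlin towers, a conjugate
  of \<open>W\<close> agrees with any given aperiodic \<open>T\<close> off a small set, and splitting the base of
  the tower finely makes the partition independent of finitely many prescribed sets.
  Iterating this with summable errors gives a sequence that converges in the uniform metric
  \<open>\<mu> {S \<noteq> T}\<close> to an element of the set in question.  This replaces the Baire category theorem.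
  The first term of the sequence is weakly close to an arbitrary transformation and has a tower
  by construction.
\<close>

text \<open>The mean of the limits over the components of \<open>W\<close> has the required form
  only for sets that meet every component in proportion; for other sets the product terms involve
  relative measures. A component is in general not independent of itself, so no single conjugate
  does this for all sets, and stage \<open>l\<close> of the iteration treats only the finite algebra
  \<open>dyadics l\<close>. The order of choices at a stage is essential: a map whose correlations
  converge on \<open>dyadics l\<close>, a time beyond the previous one at which they are within
  \<open>1 / Suc l\<close> of the target, and only then the tolerance for later changes. For a
  correlation at time \<open>m\<close> is Lipschitz in the uniform metric with constant
  \<open>|m|\<close>, and the exponents may grow arbitrarily fast. In return this metric makes the
  limit easy: the images of almost every point are eventually constant, and inversion is an
  isometry, so the inverses converge too. Matching towers of height \<open>n\<close> that cover all
  but \<open>d\<close> costs at most \<open>d + 1 / n\<close>: the uncovered part and the top level,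
  where the conjugate need not follow the given map.\<close>

abbreviation \<mu> :: "real set \<Rightarrow> real" where
  "\<mu> \<equiv> measure leb01"

abbreviation sets01 :: "real set set" ("\<B>") where
  "\<B> \<equiv> sets leb01"

abbreviation meas01 :: "(real \<Rightarrow> real) set" where
  "meas01 \<equiv> measurable leb01 leb01"

abbreviation preim :: "(real \<Rightarrow> 'a) \<Rightarrow> 'a set \<Rightarrow> real set" where
  "preim f B \<equiv> {x \<in> {0..1}. f x \<in> B}"

abbreviation disagree :: "(real \<Rightarrow> 'a) \<Rightarrow> (real \<Rightarrow> 'a) \<Rightarrow> real set" where
  "disagree f g \<equiv> {x \<in> {0..1}. f x \<noteq> g x}"

abbreviation inv01 :: "(real \<Rightarrow> real) \<Rightarrow> real \<Rightarrow> real" where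
  "inv01 T \<equiv> inv_into {0..1} T"

section \<open>Lebesgue measure on the unit interval and maps that preserve it\<close>

interpretation leb01: finite_measure leb01
  by standard (simp add: emeasure_space_leb01 flip: space_leb01)

lemma measure_leb01_UNIV [simp]: "\<mu> {0..1} = 1"
  using emeasure_space_leb01 by (simp add: measure_def)

lemma sets_leb01: "A \<in> \<B> \<longleftrightarrow> A \<in> sets borel \<and> A \<subseteq> {0..1}"
  by (auto simp: leb01_def sets_restrict_space_iff)

lemma top_sets01 [simp]: "{0..1} \<in> \<B>"
  using sets.top[of leb01] by simp

lemma measure_leb01_eq: "A \<in> \<B> \<Longrightarrow> \<mu> A = measure lborel A"
  by (simp add: leb01_def sets_leb01[unfolded leb01_def] measure_restrict_space)

lemma sets_leb01_I: "A \<in> sets borel \<Longrightarrow> A \<inter> {0..1} \<in> \<B>"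
  by (simp add: sets_leb01)

lemma measurable_leb01_iff:
  "f \<in> meas01 \<longleftrightarrow> f \<in> borel_measurable leb01 \<and> (\<forall>x\<in>{0..1}. f x \<in> {0..1})"
proof -
  have "f \<in> meas01 \<longleftrightarrow> f \<in> measurable leb01 (restrict_space lborel {0..1})"
    by (simp add: leb01_def)
  also have "\<dots> \<longleftrightarrow> f \<in> borel_measurable leb01 \<and> (\<forall>x\<in>{0..1}. f x \<in> {0..1})"
    by (auto simp: measurable_restrict_space2_iff Pi_iff)
  finally show ?thesis .
qed

lemma borel_measurable_leb01 [measurable_dest]:
  "f \<in> meas01 \<Longrightarrow> f \<in> borel_measurable leb01"
  by (simp add: measurable_leb01_iff)

lemma meas_in_01: "f \<in> meas01 \<Longrightarrow> x \<in> {0..1} \<Longrightarrow> f x \<in> {0..1}"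
  by (simp add: measurable_leb01_iff)

lemma id_measurable_leb01 [measurable]: "(\<lambda>x. x) \<in> borel_measurable leb01"
  by (simp add: leb01_def measurable_restrict_space1)

lemma preim_sets:
  assumes "f \<in> meas01" "B \<in> \<B>"
  shows "preim f B \<in> \<B>"
proof -
  have "f -` B \<inter> space leb01 = preim f B"
    by auto
  then show ?thesis
    using measurable_sets[OF assms] by simp
qed

lemma AE_leb01_I: "{x \<in> {0..1}. \<not> P x} \<in> \<B> \<Longrightarrow> \<mu> {x \<in> {0..1}. \<not> P x} = 0 \<Longrightarrow> AE x in leb01. P x"
  by (rule AE_I[where N = "{x \<in> {0..1}. \<not> P x}"]) (auto simp: leb01.emeasure_eq_measure)

lemma measure_mono_AE01:
  assumes "AE x in leb01. x \<in> A \<longrightarrow> x \<in> B" "B \<in> \<B>" "A \<in> \<B>"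
  shows "\<mu> A \<le> \<mu> B"
  using leb01.finite_measure_mono_AE[OF assms(1,2)] .

lemma measure_zero_AE:
  assumes "AE x in leb01. x \<notin> A"
  shows "\<mu> A = 0"
proof (cases "A \<in> \<B>")
  case True
  then have "\<mu> A \<le> \<mu> {}"
    using assms by (intro measure_mono_AE01) auto
  then show ?thesis
    using measure_nonneg[of leb01 A] by simp
\<comment> \<open>Outside the sigma-algebra \<open>measure\<close> has the default value 0.\<close>
qed (simp add: measure_notin_sets)

lemma AE_in_01: "AE x in leb01. x \<in> {0..1}"
  using AE_space[of leb01] by simp

lemma pres_measure:
  assumes "pres f" "B \<in> \<B>"
  shows "\<mu> (preim f B) = \<mu> B"
proof -
  have f: "f \<in> meas01" "distr leb01 leb01 f = leb01"
    using assms by (auto simp: pres_def)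
  have "\<mu> B = measure (distr leb01 leb01 f) B"
    by (simp add: f)
  also have "\<dots> = \<mu> (f -` B \<inter> space leb01)"
    by (rule measure_distr) (use f assms in auto)
  also have "f -` B \<inter> space leb01 = preim f B"
    by auto
  finally show ?thesis ..
qed

lemma presI:
  assumes f: "f \<in> meas01"
    and "\<And>B. B \<in> \<B> \<Longrightarrow> \<mu> (preim f B) = \<mu> B"
  shows "pres f"
  unfolding pres_def
proof
  show "distr leb01 leb01 f = leb01"
  proof (rule measure_eqI)
    fix B assume "B \<in> sets (distr leb01 leb01 f)"
    then have B: "B \<in> \<B>" by simp
    have "f -` B \<inter> space leb01 = preim f B"
      by auto
    then show "emeasure (distr leb01 leb01 f) B = emeasure leb01 B"
      using assms(2)[OF B] by (simp add: emeasure_distr f B leb01.emeasure_eq_measure)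
  qed simp
qed (rule f)

text \<open>An upper bound for every set, applied to the complement, is also a lower bound, because
  the total mass is the same on both sides. One inequality is what approximation and piecewise
  arguments yield.\<close>

lemma presI_le:
  assumes f: "f \<in> meas01"
    and le: "\<And>B. B \<in> \<B> \<Longrightarrow> \<mu> (preim f B) \<le> \<mu> B"
  shows "pres f"
proof (rule presI[OF f])
  fix B assume B: "B \<in> \<B>"
  let ?p = "\<lambda>B. preim f B"
  have p: "?p B \<in> \<B>"
    by (rule preim_sets[OF f B])
  have "?p (space leb01 - B) = space leb01 - ?p B"
    using f by (auto simp: measurable_leb01_iff)
  then have "\<mu> (space leb01) - \<mu> (?p B) \<le> \<mu> (space leb01) - \<mu> B"
    using le[OF sets.compl_sets[OF B]] leb01.finite_measure_compl[OF B]
      leb01.finite_measure_compl[OF p] by metis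
  with le[OF B] show "\<mu> (?p B) = \<mu> B"
    by simp
qed

lemma pres_meas: "pres f \<Longrightarrow> f \<in> meas01"
  by (simp add: pres_def)

lemma pres_cong_AE:
  assumes "pres f" "g \<in> meas01" "AE x in leb01. g x = f x"
  shows "pres g"
proof -
  have "distr leb01 leb01 g = distr leb01 leb01 f"
    by (rule distr_cong_AE) (use assms pres_meas in auto)
  with assms(1,2) show ?thesis
    by (simp add: pres_def)
qed

section \<open>Invertible transformations, exactly and up to null sets\<close>

lemma mpt_iff:
  "T \<in> mpt \<longleftrightarrow> bij_betw T {0..1} {0..1} \<and> pres T \<and> inv01 T \<in> meas01"
  by (auto simp: mpt_def pres_def)

lemma mptI:
  assumes "pres T" "g \<in> meas01"
    and "\<And>x. x \<in> {0..1} \<Longrightarrow> g (T x) = x" "\<And>x. x \<in> {0..1} \<Longrightarrow> T (g x) = x"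
  shows "T \<in> mpt"
proof -
  have b: "bij_betw T {0..1} {0..1}"
    by (rule bij_betw_byWitness[where f' = g])
       (use assms meas_in_01[OF pres_meas[OF assms(1)]]
          meas_in_01[OF assms(2)] in auto)
  moreover have "inv01 T x = g x" if "x \<in> {0..1}" for x
    using that assms(4)[OF that] meas_in_01[OF assms(2) that] b
    by (metis bij_betw_inv_into_left)
  then have "inv01 T \<in> meas01"
    using assms(2) by (subst measurable_cong[where g = g]) auto
  ultimately show ?thesis
    using assms(1) by (simp add: mpt_iff)
qed

lemma mpt_meas: "T \<in> mpt \<Longrightarrow> T \<in> meas01"
  by (simp add: mpt_def)

lemma mpt_in: "T \<in> mpt \<Longrightarrow> x \<in> {0..1} \<Longrightarrow> T x \<in> {0..1}"
  using meas_in_01 mpt_meas by blast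

lemma mpt_inv_meas: "T \<in> mpt \<Longrightarrow> inv01 T \<in> meas01"
  by (simp add: mpt_def)

lemma mpt_inv_in: "T \<in> mpt \<Longrightarrow> x \<in> {0..1} \<Longrightarrow> inv01 T x \<in> {0..1}"
  using meas_in_01 mpt_inv_meas by blast

lemma mpt_inv_left: "T \<in> mpt \<Longrightarrow> x \<in> {0..1} \<Longrightarrow> inv01 T (T x) = x"
  using bij_betw_inv_into_left by (fastforce simp only: mpt_iff)

lemma mpt_inv_right: "T \<in> mpt \<Longrightarrow> x \<in> {0..1} \<Longrightarrow> T (inv01 T x) = x"
  using bij_betw_inv_into_right by (fastforce simp only: mpt_iff)

lemma mpt_inv: "T \<in> mpt \<Longrightarrow> inv01 T \<in> mpt"
  by (rule mptI[where g = T]) (auto simp: mpt_inv_pres mpt_meas mpt_inv_left mpt_inv_right)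

lemma mpt_inv_inv: "T \<in> mpt \<Longrightarrow> x \<in> {0..1} \<Longrightarrow> inv01 (inv01 T) x = T x"
  by (metis mpt_inv mpt_inv_left mpt_inv_right mpt_in)

lemma mpt_comp: "S \<in> mpt \<Longrightarrow> T \<in> mpt \<Longrightarrow> S \<circ> T \<in> mpt"
  by (rule mptI[where g = "inv01 T \<circ> inv01 S"])
     (auto simp: pres_comp mpt_pres mpt_inv_left mpt_inv_right mpt_in mpt_inv_in
       simp del: atLeastAtMost_iff intro!: measurable_comp mpt_inv_meas)

lemma mpt_funpow: "T \<in> mpt \<Longrightarrow> T ^^ n \<in> mpt"
  using id_in_mpt by (induction n) (auto simp: mpt_comp id_def)

lemma mpt_int_iter: "T \<in> mpt \<Longrightarrow> int_iter T m \<in> mpt"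
  by (simp add: int_iter_def mpt_funpow mpt_inv)

lemma neq_sets:
  assumes "f \<in> meas01" "g \<in> meas01"
  shows "disagree f g \<in> \<B>"
proof -
  have [measurable]: "f \<in> borel_measurable leb01" "g \<in> borel_measurable leb01"
    using assms by auto
  have "{x \<in> space leb01. f x \<noteq> g x} \<in> \<B>"
    by measurable
  then show ?thesis by simp
qed

lemma eq_sets:
  assumes "f \<in> meas01" "g \<in> meas01"
  shows "{x \<in> {0..1}. f x = g x} \<in> \<B>"
proof -
  have "{x \<in> {0..1}. f x = g x} = {0..1} - disagree f g"
    by auto
  then show ?thesis
    using sets.Diff[OF top_sets01 neq_sets[OF assms]] by simp
qed

text \<open>As \<open>f\<close> preserves the measure, the law of \<open>g\<close> is that of
  \<open>g \<circ> f\<close>, the identity. Moreover \<open>f (g (f x)) = f x\<close> almost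
  everywhere, so the exceptional set of \<open>f \<circ> g\<close> has a null preimage under
  \<open>f\<close> and is itself null.\<close>

lemma pres_left_inverse:
  assumes f: "pres f" and g: "g \<in> meas01" and gf: "AE x in leb01. g (f x) = x"
  shows "pres g" "AE x in leb01. f (g x) = x"
proof -
  have fm: "f \<in> meas01" and fd: "distr leb01 leb01 f = leb01"
    using f by (auto simp: pres_def)
  have "distr leb01 leb01 g = distr (distr leb01 leb01 f) leb01 g"
    by (simp add: fd)
  also have "\<dots> = distr leb01 leb01 (g \<circ> f)"
    by (rule distr_distr[OF g fm])
  also have "\<dots> = distr leb01 leb01 (\<lambda>x. x)"
    by (rule distr_cong_AE) (use gf g fm in auto)
  finally show "pres g"
    using g by (simp add: pres_def distr_id)
  let ?N = "disagree (\<lambda>x. f (g x)) (\<lambda>x. x)"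
  have N: "?N \<in> \<B>"
    using neq_sets[OF measurable_comp[OF g fm] measurable_ident[of leb01]] by simp
  have "\<mu> (preim f ?N) = 0"
    using gf by (intro measure_zero_AE) (auto elim: AE_mp)
  then show "AE x in leb01. f (g x) = x"
    using pres_measure[OF f N] N by (intro AE_leb01_I) simp_all
qed

text \<open>On the set where all iterates of \<open>f\<close> and \<open>g\<close> are mutually inverse, \<open>f\<close> is a
  bijection; off this null set the identity takes over.\<close>

lemma mpt_of_left_inverse:
  assumes f: "pres f" and g: "g \<in> meas01" and gf: "AE x in leb01. g (f x) = x"
  shows "\<exists>T\<in>mpt. AE x in leb01. T x = f x"
proof -
  note fm = pres_meas[OF f]
  have pg: "pres g" and fg: "AE x in leb01. f (g x) = x"
    using pres_left_inverse[OF assms] by auto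
  define good where "good x \<longleftrightarrow> g (f x) = x \<and> f (g x) = x" for x
  define X where "X = {x \<in> {0..1}. \<forall>n. good ((f ^^ n) x) \<and> good ((g ^^ n) x)}"
  have AE_good: "AE x in leb01. good x"
    using gf fg by eventually_elim (simp add: good_def)
  have "AE x in leb01. \<forall>n. good ((f ^^ n) x) \<and> good ((g ^^ n) x)"
    unfolding AE_all_countable
    using pres_AE[OF pres_funpow[OF f] AE_good] pres_AE[OF pres_funpow[OF pg] AE_good]
    by (auto intro: AE_conjI)
  then have AE_X: "AE x in leb01. x \<in> X"
    using AE_in_01 by eventually_elim (simp add: X_def)
  have good_sets: "{x \<in> {0..1}. good x} \<in> \<B>"
  proof -
    have "{x \<in> {0..1}. good x} = {x \<in> {0..1}. (g \<circ> f) x = id x} \<inter> {x \<in> {0..1}. (f \<circ> g) x = id x}"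
      by (auto simp: good_def)
    then show ?thesis
      using eq_sets[OF measurable_comp[OF fm g] measurable_id]
        eq_sets[OF measurable_comp[OF g fm] measurable_id] by auto
  qed
  have X_sets: "X \<in> \<B>"
  proof -
    have sp: "(f ^^ n) x \<in> {0..1}" "(g ^^ n) x \<in> {0..1}" if "x \<in> {0..1}" for n x
      using meas_in_01[OF pres_meas[OF pres_funpow[OF f]] that]
        meas_in_01[OF pres_meas[OF pres_funpow[OF pg]] that] by auto
    have "X = (\<Inter>n. {x \<in> {0..1}. (f ^^ n) x \<in> {x \<in> {0..1}. good x}} \<inter>
        {x \<in> {0..1}. (g ^^ n) x \<in> {x \<in> {0..1}. good x}})"
      using sp by (auto simp: X_def)
    also have "\<dots> \<in> \<B>"
      by (intro sets.countable_INT sets.Int preim_sets pres_meas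
          pres_funpow f pg good_sets image_subsetI) auto
    finally show ?thesis .
  qed
  have goodX: "good x" if "x \<in> X" for x
  proof -
    have "good ((f ^^ 0) x)"
      using that unfolding X_def by blast
    then show ?thesis by simp
  qed
  \<comment> \<open>Stated with \<open>f\<close> and \<open>g\<close> bound afresh, to be used for
    both maps. One step moves the forward orbit on and the backward orbit one place back, thanks to
    \<open>g (f x) = x\<close>.\<close>
  have step: "f x \<in> {0..1} \<and> (\<forall>n. good ((f ^^ n) (f x)) \<and> good ((g ^^ n) (f x)))"
    if f: "f \<in> meas01" and x: "x \<in> {0..1}" "\<And>n. good ((f ^^ n) x)" "\<And>n. good ((g ^^ n) x)" "g (f x) = x" for f g x
  proof -
    have "good ((f ^^ n) (f x))" for n
      using x(2)[of "Suc n"] by (simp add: funpow_swap1)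
    moreover have "good ((g ^^ n) (f x))" for n
    proof (cases n)
      case 0
      then show ?thesis using x(2)[of 1] by simp
    next
      case (Suc m)
      then show ?thesis
        using x(3)[of m] x(4) by (simp add: funpow_swap1)
    qed
    ultimately show ?thesis
      using meas_in_01[OF f x(1)] by simp
  qed
  have fX: "f x \<in> X" if "x \<in> X" for x
    using step[OF fm, of x g] goodX[OF that] that by (simp add: X_def good_def)
  have gX: "g x \<in> X" if "x \<in> X" for x
    using step[OF g, of x f] goodX[OF that] that by (simp add: X_def good_def)
  define T where "T x = (if x \<in> X then f x else x)" for x
  define R where "R x = (if x \<in> X then g x else x)" for x
  have Tm: "T \<in> meas01" and Rm: "R \<in> meas01"
    unfolding T_def R_def
    by (auto intro!: measurable_If_set fm g X_sets)
  have eq: "AE x in leb01. T x = f x"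
    using AE_X by eventually_elim (simp add: T_def)
  have "T \<in> mpt"
  proof (rule mptI[OF _ Rm])
    show "pres T"
      by (rule pres_cong_AE[OF f Tm eq])
    show "R (T x) = x" "T (R x) = x" if "x \<in> {0..1}" for x
      using fX gX goodX by (auto simp: T_def R_def good_def)
  qed
  with eq show ?thesis by blast
qed

section \<open>Sets of positive measure as copies of the unit interval\<close>

lemma AE_not_in_zero: "A \<in> \<B> \<Longrightarrow> \<mu> A = 0 \<Longrightarrow> AE x in leb01. x \<notin> A"
  by (intro AE_not_in) (auto simp: null_sets_def leb01.emeasure_eq_measure)

text \<open>\<open>relcdf E\<close> and \<open>quantile E\<close> are mutually inverse isomorphisms modulo null sets between \<open>E\<close>, with
  normalised measure, and the unit interval; this replaces the isomorphism theorem for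
  standard probability spaces.\<close>

definition relcdf :: "real set \<Rightarrow> real \<Rightarrow> real" where
  "relcdf E x = \<mu> (E \<inter> {0..x}) / \<mu> E"

definition quantile :: "real set \<Rightarrow> real \<Rightarrow> real" where
  "quantile E t = Inf {x \<in> {0..1}. t \<le> relcdf E x}"

lemma Int_atMost_sets: "E \<in> \<B> \<Longrightarrow> E \<inter> {0..x} \<in> \<B>"
  by (auto simp: sets_leb01)

lemma measure_Icc_le: "x \<le> y \<Longrightarrow> E \<in> \<B> \<Longrightarrow> \<mu> (E \<inter> {0..y}) - \<mu> (E \<inter> {0..x}) \<le> y - x"
proof -
  assume xy: "x \<le> y" and E: "E \<in> \<B>"
  have "\<mu> (E \<inter> {0..y}) - \<mu> (E \<inter> {0..x}) = \<mu> (E \<inter> {0..y} - E \<inter> {0..x})"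
    using xy by (intro leb01.finite_measure_Diff[symmetric] Int_atMost_sets E) auto
  also have "\<dots> = measure lborel (E \<inter> {0..y} - E \<inter> {0..x})"
    by (intro measure_leb01_eq sets.Diff Int_atMost_sets E)
  also have "\<dots> \<le> measure lborel {x..y}"
  proof (rule measure_mono_fmeasurable)
    show "E \<inter> {0..y} - E \<inter> {0..x} \<in> sets lborel"
      using E by (auto simp: sets_leb01)
  qed (auto intro!: fmeasurableI simp: emeasure_lborel_Icc_eq)
  also have "\<dots> = y - x"
    using xy by simp
  finally show ?thesis .
qed

lemma measure_mono01: "A \<subseteq> B \<Longrightarrow> B \<in> \<B> \<Longrightarrow> \<mu> A \<le> \<mu> B"
  by (rule leb01.finite_measure_mono)

context
  fixes E :: "real set"
  assumes E: "E \<in> \<B>" and pos: "0 < \<mu> E"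
begin

lemma relcdf_mono: "x \<le> y \<Longrightarrow> relcdf E x \<le> relcdf E y"
  unfolding relcdf_def using pos
  by (intro divide_right_mono measure_mono01 Int_atMost_sets E) auto

lemma relcdf_bounds: "0 \<le> relcdf E x" "relcdf E x \<le> 1"
  using pos measure_mono01[of "E \<inter> {0..x}" E] E by (auto simp: relcdf_def)

lemma relcdf_1: "1 \<le> x \<Longrightarrow> relcdf E x = 1"
proof -
  assume "1 \<le> x"
  then have "E \<inter> {0..x} = E"
    using E by (auto simp: sets_leb01)
  then show ?thesis
    using pos by (simp add: relcdf_def)
qed

lemma relcdf_0: "x \<le> 0 \<Longrightarrow> relcdf E x = 0"
proof -
  assume "x \<le> 0"
  have "\<mu> (E \<inter> {0..0}) = measure lborel (E \<inter> {0..0})"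
    by (intro measure_leb01_eq Int_atMost_sets E)
  also have "\<dots> \<le> measure lborel {0..0::real}"
    by (rule measure_mono_fmeasurable) 
      (use E in \<open>auto simp: sets_leb01 emeasure_lborel_Icc_eq intro!: fmeasurableI\<close>)
  finally have "relcdf E 0 \<le> 0"
    using pos by (simp add: relcdf_def divide_le_0_iff)
  then show ?thesis
    using relcdf_mono[OF \<open>x \<le> 0\<close>] relcdf_bounds[of x] by simp
qed

lemma relcdf_continuous: "continuous_on A (relcdf E)"
proof -
  have lip: "\<bar>relcdf E x - relcdf E y\<bar> \<le> \<bar>x - y\<bar> / \<mu> E" for x y
  proof -
    have *: "\<bar>relcdf E x - relcdf E y\<bar> \<le> \<bar>x - y\<bar> / \<mu> E" if "x \<le> y" for x y
    proof -
      have "\<mu> (E \<inter> {0..x}) \<le> \<mu> (E \<inter> {0..y})"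
        using that by (intro measure_mono01 Int_atMost_sets E) auto
      then have "\<bar>\<mu> (E \<inter> {0..x}) - \<mu> (E \<inter> {0..y})\<bar> \<le> \<bar>x - y\<bar>"
        using measure_Icc_le[OF that E] by simp
      then show ?thesis
        using pos by (simp add: relcdf_def divide_right_mono flip: diff_divide_distrib)
    qed
    show ?thesis
      using *[of x y] *[of y x] by (cases "x \<le> y") (auto simp: abs_minus_commute)
  qed
  show ?thesis
    unfolding continuous_on_iff
  proof (intro ballI allI impI)
    fix x and e :: real assume "0 < e"
    show "\<exists>d>0. \<forall>x'\<in>A. dist x' x < d \<longrightarrow> dist (relcdf E x') (relcdf E x) < e"
    proof (intro exI conjI ballI impI)
      show "0 < e * \<mu> E" using \<open>0 < e\<close> pos by simp
      fix x' assume "dist x' x < e * \<mu> E"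
      then have "\<bar>x' - x\<bar> / \<mu> E < e"
        using pos by (simp add: dist_real_def pos_divide_less_eq)
      with lip[of x' x] show "dist (relcdf E x') (relcdf E x) < e"
        by (simp add: dist_real_def)
    qed
  qed
qed

text \<open>By continuity of \<open>relcdf E\<close> the infimum is attained, which gives the usual
  adjunction between a distribution function and its quantiles. The conjunct
  \<open>0 \<le> x\<close> matters at \<open>t = 0\<close>, where \<open>t \<le> relcdf E x\<close>
  holds for negative \<open>x\<close> too.\<close>

lemma quantile_le_iff:
  assumes t: "t \<in> {0..1}"
  shows "quantile E t \<le> x \<longleftrightarrow> 0 \<le> x \<and> t \<le> relcdf E x" and "quantile E t \<in> {0..1}"
proof -
  define C where "C = {x \<in> {0..1}. t \<le> relcdf E x}"
  have q: "quantile E t = Inf C"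
    by (simp add: quantile_def C_def)
  have "closed C"
    unfolding C_def
    using closed_Collect_le[of "\<lambda>_. t" "relcdf E"] relcdf_continuous[of UNIV]
    by (simp add: closed_Collect_conj closed_Collect_le)
  moreover have ne: "1 \<in> C"
    using t relcdf_1[of 1] by (simp add: C_def)
  moreover have bdd: "bdd_below C"
    by (rule bdd_belowI[of _ 0]) (auto simp: C_def)
  ultimately have qC: "quantile E t \<in> C"
    unfolding q using closed_contains_Inf by blast
  then show "quantile E t \<in> {0..1}"
    by (simp add: C_def)
  show "quantile E t \<le> x \<longleftrightarrow> 0 \<le> x \<and> t \<le> relcdf E x"
  proof
    assume "quantile E t \<le> x"
    with qC relcdf_mono[OF this] show "0 \<le> x \<and> t \<le> relcdf E x"
      by (auto simp: C_def)
  next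
    assume *: "0 \<le> x \<and> t \<le> relcdf E x"
    show "quantile E t \<le> x"
    proof (cases "x \<le> 1")
      case True
      with * show ?thesis
        unfolding q by (intro cInf_lower bdd) (auto simp: C_def)
    next
      case False
      then show ?thesis using qC by (auto simp: C_def)
    qed
  qed
qed

text \<open>Without atoms there is no jump above \<open>t\<close>, by the intermediate value
  theorem. In this order the composition is the identity everywhere; in the other order only almost
  everywhere on \<open>E\<close>, because \<open>relcdf E\<close> is constant on gaps of
  \<open>E\<close>.\<close>

lemma relcdf_quantile:
  assumes t: "t \<in> {0..1}"
  shows "relcdf E (quantile E t) = t"
proof (rule antisym)
  show "t \<le> relcdf E (quantile E t)"
    using quantile_le_iff(1)[OF t, of "quantile E t"] by simp
  show "relcdf E (quantile E t) \<le> t"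
  proof (rule ccontr)
    assume *: "\<not> relcdf E (quantile E t) \<le> t"
    have "\<exists>y\<ge>0. y \<le> quantile E t \<and> relcdf E y = t"
      using t * relcdf_0[of 0] quantile_le_iff(2)[OF t]
      by (intro IVT' relcdf_continuous) auto
    then obtain y where y: "0 \<le> y" "y \<le> quantile E t" "relcdf E y = t"
      by blast
    then have "quantile E t = y"
      using quantile_le_iff(1)[OF t, of y] by simp
    with y * show False by simp
  qed
qed

lemma relcdf_meas: "relcdf E \<in> meas01"
proof -
  have "relcdf E \<in> borel_measurable borel"
    by (intro borel_measurable_continuous_onI relcdf_continuous)
  then have "relcdf E \<in> borel_measurable leb01"
    by (simp add: leb01_def measurable_restrict_space1)
  then show ?thesis
    using relcdf_bounds by (auto simp: measurable_leb01_iff)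
qed

lemma quantile_meas: "quantile E \<in> meas01"
proof -
  have "quantile E \<in> borel_measurable leb01"
  proof (rule borel_measurableI_le)
    fix x
    have "{t \<in> space leb01. quantile E t \<le> x} = (if 0 \<le> x then {..relcdf E x} else {}) \<inter> {0..1}"
      using quantile_le_iff(1) by auto
    then show "{t \<in> space leb01. quantile E t \<le> x} \<in> \<B>"
      by (simp add: sets_leb01_I)
  qed
  then show ?thesis
    using quantile_le_iff(2) by (auto simp: measurable_leb01_iff)
qed

text \<open>Inverse transform sampling: the quantile function of a uniform variable has the
  normalised restriction to \<open>E\<close> as its law. Both laws are compared on the half-lines
  \<open>{x<..}\<close>, which determine them.\<close>

lemma measure_quantile:
  assumes B: "B \<in> \<B>"
  shows "\<mu> (preim (quantile E) B) = \<mu> (E \<inter> B) / \<mu> E"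
proof -
  let ?M = "distr leb01 borel (quantile E)"
  let ?N = "distr (uniform_measure leb01 E) borel (\<lambda>x. x)"
  have [measurable]: "quantile E \<in> borel_measurable leb01"
    by (rule borel_measurable_leb01[OF quantile_meas])
  have [measurable]: "E \<in> \<B>" by (rule E)
  have M: "emeasure ?M B = \<mu> (preim (quantile E) B)" if "B \<in> sets borel" for B
    using that by (subst emeasure_distr) (auto simp: leb01.emeasure_eq_measure intro!: arg_cong[of _ _ \<mu>])
  have N: "emeasure ?N B = \<mu> (E \<inter> B) / \<mu> E" if "B \<in> sets borel" for B
  proof -
    have "emeasure ?N B = emeasure (uniform_measure leb01 E) (B \<inter> {0..1})"
      by (subst emeasure_distr) (auto simp: that)
    also have "\<dots> = emeasure leb01 (E \<inter> (B \<inter> {0..1})) / emeasure leb01 E"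
      using that E by (intro emeasure_uniform_measure sets_leb01_I) auto
    also have "E \<inter> (B \<inter> {0..1}) = E \<inter> B"
      using E by (auto simp: sets_leb01)
    finally show ?thesis
      using pos by (simp add: leb01.emeasure_eq_measure divide_ennreal)
  qed
  have "?M = ?N"
  proof (rule measure_eqI_lessThan)
    fix x
    show "emeasure ?M {x<..} < \<infinity>"
      by (subst M) auto
    have "\<mu> (preim (quantile E) {x<..}) = \<mu> (E \<inter> {x<..}) / \<mu> E"
    proof (cases "0 \<le> x")
      case True
      have "preim (quantile E) {x<..} = {relcdf E x<..1}"
        using True quantile_le_iff(1) relcdf_bounds[of x] by (auto simp: not_le[symmetric] intro: order_trans)
      moreover have "{relcdf E x<..1} \<in> \<B>"
        using relcdf_bounds[of x] by (auto simp: sets_leb01)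
      ultimately have "\<mu> (preim (quantile E) {x<..}) = 1 - relcdf E x"
        using relcdf_bounds[of x] by (simp add: measure_leb01_eq)
      also have "\<dots> = (\<mu> E - \<mu> (E \<inter> {0..x})) / \<mu> E"
        using pos by (simp add: relcdf_def diff_divide_distrib)
      also have "\<mu> E - \<mu> (E \<inter> {0..x}) = \<mu> (E - E \<inter> {0..x})"
        by (intro leb01.finite_measure_Diff[symmetric] E Int_atMost_sets) auto
      also have "E - E \<inter> {0..x} = E \<inter> {x<..}"
        using True E by (auto simp: sets_leb01)
      finally show ?thesis .
    next
      case False
      then have "preim (quantile E) {x<..} = {0..1}"
        using quantile_le_iff(2) by force
      moreover have "E \<inter> {x<..} = E"
        using E False by (auto simp: sets_leb01)
      ultimately show ?thesis
        using pos by simp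
    qed
    then show "emeasure ?M {x<..} = emeasure ?N {x<..}"
      by (simp add: M N)
  qed auto
  then have "emeasure ?M B = emeasure ?N B"
    by simp
  then show ?thesis
    using B M[of B] N[of B] pos by (simp add: sets_leb01)
qed

lemma AE_quantile:
  assumes "AE x in leb01. x \<in> E \<longrightarrow> P x" "{x \<in> {0..1}. P x} \<in> \<B>"
  shows "AE t in leb01. P (quantile E t)"
proof -
  let ?N = "{x \<in> {0..1}. \<not> P x}"
  have "?N = space leb01 - {x \<in> {0..1}. P x}"
    by auto
  then have N: "?N \<in> \<B>"
    using assms(2) by (metis sets.compl_sets)
  have eq: "{t \<in> {0..1}. \<not> P (quantile E t)} = preim (quantile E) ?N"
    using quantile_le_iff(2) by blast
  have "\<mu> (E \<inter> ?N) = 0"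
    using assms(1) by (intro measure_zero_AE) (auto elim: AE_mp)
  then have "\<mu> (preim (quantile E) ?N) = 0"
    using measure_quantile[OF N] by simp
  then show ?thesis
    using preim_sets[OF quantile_meas N]
    by (intro AE_leb01_I) (simp_all only: eq)
qed

lemma AE_quantile_mem: "AE t in leb01. quantile E t \<in> E"
proof (rule AE_quantile)
  have "{x \<in> {0..1}. x \<in> E} = E"
    using E by (auto simp: sets_leb01)
  then show "{x \<in> {0..1}. x \<in> E} \<in> \<B>"
    using E by simp
qed simp

text \<open>The exact identity \<open>relcdf_quantile\<close> makes the preimage of
  \<open>preim (relcdf E) B\<close> under \<open>quantile E\<close> equal to \<open>B\<close>, which
  reduces this to \<open>measure_quantile\<close>.\<close>

lemma measure_relcdf:
  assumes B: "B \<in> \<B>"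
  shows "\<mu> (E \<inter> preim (relcdf E) B) = \<mu> E * \<mu> B"
proof -
  have "preim (quantile E) (preim (relcdf E) B) = B"
    using B quantile_le_iff(2) relcdf_quantile by (auto simp: sets_leb01 simp del: atLeastAtMost_iff)
  then show ?thesis
    using measure_quantile[OF preim_sets[OF relcdf_meas B]] pos by simp
qed

lemma AE_relcdf:
  assumes "AE t in leb01. P t"
  shows "AE x in leb01. x \<in> E \<longrightarrow> P (relcdf E x)"
proof -
  obtain N where N: "N \<in> \<B>" "\<mu> N = 0" "{t \<in> {0..1}. \<not> P t} \<subseteq> N"
    using assms by (elim AE_E) (auto simp: measure_def)
  have r: "relcdf E x \<in> {0..1}" for x
    using relcdf_bounds[of x] by simp
  have "AE x in leb01. x \<notin> E \<inter> preim (relcdf E) N"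
    using measure_relcdf[OF N(1)] N(2)
    by (intro AE_not_in_zero sets.Int E preim_sets[OF relcdf_meas N(1)]) simp
  then show ?thesis
    using AE_in_01 by eventually_elim (use N(3) r in blast)
qed

text \<open>No value of \<open>quantile E\<close> lies in the exceptional set, again by
  \<open>relcdf_quantile\<close>; so that set has an empty preimage and a null trace on
  \<open>E\<close>.\<close>

lemma AE_quantile_relcdf: "AE x in leb01. x \<in> E \<longrightarrow> quantile E (relcdf E x) = x"
proof -
  let ?P = "\<lambda>x. quantile E (relcdf E x) = x"
  have S: "{x \<in> {0..1}. \<not> ?P x} \<in> \<B>"
    using neq_sets[OF measurable_comp[OF relcdf_meas quantile_meas] measurable_ident[of leb01]]
    by simp
  have eq: "{t \<in> {0..1}. quantile E t \<in> {x \<in> {0..1}. \<not> ?P x}} = {}"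
    using relcdf_quantile by auto
  have "\<mu> (E \<inter> {x \<in> {0..1}. \<not> ?P x}) = 0"
    using measure_quantile[OF S] pos unfolding eq by simp
  then have "AE x in leb01. x \<notin> E \<inter> {x \<in> {0..1}. \<not> ?P x}"
    using S E by (intro AE_not_in) (auto simp: null_sets_def leb01.emeasure_eq_measure)
  then show ?thesis
    using AE_in_01 by eventually_elim auto
qed

end

section \<open>Countable measurable partitions and gluing along them\<close>

definition lev :: "(real \<Rightarrow> nat) \<Rightarrow> nat \<Rightarrow> real set" where
  "lev c k = {x \<in> {0..1}. c x = k}"

lemma mem_lev [simp]: "x \<in> lev c k \<longleftrightarrow> x \<in> {0..1} \<and> c x = k"
  by (simp add: lev_def)

abbreviation label :: "(real \<Rightarrow> nat) \<Rightarrow> bool" where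
  "label c \<equiv> c \<in> measurable leb01 (count_space UNIV)"

lemma lev_Collect:
  assumes "label c"
  shows "{x \<in> {0..1}. P (c x)} \<in> \<B>"
proof -
  have "c -` {k. P k} \<inter> space leb01 \<in> \<B>"
    by (rule measurable_sets[OF assms]) simp
  moreover have "c -` {k. P k} \<inter> space leb01 = {x \<in> {0..1}. P (c x)}"
    by auto
  ultimately show ?thesis by simp
qed

lemma lev_sets: "label c \<Longrightarrow> lev c k \<in> \<B>"
  unfolding lev_def by (rule lev_Collect)

lemma labelI:
  assumes "\<And>k. lev c k \<in> \<B>"
  shows "label c"
proof -
  have "c -` A \<inter> space leb01 \<in> \<B>" for A
  proof -
    have "c -` A \<inter> space leb01 = (\<Union>k\<in>A. lev c k)"
      by auto
    then show ?thesis
      using assms by (auto intro!: sets.countable_UN')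
  qed
  then show ?thesis
    by (auto simp: measurable_def)
qed

lemma label_comp: "label c \<Longrightarrow> f \<in> meas01 \<Longrightarrow> label (\<lambda>x. c (f x))"
  by (rule measurable_compose)

lemma label_map: "label c \<Longrightarrow> label (\<lambda>x. h (c x))"
  by (rule measurable_compose[of c]) auto

lemma label_If:
  assumes "label c" "label d" "A \<in> \<B>"
  shows "label (\<lambda>x. if x \<in> A then c x else d x)"
  using assms by (intro measurable_If_set) auto

lemma label_prod:
  assumes "label c" "label d"
  shows "label (\<lambda>x. h (c x) (d x))"
  by (rule measurable_compose_countable'[where I = UNIV and g = c, OF _ assms(1)])
     (auto intro: label_map[OF assms(2)])

text \<open>The common refinement of two partitions is again given by a label with values in the
  natural numbers.\<close>

lemma lev_prod_encode:
  "lev (\<lambda>x. prod_encode (u x, v x)) j = lev u (fst (prod_decode j)) \<inter> lev v (snd (prod_decode j))"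
  by (auto simp: lev_def)

lemma label_glue:
  assumes "label c" "\<And>k. f k \<in> meas01"
  shows "(\<lambda>x. f (c x) x) \<in> meas01"
  using measurable_compose_countable[OF assms(2,1)] .

lemma measure_sums_lev:
  assumes "label c" "A \<in> \<B>"
  shows "(\<lambda>k. \<mu> (A \<inter> lev c k)) sums \<mu> A"
proof -
  have "(\<lambda>k. \<mu> (A \<inter> lev c k)) sums \<mu> (\<Union>k. A \<inter> lev c k)"
    by (intro leb01.finite_measure_UNION)
       (auto simp: disjoint_family_on_def intro!: assms lev_sets)
  moreover have "(\<Union>k. A \<inter> lev c k) = A"
    using assms(2) by (auto simp: sets_leb01)
  ultimately show ?thesis by simp
qed

lemma AE_lev_pos_I:
  assumes "label c" "\<And>k. 0 < \<mu> (lev c k) \<Longrightarrow> AE x in leb01. x \<in> lev c k \<longrightarrow> P x"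
  shows "AE x in leb01. P x"
proof -
  have "AE x in leb01. c x = k \<longrightarrow> P x" for k
  proof (cases "\<mu> (lev c k) = 0")
    case True
    then have "AE x in leb01. x \<notin> lev c k"
      by (rule AE_not_in_zero[OF lev_sets[OF assms(1)]])
    then show ?thesis
      using AE_in_01 by eventually_elim auto
  next
    case False
    then have "0 < \<mu> (lev c k)"
      using measure_nonneg[of leb01 "lev c k"] by linarith
    from assms(2)[OF this] AE_in_01 show ?thesis
      by eventually_elim auto
  qed
  then have "AE x in leb01. \<forall>k. c x = k \<longrightarrow> P x"
    unfolding AE_all_countable by blast
  then show ?thesis
    by eventually_elim simp
qed

text \<open>With \<open>S k\<close> the identity this rearranges one partition into another one with the same weights;
  with \<open>c = c'\<close> it is a disjoint union of copies of the \<open>S k\<close>.\<close>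

lemma mpt_glue:
  assumes c: "label c" and c': "label c'" and eq: "\<And>k. \<mu> (lev c k) = \<mu> (lev c' k)"
    and S: "\<And>k. S k \<in> mpt"
  shows "\<exists>\<Phi>\<in>mpt. AE x in leb01. c' (\<Phi> x) = c x \<and>
    \<Phi> x = quantile (lev c' (c x)) (S (c x) (relcdf (lev c (c x)) x)) \<and> 0 < \<mu> (lev c (c x))"
proof -
  \<comment> \<open>On a null piece the normalisation would divide by 0; the identity is a
    measurable filler there.\<close>
  define f where "f k x = (if 0 < \<mu> (lev c k)
    then quantile (lev c' k) (S k (relcdf (lev c k) x)) else x)" for k x
  define g where "g k x = (if 0 < \<mu> (lev c k)
    then quantile (lev c k) (inv01 (S k) (relcdf (lev c' k) x)) else x)" for k x
  note E = lev_sets[OF c] lev_sets[OF c']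
  have fm: "f k \<in> meas01" and gm: "g k \<in> meas01" for k
  proof -
    have "f k \<in> meas01 \<and> g k \<in> meas01"
    proof (cases "0 < \<mu> (lev c k)")
      case True
      then have "0 < \<mu> (lev c' k)"
        using eq by simp
      note pos = True this
      have "f k = quantile (lev c' k) \<circ> (S k \<circ> relcdf (lev c k))"
        "g k = quantile (lev c k) \<circ> (inv01 (S k) \<circ> relcdf (lev c' k))"
        using True by (auto simp: f_def g_def)
      then show ?thesis
        using mpt_meas[OF S[of k]] mpt_inv_meas[OF S[of k]]
        by (auto intro!: measurable_comp quantile_meas relcdf_meas E pos)
    next
      case False
      then have "f k = (\<lambda>x. x)" "g k = (\<lambda>x. x)"
        by (auto simp: f_def g_def)
      then show ?thesis by simp
    qed
    then show "f k \<in> meas01" "g k \<in> meas01"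
      by auto
  qed
  let ?F = "\<lambda>x. f (c x) x" and ?G = "\<lambda>x. g (c' x) x"
  have Fm: "?F \<in> meas01" and Gm: "?G \<in> meas01"
    by (rule label_glue[OF c fm], rule label_glue[OF c' gm])
  have lev: "AE x in leb01. c' (?F x) = c x \<and> ?G (?F x) = x \<and> 0 < \<mu> (lev c (c x))"
  proof (rule AE_lev_pos_I[OF c])
    fix k assume pos: "0 < \<mu> (lev c k)"
    then have pos': "0 < \<mu> (lev c' k)" by (simp add: eq)
    have "AE t in leb01. quantile (lev c' k) (S k t) \<in> lev c' k"
      by (rule pres_AE[OF mpt_pres[OF S] AE_quantile_mem[OF E(2) pos']])
    from AE_relcdf[OF E(1) pos this] AE_quantile_relcdf[OF E(1) pos]
    show "AE x in leb01. x \<in> lev c k \<longrightarrow> c' (?F x) = c x \<and> ?G (?F x) = x \<and> 0 < \<mu> (lev c (c x))"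
    proof eventually_elim
      case (elim x)
      show ?case
      proof
        assume x: "x \<in> lev c k"
        let ?t = "relcdf (lev c k) x"
        have t: "?t \<in> {0..1}"
          using relcdf_bounds[OF E(1) pos] by simp
        have F: "?F x = quantile (lev c' k) (S k ?t)"
          using x pos by (simp add: f_def)
        have "c' (?F x) = k"
          using elim x F by auto
        moreover from this have "?G (?F x) = quantile (lev c k) (inv01 (S k) (S k ?t))"
          using pos F relcdf_quantile[OF E(2) pos' mpt_in[OF S t]] by (simp add: g_def)
        then have "?G (?F x) = x"
          using elim(2) x mpt_inv_left[OF S t] by simp
        ultimately show "c' (?F x) = c x \<and> ?G (?F x) = x \<and> 0 < \<mu> (lev c (c x))"
          using x pos by auto
      qed
    qed
  qed
  have "pres ?F"
  proof (rule presI[OF Fm])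
    fix B assume B: "B \<in> \<B>"
    have "\<mu> (preim ?F B \<inter> lev c k) = \<mu> (B \<inter> lev c' k)" for k
    proof (cases "0 < \<mu> (lev c k)")
      case True
      then have pos': "0 < \<mu> (lev c' k)" by (simp add: eq)
      let ?Q = "preim (quantile (lev c' k)) B"
      have Q: "?Q \<in> \<B>"
        by (rule preim_sets[OF quantile_meas[OF E(2) pos'] B])
      have r: "relcdf (lev c k) x \<in> {0..1}" for x
        using relcdf_bounds[OF E(1) True] by simp
      have "preim ?F B \<inter> lev c k =
          lev c k \<inter> preim (relcdf (lev c k)) (preim (S k) ?Q)"
        using True r mpt_in[OF S[of k]] by (auto simp: f_def simp del: atLeastAtMost_iff)
      then have "\<mu> (preim ?F B \<inter> lev c k) = \<mu> (lev c k) * \<mu> (preim (S k) ?Q)"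
        using measure_relcdf[OF E(1) True preim_sets[OF mpt_meas[OF S] Q]] by simp
      also have "\<dots> = \<mu> (lev c k) * (\<mu> (lev c' k \<inter> B) / \<mu> (lev c' k))"
        using pres_measure[OF mpt_pres[OF S] Q] measure_quantile[OF E(2) pos' B] by simp
      finally show ?thesis
        using pos' by (simp add: eq Int_commute)
    next
      case False
      then have "\<mu> (lev c k) \<le> 0" "\<mu> (lev c' k) \<le> 0"
        using eq by auto
      then show ?thesis
        using measure_mono01[of "preim ?F B \<inter> lev c k" "lev c k"]
          measure_mono01[of "B \<inter> lev c' k" "lev c' k"] E
        by (smt (verit) Int_lower2 measure_nonneg)
    qed
    then show "\<mu> (preim ?F B) = \<mu> B"
      using measure_sums_lev[OF c preim_sets[OF Fm B]] measure_sums_lev[OF c' B]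
      by (simp add: sums_unique2)
  qed
  from mpt_of_left_inverse[OF this Gm] lev obtain \<Phi> where
    \<Phi>: "\<Phi> \<in> mpt" "AE x in leb01. \<Phi> x = ?F x"
    by (auto elim: AE_mp)
  from \<Phi>(2) lev have "AE x in leb01. c' (\<Phi> x) = c x \<and>
    \<Phi> x = quantile (lev c' (c x)) (S (c x) (relcdf (lev c (c x)) x)) \<and> 0 < \<mu> (lev c (c x))"
    by eventually_elim (auto simp: f_def)
  with \<Phi>(1) show ?thesis by blast
qed

text \<open>Since \<open>p'\<close> reads off from the image which \<open>f k\<close> was used, it
  provides an almost everywhere left inverse. What lands in piece \<open>k\<close> of
  \<open>p'\<close> comes from inside its preimage under \<open>f k\<close>; this gives one
  inequality per piece, enough for \<open>presI_le\<close>.\<close>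

lemma mpt_piecewise:
  assumes p: "label p" and p': "label p'" and f: "\<And>k. f k \<in> mpt"
    and pf: "AE x in leb01. p' (f (p x) x) = p x"
  shows "\<exists>\<Phi>\<in>mpt. AE x in leb01. \<Phi> x = f (p x) x"
proof (rule mpt_of_left_inverse[where f = "\<lambda>x. f (p x) x" and g = "\<lambda>y. inv01 (f (p' y)) y"])
  let ?F = "\<lambda>x. f (p x) x"
  have Fm: "?F \<in> meas01"
    by (rule label_glue[OF p mpt_meas[OF f]])
  show "(\<lambda>y. inv01 (f (p' y)) y) \<in> meas01"
    by (rule label_glue[OF p' mpt_inv_meas[OF f]])
  show "AE x in leb01. inv01 (f (p' (f (p x) x))) (f (p x) x) = x"
    using pf AE_in_01
  proof eventually_elim
    case (elim x)
    then show ?case by (simp only: mpt_inv_left[OF f])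
  qed
  show "pres ?F"
  proof (rule presI_le[OF Fm])
    fix B assume B: "B \<in> \<B>"
    show "\<mu> (preim ?F B) \<le> \<mu> B"
    proof (rule sums_le[OF _ measure_sums_lev[OF p preim_sets[OF Fm B]]
          measure_sums_lev[OF p' B]])
      fix k
      have S: "B \<inter> lev p' k \<in> \<B>"
        by (intro sets.Int B lev_sets p')
      have "\<mu> (preim ?F B \<inter> lev p k) \<le> \<mu> (preim (f k) (B \<inter> lev p' k))"
      proof (rule measure_mono_AE01)
        show "AE x in leb01. x \<in> preim ?F B \<inter> lev p k \<longrightarrow>
            x \<in> preim (f k) (B \<inter> lev p' k)"
          using pf
        proof eventually_elim
          case (elim x)
          then show ?case
            using mpt_in[OF f[of k], of x] by (auto simp del: atLeastAtMost_iff)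
        qed
      qed (intro sets.Int lev_sets p preim_sets Fm B S mpt_meas f)+
      also have "\<dots> = \<mu> (B \<inter> lev p' k)"
        by (rule pres_measure[OF mpt_pres[OF f] S])
      finally show "\<mu> (preim ?F B \<inter> lev p k) \<le> \<mu> (B \<inter> lev p' k)" .
    qed
  qed
qed

section \<open>Random variables independent of finitely many sets\<close>

lemma finite_family_label:
  assumes "finite \<C>" "\<C> \<subseteq> \<B>"
  shows "\<exists>c. label c \<and> (\<forall>C\<in>\<C>. \<forall>x y. c x = c y \<longrightarrow> (x \<in> C \<longleftrightarrow> y \<in> C))"
  using assms
proof (induction \<C>)
  case empty
  show ?case by (intro exI[of _ "\<lambda>x. 0"]) simp
next
  case (insert A \<C>)
  then have "\<C> \<subseteq> \<B>" by blast
  from insert.IH[OF this] obtain c where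
    cc: "label c \<and> (\<forall>C\<in>\<C>. \<forall>x y. c x = c y \<longrightarrow> (x \<in> C \<longleftrightarrow> y \<in> C))"
    by (rule exE)
  note c = cc[THEN conjunct1] and c2 = cc[THEN conjunct2]
  \<comment> \<open>The parity of the new label records membership in \<open>A\<close>, its half the
    old label.\<close>
  define d where "d x = (if x \<in> A then 2 * c x else 2 * c x + 1)" for x
  have "label d"
    unfolding d_def using insert.prems
    by (intro label_If label_map[OF c, of "\<lambda>k. 2 * k"] label_map[OF c, of "\<lambda>k. 2 * k + 1"]) auto
  moreover have "c x = c y \<and> (x \<in> A \<longleftrightarrow> y \<in> A)" if "d x = d y" for x y
    using that unfolding d_def by (simp split: if_splits) presburger+
  then have "\<forall>C\<in>insert A \<C>. \<forall>x y. d x = d y \<longrightarrow> (x \<in> C \<longleftrightarrow> y \<in> C)"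
    using c2 by (metis insert_iff)
  ultimately show ?case
    by (intro exI[of _ d] conjI)
qed

text \<open>On each cell of the partition generated by the family, the relative distribution
  function of the cell is uniform. Glued together these functions are uniform given the cell, hence
  independent of every union of cells. This is the source of randomness for all later
  splittings.\<close>

lemma independent_uniform:
  assumes "finite \<C>" "\<C> \<subseteq> \<B>"
  shows "\<exists>U\<in>meas01. \<forall>C\<in>\<C>. \<forall>B\<in>\<B>.
    \<mu> (C \<inter> preim U B) = \<mu> C * \<mu> B"
proof -
  obtain c where c: "label c" and sep: "\<And>C x y. C \<in> \<C> \<Longrightarrow> c x = c y \<Longrightarrow> x \<in> C \<longleftrightarrow> y \<in> C"
    using finite_family_label[OF assms] by blast
  define f where "f k = (if 0 < \<mu> (lev c k) then relcdf (lev c k) else (\<lambda>x. x))" for k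
  note E = lev_sets[OF c]
  have "f k \<in> meas01" for k
    by (auto simp: f_def intro!: relcdf_meas E)
  then have U: "(\<lambda>x. f (c x) x) \<in> meas01"
    by (rule label_glue[OF c])
  have *: "\<mu> (C \<inter> {x \<in> {0..1}. f (c x) x \<in> B}) = \<mu> C * \<mu> B" if C: "C \<in> \<C>" and B: "B \<in> \<B>" for C B
  proof -
    define P where P_def: "P = {x \<in> {0..1}. f (c x) x \<in> B}"
    have P: "P \<in> \<B>"
      unfolding P_def by (rule preim_sets[OF U B])
    have lev: "\<mu> (P \<inter> lev c k) = \<mu> (lev c k) * \<mu> B" for k
    proof (cases "0 < \<mu> (lev c k)")
      case True
      have "P \<inter> lev c k = lev c k \<inter> preim (relcdf (lev c k)) B"
        using True by (auto simp: P_def f_def)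
      then show ?thesis
        using measure_relcdf[OF E True B] by simp
    next
      case False
      then have "\<mu> (lev c k) = 0"
        using measure_nonneg[of leb01 "lev c k"] by linarith
      moreover from this have "\<mu> (P \<inter> lev c k) = 0"
        using measure_mono01[of "P \<inter> lev c k" "lev c k"] E measure_nonneg[of leb01 "P \<inter> lev c k"]
        by (simp add: antisym)
      ultimately show ?thesis by simp
    qed
    have Cs: "C \<in> \<B>"
      using C assms(2) by blast
    have "\<mu> ((C \<inter> P) \<inter> lev c k) = \<mu> (C \<inter> lev c k) * \<mu> B" for k
    proof (cases "C \<inter> lev c k = {}")
      case True
      then have e: "(C \<inter> P) \<inter> lev c k = {}" by blast
      show ?thesis unfolding e True by simp
    next
      case False
      then obtain y where "y \<in> C \<inter> lev c k" by blast
      then have y: "y \<in> C" "c y = k" by simp_all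
      have "x \<in> C" if "x \<in> lev c k" for x
        using sep[OF C, of x y] y that by simp
      then have "lev c k \<subseteq> C" by (rule subsetI)
      then have "C \<inter> lev c k = lev c k" "(C \<inter> P) \<inter> lev c k = P \<inter> lev c k"
        by blast+
      then show ?thesis using lev by simp
    qed
    then have "(\<lambda>k. \<mu> (C \<inter> lev c k) * \<mu> B) sums \<mu> (C \<inter> P)"
      using measure_sums_lev[OF c sets.Int[OF Cs P]] by simp
    moreover have "(\<lambda>k. \<mu> (C \<inter> lev c k) * \<mu> B) sums (\<mu> C * \<mu> B)"
      by (intro sums_mult2 measure_sums_lev c Cs)
    ultimately show ?thesis
      unfolding P_def by (rule sums_unique2)
  qed
  show ?thesis
    by (intro bexI[OF _ U] ballI *)
qed

section \<open>Iterates in both directions and almost everywhere invariant functions\<close>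

lemma mpt_funpow_in: "T \<in> mpt \<Longrightarrow> x \<in> {0..1} \<Longrightarrow> (T ^^ n) x \<in> {0..1}"
  by (rule mpt_in[OF mpt_funpow])

lemma mpt_inv_funpow_in: "T \<in> mpt \<Longrightarrow> x \<in> {0..1} \<Longrightarrow> (inv01 T ^^ n) x \<in> {0..1}"
  by (rule mpt_funpow_in[OF mpt_inv])

lemma funpow_meas:
  assumes "T \<in> mpt"
  shows "T ^^ n \<in> meas01" and "inv01 T ^^ n \<in> meas01"
  by (rule mpt_meas[OF mpt_funpow[OF assms]], rule mpt_meas[OF mpt_funpow[OF mpt_inv[OF assms]]])

lemma inv_funpow_right: "T \<in> mpt \<Longrightarrow> x \<in> {0..1} \<Longrightarrow> (T ^^ n) ((inv01 T ^^ n) x) = x"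
proof (induction n)
  case (Suc n)
  have "(T ^^ Suc n) ((inv01 T ^^ Suc n) x) = (T ^^ n) (T (inv01 T ((inv01 T ^^ n) x)))"
    by (simp add: funpow_swap1)
  then show ?case
    using Suc by (simp only: mpt_inv_right[OF Suc.prems(1) mpt_inv_funpow_in[OF Suc.prems]])
qed simp

lemma funpow_inv_funpow_ge:
  assumes "T \<in> mpt" "x \<in> {0..1}" "b \<le> a"
  shows "(T ^^ a) ((inv01 T ^^ b) x) = (T ^^ (a - b)) x"
proof -
  have "(T ^^ a) ((inv01 T ^^ b) x) = (T ^^ (a - b)) ((T ^^ b) ((inv01 T ^^ b) x))"
    using assms(3) by (metis comp_apply funpow_add le_add_diff_inverse2)
  then show ?thesis
    using assms by (simp only: inv_funpow_right)
qed

lemma funpow_inv_funpow_le: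
  assumes "T \<in> mpt" "x \<in> {0..1}" "a \<le> b"
  shows "(T ^^ a) ((inv01 T ^^ b) x) = (inv01 T ^^ (b - a)) x"
proof -
  have "(T ^^ a) ((inv01 T ^^ b) x) = (T ^^ a) ((inv01 T ^^ a) ((inv01 T ^^ (b - a)) x))"
    using assms(3) by (metis comp_apply funpow_add le_add_diff_inverse)
  then show ?thesis
    using assms by (simp only: inv_funpow_right mpt_inv_funpow_in)
qed

lemma inv_inv_funpow: "T \<in> mpt \<Longrightarrow> x \<in> {0..1} \<Longrightarrow> (inv01 (inv01 T) ^^ n) x = (T ^^ n) x"
proof (induction n)
  case (Suc n)
  then show ?case
    by (simp add: mpt_inv_inv[OF Suc.prems(1) mpt_funpow_in[OF Suc.prems]])
qed simp

lemma inv_funpow_funpow_ge: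
  assumes "T \<in> mpt" "x \<in> {0..1}" "b \<le> a"
  shows "(inv01 T ^^ a) ((T ^^ b) x) = (inv01 T ^^ (a - b)) x"
  using funpow_inv_funpow_ge[OF mpt_inv[OF assms(1)] assms(2,3)] by (simp only: inv_inv_funpow[OF assms(1,2)])

lemma inv_funpow_funpow_le:
  assumes "T \<in> mpt" "x \<in> {0..1}" "a \<le> b"
  shows "(inv01 T ^^ a) ((T ^^ b) x) = (T ^^ (b - a)) x"
  using funpow_inv_funpow_le[OF mpt_inv[OF assms(1)] assms(2,3)] by (simp only: inv_inv_funpow[OF assms(1,2)])

lemma inv_funpow_left: "T \<in> mpt \<Longrightarrow> x \<in> {0..1} \<Longrightarrow> (inv01 T ^^ n) ((T ^^ n) x) = x"
  using inv_funpow_funpow_ge[of T x n n] by simp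

abbreviation ae_inv :: "(real \<Rightarrow> real) \<Rightarrow> (real \<Rightarrow> 'a) \<Rightarrow> bool" where
  "ae_inv T d \<equiv> AE x in leb01. d (T x) = d x"

lemma ae_inv_funpow:
  assumes "pres T" "ae_inv T d"
  shows "ae_inv (T ^^ n) d"
proof (induction n)
  case (Suc n)
  from pres_AE[OF pres_funpow[OF assms(1)] assms(2), of n] Suc show ?case
    by eventually_elim simp
qed simp

lemma ae_inv_inv:
  assumes "T \<in> mpt" "ae_inv T d"
  shows "ae_inv (inv01 T) d"
  using pres_AE[OF mpt_inv_pres[OF assms(1)] assms(2)] AE_in_01
proof eventually_elim
  case (elim x)
  then show ?case
    using mpt_inv_right[OF assms(1), of x] by simp
qed

lemma measure_inv_Int:
  assumes f: "pres f" and F: "F \<in> \<B>" and I: "I \<in> \<B>"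
    and inv: "ae_inv f (\<lambda>x. x \<in> I)"
  shows "\<mu> (preim f F \<inter> I) = \<mu> (F \<inter> I)"
proof -
  note m = preim_sets[OF pres_meas[OF f]]
  have "\<mu> (preim f F \<inter> I) = \<mu> (preim f (F \<inter> I))"
  proof (rule leb01.finite_measure_eq_AE)
    show "AE x in leb01. (x \<in> preim f F \<inter> I) = (x \<in> preim f (F \<inter> I))"
      using inv by eventually_elim auto
  qed (intro sets.Int F I m)+
  also have "\<dots> = \<mu> (F \<inter> I)"
    by (rule pres_measure[OF f]) (intro sets.Int F I)
  finally show ?thesis .
qed

subsection \<open>Rokhlin towers\<close>

text \<open>The right end point has the label \<open>2 ^ m\<close> for itself, so labels range over
  \<open>{..2 ^ m}\<close>.\<close>

definition dyadic :: "nat \<Rightarrow> real \<Rightarrow> nat" where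
  "dyadic m x = nat \<lfloor>2 ^ m * x\<rfloor>"

lemma label_dyadic: "label (dyadic m)"
proof -
  have "(\<lambda>x::real. nat \<lfloor>2 ^ m * x\<rfloor>) \<in> measurable borel (count_space UNIV)"
    by measurable
  then show ?thesis
    unfolding dyadic_def[abs_def] leb01_def by (simp add: measurable_restrict_space1)
qed

abbreviation dyadic_neq :: "nat \<Rightarrow> (real \<Rightarrow> real) \<Rightarrow> (real \<Rightarrow> real) \<Rightarrow> real set" where
  "dyadic_neq i S T \<equiv> {x \<in> {0..1}. dyadic i (S x) \<noteq> dyadic i (T x)}"

lemma dyadic_neq_sets: "S \<in> mpt \<Longrightarrow> T \<in> mpt \<Longrightarrow> dyadic_neq i S T \<in> \<B>"
proof -
  assume S: "S \<in> mpt" and T: "T \<in> mpt"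
  have "label (\<lambda>x. prod_encode (dyadic i (S x), dyadic i (T x)))"
    by (rule label_prod[OF label_comp[OF label_dyadic mpt_meas[OF S]] label_comp[OF label_dyadic mpt_meas[OF T]]])
  from lev_Collect[OF this, of "\<lambda>k. fst (prod_decode k) \<noteq> snd (prod_decode k)"] show ?thesis
    by (simp del: atLeastAtMost_iff)
qed

lemma dyadic_eq_imp:
  assumes "x \<in> {0..1}" "y \<in> {0..1}" "dyadic m x = dyadic m y"
  shows "\<bar>x - y\<bar> \<le> (1/2) ^ m"
proof -
  have "\<lfloor>2 ^ m * x\<rfloor> \<ge> 0" "\<lfloor>2 ^ m * y\<rfloor> \<ge> 0"
    using assms by auto
  then have "\<lfloor>2 ^ m * x\<rfloor> = \<lfloor>2 ^ m * y\<rfloor>"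
    using assms(3) unfolding dyadic_def by (metis eq_nat_nat_iff)
  then have "\<bar>2 ^ m * x - 2 ^ m * y\<bar> \<le> 1"
    by linarith
  then have "2 ^ m * \<bar>x - y\<bar> \<le> 1"
    by (simp add: abs_mult flip: right_diff_distrib)
  then show ?thesis
    by (simp add: field_simps power_divide)
qed

lemma eventually_dyadic_neq:
  assumes "x \<in> {0..1}" "y \<in> {0..1}" "x \<noteq> y"
  shows "eventually (\<lambda>m. dyadic m x \<noteq> dyadic m y) sequentially"
proof -
  have "(\<lambda>m. (1/2::real) ^ m) \<longlonglongrightarrow> 0"
    by (rule LIMSEQ_realpow_zero) auto
  then have "eventually (\<lambda>m. (1/2) ^ m < \<bar>x - y\<bar>) sequentially"
    using assms(3) by (intro order_tendstoD) auto
  then show ?thesis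
    by eventually_elim (use dyadic_eq_imp[OF assms(1,2)] in force)
qed

text \<open>By aperiodicity almost every point has a dyadic neighbourhood that its next \<open>N - 1\<close> iterates
  avoid.  The resulting countably many pieces are added one after another, each without the
  points that come too close in time to those already chosen.\<close>

lemma marker_set:
  assumes T: "T \<in> mpt" and aper: "AE x in leb01. \<forall>i\<ge>1. (T ^^ i) x \<noteq> x"
  shows "\<exists>B\<in>\<B>. (\<forall>x\<in>B. \<forall>i. 0 < i \<and> i < N \<longrightarrow> (T ^^ i) x \<notin> B) \<and>
    (AE x in leb01. \<exists>a. (inv01 T ^^ a) x \<in> B)"
proof -
  let ?U = "inv01 T"
  \<comment> \<open>The index \<open>j\<close> codes a pair: a scale and a cell number at that
    scale.\<close>
  define C where "C j = lev (dyadic (fst (prod_decode j))) (snd (prod_decode j)) -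
    (\<Union>i\<in>{1..<N}. {x \<in> {0..1}. dyadic (fst (prod_decode j)) ((T ^^ i) x) = snd (prod_decode j)})" for j
  define B where "B = rec_nat {} (\<lambda>j S. S \<union> (C j -
    (\<Union>i\<in>{1..<N}. preim (T ^^ i) S \<union> preim (?U ^^ i) S)))"
  have B0: "B 0 = {}"
    by (simp add: B_def)
  have BS: "B (Suc j) = B j \<union> (C j -
    (\<Union>i\<in>{1..<N}. preim (T ^^ i) (B j) \<union> preim (?U ^^ i) (B j)))" for j
    by (simp add: B_def)
  note Tm = funpow_meas(1)[OF T] and Um = funpow_meas(2)[OF T]
  have C_sets: "C j \<in> \<B>" for j
    unfolding C_def
    by (intro sets.Diff lev_sets label_dyadic sets.finite_UN
        lev_Collect[OF label_comp[OF label_dyadic Tm]]) auto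
  have C_space: "x \<in> {0..1}" if "x \<in> C j" for x j
    using C_sets[of j] that by (auto simp: sets_leb01)
  have C_disj: "(T ^^ i) x \<notin> C j" if "x \<in> C j" "0 < i" "i < N" for x i j
    using that by (auto simp: C_def)
  have B_sets: "B j \<in> \<B>" for j
    by (induction j)
       (auto simp only: B0 BS intro!: sets.Un sets.Diff C_sets sets.finite_UN preim_sets Tm Um
         sets.empty_sets finite_atLeastLessThan)
  have B_space: "x \<in> {0..1}" if "x \<in> B j" for x j
    using B_sets[of j] that by (auto simp: sets_leb01)
  have B_disj: "(T ^^ i) x \<notin> B j" if "x \<in> B j" "0 < i" "i < N" for x i j
    using that(1)
  proof (induction j arbitrary: )
    case 0
    then show ?case by (simp add: B0)
  next
    case (Suc j)
    have x01: "x \<in> {0..1}" and y01: "(T ^^ i) x \<in> {0..1}"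
      using B_space[OF Suc.prems] mpt_funpow_in[OF T] by auto
    have i: "i \<in> {1..<N}" using that by auto
    show ?case
    proof
      assume y: "(T ^^ i) x \<in> B (Suc j)"
      then consider "(T ^^ i) x \<in> B j" | "(T ^^ i) x \<in> C j" "(?U ^^ i) ((T ^^ i) x) \<notin> B j"
        using y01 i unfolding BS by blast
      then show False
      proof cases
        case 1
        then show False
          using Suc x01 i unfolding BS by blast
      next
        case 2
        then have "x \<notin> B j"
          by (simp only: inv_funpow_left[OF T x01] not_False_eq_True)
        then show False
          using Suc.prems C_disj[of x j i] 2(1) that unfolding BS by blast
      qed
    qed
  qed
  have mono: "B j \<subseteq> B k" if "j \<le> k" for j k
    by (rule lift_Suc_mono_le[of B]) (use that BS in auto)
  show ?thesis
  proof (intro bexI[of _ "\<Union>j. B j"] conjI ballI allI impI)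
    show "(\<Union>j. B j) \<in> \<B>"
      using B_sets by auto
    fix x i assume "x \<in> (\<Union>j. B j)" and i: "0 < i \<and> i < N"
    then obtain j where j: "x \<in> B j" by auto
    show "(T ^^ i) x \<notin> (\<Union>j. B j)"
    proof
      assume "(T ^^ i) x \<in> (\<Union>j. B j)"
      then obtain k where k: "(T ^^ i) x \<in> B k" by auto
      have "x \<in> B (max j k)" "(T ^^ i) x \<in> B (max j k)"
        using j k mono[of j "max j k"] mono[of k "max j k"] by auto
      then show False
        using B_disj i by blast
    qed
  next
    have "AE x in leb01. \<forall>i\<ge>1. (T ^^ i) ((?U ^^ N) x) \<noteq> (?U ^^ N) x"
      by (rule pres_AE[OF mpt_pres[OF mpt_funpow[OF mpt_inv[OF T]]] aper])
    then show "AE x in leb01. \<exists>a. (?U ^^ a) x \<in> (\<Union>j. B j)"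
      using AE_in_01
    proof eventually_elim
      case (elim x)
      \<comment> \<open>Going back \<open>N\<close> steps first leaves room: \<open>?z\<close> and
        every point less than \<open>N\<close> steps before or after it are backward iterates of
        \<open>x\<close>. So it does not matter which of them the marker set contains.\<close>
      let ?z = "(?U ^^ N) x"
      have z: "?z \<in> {0..1}"
        by (rule mpt_inv_funpow_in[OF T elim(2)])
      have "eventually (\<lambda>m. \<forall>i\<in>{1..<N}. dyadic m ((T ^^ i) ?z) \<noteq> dyadic m ?z) sequentially"
        using elim(1) by (intro eventually_ball_finite ballI eventually_dyadic_neq
            mpt_funpow_in[OF T] z) auto
      then obtain m where "\<forall>i\<in>{1..<N}. dyadic m ((T ^^ i) ?z) \<noteq> dyadic m ?z"
        unfolding eventually_sequentially by blast
      then have zC: "?z \<in> C (prod_encode (m, dyadic m ?z))" (is "_ \<in> C ?j")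
        using z by (auto simp: C_def)
      show ?case
      proof (cases "?z \<in> B (Suc ?j)")
        case True
        then show ?thesis by blast
      next
        case False
        then obtain i where i: "i \<in> {1..<N}" "(T ^^ i) ?z \<in> B ?j \<or> (?U ^^ i) ?z \<in> B ?j"
          using zC unfolding BS by blast
        have "(T ^^ i) ?z = (?U ^^ (N - i)) x"
          using i by (intro funpow_inv_funpow_le T elim) auto
        moreover have "(?U ^^ i) ?z = (?U ^^ (i + N)) x"
          by (simp add: funpow_add)
        ultimately show ?thesis
          using i(2) by (metis UN_I UNIV_I)
      qed
    qed
  qed
qed

text \<open>Only the base is recorded. The level \<open>i\<close>, that is the image of
  \<open>F\<close> under the \<open>i\<close>-th power of \<open>T\<close>, appears everywhere as
  \<open>preim (inv01 T ^^ i) F\<close>.\<close>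

definition tower :: "(real \<Rightarrow> real) \<Rightarrow> nat \<Rightarrow> real set \<Rightarrow> bool" where
  "tower T n F \<longleftrightarrow> F \<in> \<B> \<and> (\<forall>x\<in>F. \<forall>i. 0 < i \<and> i < n \<longrightarrow> (T ^^ i) x \<notin> F)"

lemma tower_subset: "tower T n F \<Longrightarrow> G \<subseteq> F \<Longrightarrow> G \<in> \<B> \<Longrightarrow> tower T n G"
  by (auto simp: tower_def)

lemma tower_disjoint:
  assumes T: "T \<in> mpt" and F: "tower T n F" and x: "x \<in> {0..1}" and ij: "i < n" "j < n"
    and xF: "(inv01 T ^^ i) x \<in> F" "(inv01 T ^^ j) x \<in> F"
  shows "i = j"
proof -
  have *: False if "i < j" "j < n" "(inv01 T ^^ i) x \<in> F" "(inv01 T ^^ j) x \<in> F" for i j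
  proof -
    have "(T ^^ (j - i)) ((inv01 T ^^ j) x) = (inv01 T ^^ (j - (j - i))) x"
      by (rule funpow_inv_funpow_le[OF T x]) simp
    then have "(T ^^ (j - i)) ((inv01 T ^^ j) x) \<in> F"
      using that by simp
    then show False
      using F that by (auto simp: tower_def)
  qed
  show ?thesis
    using * ij xF by (metis linorder_neqE_nat)
qed

lemma tower_level_sets:
  assumes "T \<in> mpt" "tower T n F"
  shows "preim (inv01 T ^^ i) F \<in> \<B>"
  using assms by (intro preim_sets mpt_meas mpt_funpow mpt_inv) (auto simp: tower_def)

lemma measure_tower_Int:
  assumes T: "T \<in> mpt" and F: "tower T n F" and I: "I \<in> \<B>"
    and inv: "ae_inv T (\<lambda>x. x \<in> I)"
  shows "\<mu> ((\<Union>i<n. preim (inv01 T ^^ i) F) \<inter> I) = n * \<mu> (F \<inter> I)"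
proof -
  have Fs: "F \<in> \<B>"
    using F by (simp add: tower_def)
  have "(\<Union>i<n. preim (inv01 T ^^ i) F) \<inter> I =
      (\<Union>i<n. preim (inv01 T ^^ i) F \<inter> I)"
    by blast
  also have "\<mu> \<dots> = (\<Sum>i<n. \<mu> (preim (inv01 T ^^ i) F \<inter> I))"
  proof (rule leb01.finite_measure_finite_Union)
    show "disjoint_family_on (\<lambda>i. preim (inv01 T ^^ i) F \<inter> I) {..<n}"
      using tower_disjoint[OF T F] unfolding disjoint_family_on_def by blast
  qed (use tower_level_sets[OF T F] I in auto)
  also have "\<dots> = (\<Sum>i<n. \<mu> (F \<inter> I))"
    by (intro sum.cong refl measure_inv_Int mpt_pres mpt_funpow mpt_inv T Fs I ae_inv_funpow
        ae_inv_inv inv)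
  finally show ?thesis by simp
qed

text \<open>The base consists of every \<open>n\<close>-th point after a visit to the marker set, as long as the next
  visit is at least \<open>n\<close> steps ahead.  The uncovered points lie less than \<open>n\<close> steps before a visit,
  also relative to an invariant set \<open>I\<close>.\<close>

lemma rokhlin:
  assumes T: "T \<in> mpt" and aper: "AE x in leb01. \<forall>i\<ge>1. (T ^^ i) x \<noteq> x"
    and n: "1 \<le> n" and e: "0 < \<epsilon>"
  shows "\<exists>F. tower T n F \<and>
    (\<forall>I\<in>\<B>. ae_inv T (\<lambda>x. x \<in> I) \<longrightarrow> (1 - \<epsilon>) * \<mu> I \<le> n * \<mu> (F \<inter> I))"
proof -
  let ?U = "inv01 T"
  \<comment> \<open>Visits to the marker set are at least \<open>N\<close> steps apart, so the fewer
    than \<open>n\<close> steps in front of each visit make up a proportion of at most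
    \<open>n / N\<close>, which is below \<open>\<epsilon>\<close>.\<close>
  obtain N where N: "real n / \<epsilon> < real N"
    using reals_Archimedean2 by blast
  have N0: "0 < real N"
    using N e by (smt (verit) divide_nonneg_pos of_nat_0_le_iff)
  obtain B where B: "B \<in> \<B>" and
      Bd: "\<And>x i. x \<in> B \<Longrightarrow> 0 < i \<Longrightarrow> i < N \<Longrightarrow> (T ^^ i) x \<notin> B" and
      Bc: "AE x in leb01. \<exists>a. (?U ^^ a) x \<in> B"
    using marker_set[OF T aper, of N] by blast
  \<comment> \<open>Here \<open>a\<close> is the time elapsed since the last visit to
    \<open>B\<close>.\<close>
  define F where "F = {x \<in> {0..1}. \<exists>a. n dvd a \<and> (?U ^^ a) x \<in> B \<and> (\<forall>a'<a. (?U ^^ a') x \<notin> B) \<and>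
    (\<forall>b\<in>{1..<n}. (T ^^ b) x \<notin> B)}"
  note Tm = funpow_meas(1)[OF T] and Um = funpow_meas(2)[OF T]
  have "F = (\<Union>a\<in>{a. n dvd a}. preim (?U ^^ a) B - (\<Union>a'<a. preim (?U ^^ a') B)
      - (\<Union>b\<in>{1..<n}. preim (T ^^ b) B))"
    unfolding F_def by blast
  also have "\<dots> \<in> \<B>"
    by (intro sets.countable_UN' sets.Diff preim_sets[OF Um B]
        preim_sets[OF Tm B] countableI_type image_subsetI)
  finally have F: "F \<in> \<B>" .
  have tow: "tower T n F"
    unfolding tower_def
  proof (intro conjI ballI allI impI F)
    fix x i assume x: "x \<in> F" and i: "0 < i \<and> i < n"
    show "(T ^^ i) x \<notin> F"
    proof
      assume y: "(T ^^ i) x \<in> F"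
      have x01: "x \<in> {0..1}" using x by (simp add: F_def)
      obtain a where a: "n dvd a" "(?U ^^ a) x \<in> B" "\<And>a'. a' < a \<Longrightarrow> (?U ^^ a') x \<notin> B"
          "\<And>b. b \<in> {1..<n} \<Longrightarrow> (T ^^ b) x \<notin> B"
        using x unfolding F_def by blast
      obtain c where c: "n dvd c" "(?U ^^ c) ((T ^^ i) x) \<in> B"
          "\<And>a'. a' < c \<Longrightarrow> (?U ^^ a') ((T ^^ i) x) \<notin> B"
        using y unfolding F_def by blast
      \<comment> \<open>No visit occurs in the \<open>n - 1\<close> steps after \<open>x\<close>, so
        the elapsed time has grown from \<open>a\<close> to exactly \<open>a + i\<close>. As both
        are multiples of \<open>n\<close>, so would be \<open>i\<close>.\<close>
      have 1: "(?U ^^ (a + i)) ((T ^^ i) x) \<in> B"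
        using a(2) inv_funpow_funpow_ge[OF T x01, of i "a + i"] by simp
      have 2: "(?U ^^ a') ((T ^^ i) x) \<notin> B" if "a' < a + i" for a'
      proof (cases "a' < i")
        case True
        then have "i - a' \<in> {1..<n}" using i by auto
        with True show ?thesis
          using inv_funpow_funpow_le[OF T x01, of a' i] a(4)[of "i - a'"] by simp
      next
        case False
        then show ?thesis
          using inv_funpow_funpow_ge[OF T x01, of i a'] a(3)[of "a' - i"] that by auto
      qed
      have "c = a + i"
        using 1 2 c(2,3) by (metis linorder_neqE_nat)
      then have "n dvd i"
        using a(1) c(1) by (simp add: dvd_add_right_iff)
      with i show False
        by (auto dest: dvd_imp_le)
    qed
  qed
  show ?thesis
  proof (intro exI[of _ F] conjI ballI impI tow)
    fix I assume I: "I \<in> \<B>" and inv: "ae_inv T (\<lambda>x. x \<in> I)"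
    have "tower T N B"
      using B Bd by (auto simp: tower_def)
    have "N * \<mu> (B \<inter> I) = \<mu> ((\<Union>i<N. preim (?U ^^ i) B) \<inter> I)"
      using measure_tower_Int[OF T \<open>tower T N B\<close> I inv] by simp
    also have "\<dots> \<le> \<mu> I"
      by (rule measure_mono01) (use I in auto)
    finally have NB: "N * \<mu> (B \<inter> I) \<le> \<mu> I" .
    let ?W = "\<Union>i<n. preim (?U ^^ i) F"
    let ?V = "\<lambda>b. preim (T ^^ b) B"
    have W: "?W \<in> \<B>" and V: "?V b \<in> \<B>" for b
      using tower_level_sets[OF T tow] preim_sets[OF Tm B] by auto
    have "AE x in leb01. x \<in> I \<longrightarrow> x \<in> (?W \<inter> I) \<union> (\<Union>b\<in>{1..<n}. ?V b \<inter> I)"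
      using Bc AE_in_01
    proof eventually_elim
      case (elim y)
      define a where "a = (LEAST a. (?U ^^ a) y \<in> B)"
      have a: "(?U ^^ a) y \<in> B" "\<And>a'. a' < a \<Longrightarrow> (?U ^^ a') y \<notin> B"
        using elim(1) unfolding a_def by (auto intro: LeastI_ex dest: not_less_Least)
      \<comment> \<open>Going back \<open>i\<close> steps rounds the elapsed time down to a multiple
        of \<open>n\<close>. If the point \<open>?z\<close> reached is not in the base, a visit
        follows it within \<open>n - 1\<close> steps. A visit up to \<open>y\<close> would
        contradict the minimality of \<open>a\<close>; hence it comes after \<open>y\<close>, less
        than \<open>n\<close> steps ahead.\<close>
      define i where "i = a mod n"
      have i: "i < n" "i \<le> a" using n by (auto simp: i_def)
      let ?z = "(?U ^^ i) y"
      have z: "?z \<in> {0..1}" by (rule mpt_inv_funpow_in[OF T elim(2)])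
      have Uz: "(?U ^^ k) ?z = (?U ^^ (k + i)) y" for k
        by (simp add: funpow_add)
      show ?case
      proof (cases "\<forall>b\<in>{1..<n}. (T ^^ b) ?z \<notin> B")
        case True
        have "n dvd (a - i)"
          by (simp add: i_def minus_mod_eq_mult_div)
        moreover have "(?U ^^ (a - i)) ?z \<in> B"
          unfolding Uz using a(1) i by simp
        moreover have "\<forall>a'<a - i. (?U ^^ a') ?z \<notin> B"
          unfolding Uz using a(2) by simp
        ultimately have "?z \<in> F"
          unfolding F_def using True z by blast
        then show ?thesis
          using elim(2) i by blast
      next
        case False
        then obtain b where b: "b \<in> {1..<n}" "(T ^^ b) ?z \<in> B" by blast
        show ?thesis
        proof (cases "b \<le> i")
          case True
          then have "(?U ^^ (i - b)) y \<in> B"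
            using funpow_inv_funpow_le[OF T elim(2) True] b by simp
          moreover have "i - b < a"
            using b i True by auto
          ultimately show ?thesis
            using a(2) by blast
        next
          case False
          then have "(T ^^ (b - i)) y \<in> B"
            using funpow_inv_funpow_ge[OF T elim(2), of i b] b by simp
          moreover have "b - i \<in> {1..<n}"
            using False b by auto
          ultimately show ?thesis
            using elim(2) by blast
        qed
      qed
    qed
    then have "\<mu> I \<le> \<mu> ((?W \<inter> I) \<union> (\<Union>b\<in>{1..<n}. ?V b \<inter> I))"
      by (rule measure_mono_AE01)
         (intro sets.Un sets.Int W I sets.finite_UN V finite_atLeastLessThan)+
    also have "\<dots> \<le> \<mu> (?W \<inter> I) + \<mu> (\<Union>b\<in>{1..<n}. ?V b \<inter> I)"
      by (intro measure_Un_le sets.Int W I sets.finite_UN V finite_atLeastLessThan)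
    also have "\<mu> (\<Union>b\<in>{1..<n}. ?V b \<inter> I) \<le> (\<Sum>b\<in>{1..<n}. \<mu> (?V b \<inter> I))"
      by (intro measure_UNION_le sets.Int V I) auto
    also have "(\<Sum>b\<in>{1..<n}. \<mu> (?V b \<inter> I)) = (\<Sum>b\<in>{1..<n}. \<mu> (B \<inter> I))"
      by (intro sum.cong refl measure_inv_Int mpt_pres mpt_funpow T B I ae_inv_funpow inv)
    also have "\<dots> \<le> n * \<mu> (B \<inter> I)"
      by (simp add: mult_right_mono)
    also have "n * \<mu> (B \<inter> I) \<le> \<epsilon> * (N * \<mu> (B \<inter> I))"
    proof -
      have "real n \<le> \<epsilon> * N"
        using N e by (simp add: field_simps)
      then show ?thesis
        by (simp add: mult_right_mono flip: mult.assoc)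
    qed
    also have "\<epsilon> * (N * \<mu> (B \<inter> I)) \<le> \<epsilon> * \<mu> I"
      using NB e by simp
    finally show "(1 - \<epsilon>) * \<mu> I \<le> n * \<mu> (F \<inter> I)"
      unfolding measure_tower_Int[OF T tow I inv] by (simp add: algebra_simps)
  qed
qed

subsection \<open>Disjoint unions and conjugates\<close>

abbreviation aperiodic_map :: "(real \<Rightarrow> real) \<Rightarrow> bool" where
  "aperiodic_map T \<equiv> AE x in leb01. \<forall>i\<ge>1. (T ^^ i) x \<noteq> x"

abbreviation corr_limit :: "(real \<Rightarrow> real) \<Rightarrow> (nat \<Rightarrow> int) \<Rightarrow> real \<Rightarrow> real set \<Rightarrow> real set \<Rightarrow> bool" where
  "corr_limit T m p A B \<equiv>
     (\<lambda>k. \<mu> (A \<inter> preimage_iter T (m k) B)) \<longlonglongrightarrow> (1 - p) * \<mu> (A \<inter> B) + p * (\<mu> A * \<mu> B)"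

abbreviation mixes_map :: "(real \<Rightarrow> real) \<Rightarrow> (nat \<Rightarrow> int) \<Rightarrow> real \<Rightarrow> bool" where
  "mixes_map T m p \<equiv> \<forall>A\<in>\<B>. \<forall>B\<in>\<B>. corr_limit T m p A B"

text \<open>The index \<open>c x\<close> can be frozen along the orbit because \<open>c\<close> is
  invariant.\<close>

lemma semiconj_funpow:
  assumes W: "W \<in> mpt" and c: "ae_inv W c" and h: "AE x in leb01. h (W x) = S (c x) (h x)"
  shows "AE x in leb01. h ((W ^^ n) x) = (S (c x) ^^ n) (h x)"
proof (induction n)
  case (Suc n)
  from pres_AE[OF mpt_pres[OF mpt_funpow[OF W]] h, of n] Suc ae_inv_funpow[OF mpt_pres[OF W] c, of n]
  show ?case
    by eventually_elim simp
qed simp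

lemma semiconj_inv:
  assumes W: "W \<in> mpt" and S: "\<And>k. S k \<in> mpt" and c: "ae_inv W c"
    and h: "AE x in leb01. h (W x) = S (c x) (h x)" and h01: "\<And>x. x \<in> {0..1} \<Longrightarrow> h x \<in> {0..1}"
  shows "AE x in leb01. h (inv01 W x) = inv01 (S (c x)) (h x)"
  using pres_AE[OF mpt_inv_pres[OF W] h] ae_inv_inv[OF W c] AE_in_01
proof eventually_elim
  case (elim x)
  have "h x = S (c x) (h (inv01 W x))"
    using elim mpt_inv_right[OF W, of x] by simp
  then show ?case
    by (simp only: mpt_inv_left[OF S h01[OF mpt_inv_in[OF W elim(3)]]])
qed

lemma semiconj_int_iter:
  assumes W: "W \<in> mpt" and S: "\<And>k. S k \<in> mpt" and c: "ae_inv W c"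
    and h: "AE x in leb01. h (W x) = S (c x) (h x)" and h01: "\<And>x. x \<in> {0..1} \<Longrightarrow> h x \<in> {0..1}"
  shows "AE x in leb01. h (int_iter W m x) = int_iter (S (c x)) m (h x)"
proof (cases "0 \<le> m")
  case True
  then show ?thesis
    using semiconj_funpow[where S = S, OF W c h] by (simp add: int_iter_def)
next
  case False
  then show ?thesis
    using semiconj_funpow[where S = "\<lambda>k. inv01 (S k)", OF mpt_inv[OF W] ae_inv_inv[OF W c] semiconj_inv[OF assms]]
    by (simp add: int_iter_def)
qed

lemma ae_inv_int_iter:
  assumes "W \<in> mpt" "ae_inv W c"
  shows "ae_inv (int_iter W m) c"
  using ae_inv_funpow[OF mpt_pres[OF assms(1)] assms(2)]
    ae_inv_funpow[OF mpt_pres[OF mpt_inv[OF assms(1)]] ae_inv_inv[OF assms]]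
  by (simp add: int_iter_def)

lemma measure_zero_subset: "A \<subseteq> B \<Longrightarrow> B \<in> \<B> \<Longrightarrow> \<mu> B = 0 \<Longrightarrow> \<mu> A = 0"
  by (metis measure_mono01 measure_nonneg order_antisym)

lemma measure_sum_lev:
  assumes c: "label c" and K: "\<And>x. x \<in> {0..1} \<Longrightarrow> c x < K" and X: "X \<in> \<B>"
  shows "\<mu> X = (\<Sum>k<K. \<mu> (X \<inter> lev c k))"
proof -
  have "(\<lambda>k. \<mu> (X \<inter> lev c k)) sums (\<Sum>k<K. \<mu> (X \<inter> lev c k))"
  proof (rule sums_finite)
    fix k assume "k \<notin> {..<K}"
    then have "X \<inter> lev c k = {}"
      using K by fastforce
    then show "\<mu> (X \<inter> lev c k) = 0" by (simp only: measure_empty)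
  qed simp
  with measure_sums_lev[OF c X] show ?thesis
    by (rule sums_unique2)
qed

text \<open>For null \<open>E\<close> the quotient is 0 by the convention on division, so
  \<open>coord\<close> below stays in the interval even on null pieces.\<close>

lemma relcdf_mem: "E \<in> \<B> \<Longrightarrow> relcdf E x \<in> {0..1}"
  using relcdf_bounds[of E x]
  by (cases "\<mu> E = 0") (auto simp: relcdf_def[where x = x] zero_less_measure_iff)

text \<open>The position of a point inside its own piece, rescaled to the unit interval. In this
  coordinate the disjoint union acts on the piece \<open>k\<close> as \<open>S k\<close>.\<close>

definition coord :: "(real \<Rightarrow> nat) \<Rightarrow> real \<Rightarrow> real" where
  "coord c x = relcdf (lev c (c x)) x"

lemma coord_mem: "label c \<Longrightarrow> coord c x \<in> {0..1}"
  unfolding coord_def by (intro relcdf_mem lev_sets)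

lemma disjoint_union_exists:
  assumes c: "label c" and S: "\<And>k. S k \<in> mpt"
  shows "\<exists>W\<in>mpt. ae_inv W c \<and> (AE x in leb01. coord c (W x) = S (c x) (coord c x))"
proof -
  obtain W where W: "W \<in> mpt" and *: "AE x in leb01. c (W x) = c x \<and>
      W x = quantile (lev c (c x)) (S (c x) (relcdf (lev c (c x)) x)) \<and> 0 < \<mu> (lev c (c x))"
    using mpt_glue[where c = c and c' = c and S = S, OF c c refl S] by blast
  from * have "ae_inv W c"
    by eventually_elim blast
  moreover from * have "AE x in leb01. coord c (W x) = S (c x) (coord c x)"
  proof eventually_elim
    case (elim x)
    have "relcdf (lev c (c x)) (W x) = S (c x) (relcdf (lev c (c x)) x)"
      using elim relcdf_quantile[OF lev_sets[OF c] _ mpt_in[OF S relcdf_mem[OF lev_sets[OF c]]]]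
      by metis
    moreover have "c (W x) = c x"
      using elim by blast
    ultimately show ?case
      by (simp only: coord_def)
  qed
  ultimately show ?thesis
    using W by blast
qed

locale disjoint_union =
  fixes c :: "real \<Rightarrow> nat" and S :: "nat \<Rightarrow> real \<Rightarrow> real" and W :: "real \<Rightarrow> real"
  assumes c: "label c" and S: "\<And>k. S k \<in> mpt" and W: "W \<in> mpt"
    and c_inv: "ae_inv W c"
    and coord: "AE x in leb01. coord c (W x) = S (c x) (coord c x)"
begin

text \<open>A period of \<open>x\<close> under \<open>W\<close> is also a period of
  \<open>coord c x\<close> under the component map.\<close>

lemma aperiodic_union:
  assumes "\<And>k. 0 < \<mu> (lev c k) \<Longrightarrow> aperiodic_map (S k)"
  shows "aperiodic_map W"
proof -
  have "AE x in leb01. \<forall>i. coord c ((W ^^ i) x) = (S (c x) ^^ i) (coord c x)"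
    using semiconj_funpow[where h = "coord c" and S = S, OF W c_inv coord]
    by (simp only: AE_all_countable) blast
  moreover have "AE x in leb01. \<forall>i\<ge>1. (S (c x) ^^ i) (coord c x) \<noteq> coord c x"
  proof (rule AE_lev_pos_I[OF c])
    fix k assume pos: "0 < \<mu> (lev c k)"
    from AE_relcdf[OF lev_sets[OF c] pos assms[OF pos]]
    show "AE x in leb01. x \<in> lev c k \<longrightarrow>
      (\<forall>i\<ge>1. (S (c x) ^^ i) (coord c x) \<noteq> coord c x)"
      by eventually_elim (simp add: coord_def)
  qed
  ultimately show ?thesis
    by eventually_elim metis
qed

text \<open>In the coordinate of the piece, \<open>W\<close> becomes \<open>S k\<close> and a set
  becomes its preimage under the quantile function.\<close>

lemma measure_corr_lev:
  assumes A: "A \<in> \<B>" and B: "B \<in> \<B>" and pos: "0 < \<mu> (lev c k)"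
  defines "q \<equiv> \<lambda>A. preim (quantile (lev c k)) A"
  shows "\<mu> (A \<inter> preimage_iter W m B \<inter> lev c k) =
    \<mu> (lev c k) * \<mu> (q A \<inter> preimage_iter (S k) m (q B))"
proof -
  let ?E = "lev c k"
  note E = lev_sets[OF c, of k]
  have q: "q A \<in> \<B>" "q B \<in> \<B>"
    unfolding q_def
    by (intro preim_sets quantile_meas E pos A B)+
  let ?Q = "q A \<inter> preimage_iter (S k) m (q B)"
  have Q: "?Q \<in> \<B>"
    by (intro sets.Int q preimage_iter_sets S)
  have qr: "AE x in leb01. x \<in> ?E \<longrightarrow> quantile ?E (relcdf ?E x) = x"
    by (rule AE_quantile_relcdf[OF E pos])
  have "\<mu> (A \<inter> preimage_iter W m B \<inter> ?E) = \<mu> (?E \<inter> preim (relcdf ?E) ?Q)"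
  proof (rule leb01.finite_measure_eq_AE)
    show "AE x in leb01. (x \<in> A \<inter> preimage_iter W m B \<inter> ?E) =
        (x \<in> ?E \<inter> preim (relcdf ?E) ?Q)"
      using qr pres_AE[OF mpt_int_iter_pres[OF W] qr, of m] ae_inv_int_iter[OF W c_inv, of m]
        semiconj_int_iter[where h = "coord c" and S = S, OF W S c_inv coord coord_mem[OF c], of m]
        AE_in_01
    proof eventually_elim
      case (elim x)
      have r: "relcdf ?E x \<in> {0..1}" by (rule relcdf_mem[OF E])
      have w: "int_iter W m x \<in> {0..1}" and s: "int_iter (S k) m (relcdf ?E x) \<in> {0..1}"
        using mpt_in[OF mpt_int_iter[OF W]] mpt_in[OF mpt_int_iter[OF S]] elim(5) r by blast+
      show ?case
      proof (cases "c x = k")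
        case True
        then have *: "relcdf ?E (int_iter W m x) = int_iter (S k) m (relcdf ?E x)"
          using elim(3,4) by (simp add: coord_def)
        have "quantile ?E (int_iter (S k) m (relcdf ?E x)) = int_iter W m x"
          using elim(2,3) True w * by simp
        moreover have "quantile ?E (relcdf ?E x) = x"
          using elim(1,5) True by simp
        ultimately show ?thesis
          using True elim(5) w r s by (simp add: q_def preimage_iter_def del: atLeastAtMost_iff)
      qed simp
    qed
  qed (intro sets.Int A preimage_iter_sets W B E preim_sets relcdf_meas pos Q)+
  also have "\<dots> = \<mu> ?E * \<mu> ?Q"
    by (rule measure_relcdf[OF E pos Q])
  finally show ?thesis .
qed

text \<open>Independence makes the relative measures of \<open>A\<close>, \<open>B\<close> and
  \<open>A \<inter> B\<close> in each component equal to their full measures. So every component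
  contributes the same two quantities, and averaging only affects the weight \<open>\<xi> k\<close>.
  The bound \<open>K\<close> reduces the exchange of limit and sum to a finite sum.\<close>

lemma corr_tendsto:
  assumes K: "\<And>x. x \<in> {0..1} \<Longrightarrow> c x < K"
    and A: "A \<in> \<B>" and B: "B \<in> \<B>"
    and ind: "\<And>k. \<mu> (A \<inter> lev c k) = \<mu> A * \<mu> (lev c k)" "\<And>k. \<mu> (B \<inter> lev c k) = \<mu> B * \<mu> (lev c k)"
      "\<And>k. \<mu> (A \<inter> B \<inter> lev c k) = \<mu> (A \<inter> B) * \<mu> (lev c k)"
    and mix: "\<And>k. 0 < \<mu> (lev c k) \<Longrightarrow> mixes_map (S k) m (\<xi> k)"
    and p: "p = (\<Sum>k<K. \<mu> (lev c k) * \<xi> k)"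
  shows "corr_limit W m p A B"
proof -
  note split = measure_sum_lev[OF c K]
  have one: "(\<Sum>k<K. \<mu> (lev c k)) = 1"
  proof -
    have "{0..1} \<inter> lev c k = lev c k" for k by auto
    then show ?thesis
      using split[of "{0..1}"] sets.top[of leb01] by simp
  qed
  have lim: "(\<lambda>l. \<mu> (A \<inter> preimage_iter W (m l) B \<inter> lev c k)) \<longlonglongrightarrow>
      \<mu> (lev c k) * ((1 - \<xi> k) * \<mu> (A \<inter> B) + \<xi> k * (\<mu> A * \<mu> B))" for k
  proof (cases "0 < \<mu> (lev c k)")
    case True
    let ?q = "\<lambda>A. preim (quantile (lev c k)) A"
    have qs: "?q X \<in> \<B>" if "X \<in> \<B>" for X
      by (intro preim_sets quantile_meas lev_sets c True that)
    have qm: "\<mu> (?q X) = \<mu> X" if "X \<in> \<B>" "\<mu> (X \<inter> lev c k) = \<mu> X * \<mu> (lev c k)" for X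
      using measure_quantile[OF lev_sets[OF c] True that(1)] that(2) True by (simp add: Int_commute)
    have qq: "?q A \<inter> ?q B = ?q (A \<inter> B)" by blast
    have "(\<lambda>l. \<mu> (?q A \<inter> preimage_iter (S k) (m l) (?q B))) \<longlonglongrightarrow>
        (1 - \<xi> k) * \<mu> (A \<inter> B) + \<xi> k * (\<mu> A * \<mu> B)"
      using mix[OF True, rule_format, OF qs[OF A] qs[OF B]]
      by (simp only: qq qm[OF A ind(1)] qm[OF B ind(2)] qm[OF sets.Int[OF A B] ind(3)])
    then show ?thesis
      unfolding measure_corr_lev[OF A B True] by (intro tendsto_mult tendsto_const)
  next
    case False
    then have 0: "\<mu> (lev c k) = 0"
      using measure_nonneg[of leb01 "lev c k"] by linarith
    have "\<mu> (A \<inter> preimage_iter W (m l) B \<inter> lev c k) = 0" for l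
      by (rule measure_zero_subset[OF Int_lower2 lev_sets[OF c] 0])
    with 0 show ?thesis by simp
  qed
  have "(\<lambda>l. \<Sum>k<K. \<mu> (A \<inter> preimage_iter W (m l) B \<inter> lev c k)) \<longlonglongrightarrow>
      (\<Sum>k<K. \<mu> (lev c k) * ((1 - \<xi> k) * \<mu> (A \<inter> B) + \<xi> k * (\<mu> A * \<mu> B)))"
    by (intro tendsto_sum lim)
  also have "(\<lambda>l. \<Sum>k<K. \<mu> (A \<inter> preimage_iter W (m l) B \<inter> lev c k)) =
      (\<lambda>l. \<mu> (A \<inter> preimage_iter W (m l) B))"
    by (intro ext split[symmetric] sets.Int A preimage_iter_sets W B)
  also have "(\<Sum>k<K. \<mu> (lev c k) * ((1 - \<xi> k) * \<mu> (A \<inter> B) + \<xi> k * (\<mu> A * \<mu> B))) =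
      ((\<Sum>k<K. \<mu> (lev c k)) - p) * \<mu> (A \<inter> B) + p * (\<mu> A * \<mu> B)"
    by (simp add: p sum_distrib_left sum_distrib_right sum_subtractf algebra_simps sum.distrib)
  finally show ?thesis
    by (simp only: one)
qed

end

lemma conj_mpt: "f \<in> mpt \<Longrightarrow> W \<in> mpt \<Longrightarrow> inv01 f \<circ> W \<circ> f \<in> mpt"
  by (intro mpt_comp mpt_inv)

lemma conj_AE:
  assumes "f \<in> mpt" "W \<in> mpt"
  shows "AE x in leb01. f ((inv01 f \<circ> W \<circ> f) x) = W (f x)"
  using AE_in_01 by eventually_elim (simp add: mpt_inv_right[OF assms(1)] mpt_in assms del: atLeastAtMost_iff)

lemma aperiodic_conj:
  assumes f: "f \<in> mpt" and W: "W \<in> mpt" and "aperiodic_map W"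
  shows "aperiodic_map (inv01 f \<circ> W \<circ> f)"
proof -
  \<comment> \<open>A conjugacy is the case of a constant label in the semiconjugacy lemma.\<close>
  have "AE x in leb01. \<forall>i. f (((inv01 f \<circ> W \<circ> f) ^^ i) x) = (W ^^ i) (f x)"
    unfolding AE_all_countable
    using semiconj_funpow[where c = "\<lambda>_. 0::nat" and S = "\<lambda>_. W" and h = f,
        OF conj_mpt[OF f W] AE_I2[OF refl] conj_AE[OF f W]]
    by blast
  with pres_AE[OF mpt_pres[OF f] assms(3)] show ?thesis
    by eventually_elim metis
qed

lemma measure_corr_conj:
  assumes f: "f \<in> mpt" and W: "W \<in> mpt" and A: "A \<in> \<B>" and B: "B \<in> \<B>"
  shows "\<mu> (A \<inter> preimage_iter (inv01 f \<circ> W \<circ> f) m B) =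
    \<mu> (preim (inv01 f) A \<inter> preimage_iter W m (preim (inv01 f) B))"
proof -
  let ?T = "inv01 f \<circ> W \<circ> f" and ?f = "\<lambda>A. preim (inv01 f) A"
  have fs: "?f X \<in> \<B>" if "X \<in> \<B>" for X
    by (intro preim_sets mpt_inv_meas f that)
  let ?Q = "?f A \<inter> preimage_iter W m (?f B)"
  have Q: "?Q \<in> \<B>"
    by (intro sets.Int fs A preimage_iter_sets W B)
  have "AE x in leb01. f (int_iter ?T m x) = int_iter W m (f x)"
    using semiconj_int_iter[where c = "\<lambda>_. 0::nat" and S = "\<lambda>_. W" and h = f,
        OF conj_mpt[OF f W] W AE_I2[OF refl] conj_AE[OF f W] mpt_in[OF f]] by blast
  then have "AE x in leb01. (x \<in> A \<inter> preimage_iter ?T m B) = (x \<in> preim f ?Q)"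
    using AE_in_01
  proof eventually_elim
    case (elim x)
    have "int_iter ?T m x \<in> {0..1}"
      using mpt_in[OF mpt_int_iter[OF conj_mpt[OF f W]] elim(2)] .
    then have "inv01 f (int_iter W m (f x)) = int_iter ?T m x"
      unfolding elim(1)[symmetric] by (rule mpt_inv_left[OF f])
    then show ?case
      using elim(2) mpt_in[OF f elim(2)] mpt_inv_left[OF f elim(2)]
        mpt_in[OF mpt_int_iter[OF W] mpt_in[OF f elim(2)]]
      by (simp add: preimage_iter_def del: atLeastAtMost_iff)
  qed
  then have "\<mu> (A \<inter> preimage_iter ?T m B) = \<mu> (preim f ?Q)"
    by (rule leb01.finite_measure_eq_AE)
       (intro sets.Int A preimage_iter_sets conj_mpt f W B preim_sets mpt_meas Q)+
  then show ?thesis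
    using pres_measure[OF mpt_pres[OF f] Q] by simp
qed

subsection \<open>Matching towers\<close>

text \<open>An independent uniform variable, cut at the fraction \<open>t / \<mu> A\<close>, selects
  the right share of \<open>A\<close>.\<close>

lemma subset_of_measure:
  assumes A: "A \<in> \<B>" and t: "0 \<le> t" "t \<le> \<mu> A"
  shows "\<exists>B\<in>\<B>. B \<subseteq> A \<and> \<mu> B = t"
proof (cases "\<mu> A = 0")
  case True
  with A t show ?thesis by (intro bexI[of _ A]) auto
next
  case False
  then have pos: "0 < \<mu> A"
    using t by linarith
  obtain U where U: "U \<in> meas01"
    and ind: "\<And>B. B \<in> \<B> \<Longrightarrow> \<mu> (A \<inter> preim U B) = \<mu> A * \<mu> B"
    using independent_uniform[of "{A}"] A by auto
  have "t / \<mu> A \<le> 1"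
    using t pos by simp
  then have B: "{0..t / \<mu> A} \<in> \<B>"
    by (simp add: sets_leb01)
  have "\<mu> (A \<inter> preim U {0..t / \<mu> A}) = t"
    using ind[OF B] pos t by (simp add: measure_leb01_eq[OF B])
  then show ?thesis
    using preim_sets[OF U B] A by blast
qed

lemma subset_of_lev_measure:
  assumes A: "A \<in> \<B>" and c: "label c"
    and t: "\<And>k. 0 \<le> t k" "\<And>k. t k \<le> \<mu> (A \<inter> lev c k)"
  shows "\<exists>B\<in>\<B>. B \<subseteq> A \<and> (\<forall>k. \<mu> (B \<inter> lev c k) = t k)"
proof -
  have "\<exists>B. B \<in> \<B> \<and> B \<subseteq> A \<inter> lev c k \<and> \<mu> B = t k" for k
    using subset_of_measure[OF sets.Int[OF A lev_sets[OF c]] t] by blast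
  then obtain B where B: "\<And>k. B k \<in> \<B>" "\<And>k. B k \<subseteq> A \<inter> lev c k" "\<And>k. \<mu> (B k) = t k"
    by metis
  have "(\<Union>k. B k) \<inter> lev c k = B k" for k
    using B(2) by fastforce
  moreover have "(\<Union>k. B k) \<subseteq> A"
    using B(2) by blast
  ultimately show ?thesis
    using B by (intro bexI[of _ "\<Union>k. B k"] conjI allI) auto
qed

text \<open>Points outside the tower receive the value \<open>n\<close>, so the levels and the
  remainder form one partition with labels up to \<open>n\<close>.\<close>

definition level :: "(real \<Rightarrow> real) \<Rightarrow> nat \<Rightarrow> real set \<Rightarrow> real \<Rightarrow> nat" where
  "level T n F x = (LEAST i. i = n \<or> (inv01 T ^^ i) x \<in> F)"

lemma level_le: "level T n F x \<le> n"
  unfolding level_def by (rule Least_le) simp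

lemma level_mem: "level T n F x < n \<Longrightarrow> (inv01 T ^^ level T n F x) x \<in> F"
  using LeastI[of "\<lambda>i. i = n \<or> (inv01 T ^^ i) x \<in> F" n] unfolding level_def by auto

context
  fixes T :: "real \<Rightarrow> real" and n :: nat and F :: "real set"
  assumes T: "T \<in> mpt" and F: "tower T n F"
begin

lemma level_eq:
  assumes "x \<in> {0..1}" "i < n" "(inv01 T ^^ i) x \<in> F"
  shows "level T n F x = i"
proof -
  have "level T n F x \<le> i"
    unfolding level_def using assms(3) by (intro Least_le) simp
  then have "level T n F x < n"
    using assms by simp
  from level_mem[OF this] show ?thesis
    using tower_disjoint[OF T F assms(1) \<open>level T n F x < n\<close> assms(2) _ assms(3)] by blast
qed

lemma lev_level: "i < n \<Longrightarrow> lev (level T n F) i = preim (inv01 T ^^ i) F"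
  using level_eq[of _ i] level_mem[of T n F] by (auto simp: set_eq_iff simp del: atLeastAtMost_iff)

lemma lev_level_top: "lev (level T n F) n = {0..1} - (\<Union>i<n. preim (inv01 T ^^ i) F)"
proof (intro set_eqI iffI)
  fix x assume x: "x \<in> {0..1} - (\<Union>i<n. preim (inv01 T ^^ i) F)"
  then have "level T n F x = n"
    using level_mem[of T n F x] level_le[of T n F x] by fastforce
  with x show "x \<in> lev (level T n F) n" by simp
next
  fix x assume x: "x \<in> lev (level T n F) n"
  have False if "i < n" "(inv01 T ^^ i) x \<in> F" for i
    using level_eq[OF _ that] x that by simp
  with x show "x \<in> {0..1} - (\<Union>i<n. preim (inv01 T ^^ i) F)"
    by (auto simp del: atLeastAtMost_iff)
qed

lemma lev_level_above: "n < i \<Longrightarrow> lev (level T n F) i = {}"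
  using level_le[of T n F] by (auto simp: not_le[symmetric])

lemma label_level: "label (level T n F)"
proof (rule labelI)
  fix k
  consider "k < n" | "k = n" | "n < k" by linarith
  then show "lev (level T n F) k \<in> \<B>"
  proof cases
    case 1
    then show ?thesis using tower_level_sets[OF T F] by (simp only: lev_level)
  next
    case 2
    show ?thesis
      unfolding 2 lev_level_top by (intro sets.Diff sets.finite_UN tower_level_sets[OF T F]) auto
  next
    case 3
    then show ?thesis by (simp only: lev_level_above sets.empty_sets)
  qed
qed

lemma measure_lev_level_Int:
  assumes I: "I \<in> \<B>" and inv: "ae_inv T (\<lambda>x. x \<in> I)"
  shows "\<mu> (lev (level T n F) i \<inter> I) =
    (if i < n then \<mu> (F \<inter> I) else if i = n then \<mu> I - n * \<mu> (F \<inter> I) else 0)"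
proof -
  have Fs: "F \<in> \<B>"
    using F by (simp add: tower_def)
  consider "i < n" | "i = n" | "n < i" by linarith
  then show ?thesis
  proof cases
    case 1
    then have "\<mu> (lev (level T n F) i \<inter> I) = \<mu> (F \<inter> I)"
      unfolding lev_level[OF 1]
      by (intro measure_inv_Int mpt_pres mpt_funpow mpt_inv T Fs I ae_inv_funpow ae_inv_inv inv)
    with 1 show ?thesis by simp
  next
    case 2
    let ?W = "\<Union>i<n. preim (inv01 T ^^ i) F"
    have W: "?W \<in> \<B>"
      by (intro sets.finite_UN tower_level_sets[OF T F]) auto
    have "lev (level T n F) i \<inter> I = I - ?W \<inter> I"
      unfolding 2 lev_level_top using I by (auto simp: sets_leb01)
    then have "\<mu> (lev (level T n F) i \<inter> I) = \<mu> I - \<mu> (?W \<inter> I)"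
      using leb01.finite_measure_Diff[OF I sets.Int[OF W I]] by simp
    also have "\<mu> (?W \<inter> I) = n * \<mu> (F \<inter> I)"
      by (rule measure_tower_Int[OF T F I inv])
    finally show ?thesis using 2 by simp
  next
    case 3
    then show ?thesis by (simp add: lev_level_above)
  qed
qed

end

context disjoint_union
begin

text \<open>The conjugacy matches the two towers level by level.  The base of the given tower is
  split independently of the itineraries of the sets \<open>\<A>\<close>; as the components of \<open>W\<close> are carried
  to these pieces, they become independent of \<open>\<A>\<close>.\<close>

lemma matching_conjugacy:
  assumes aper: "aperiodic_map W"
    and T: "T \<in> mpt" and F: "tower T n F" and n: "1 \<le> n" and e: "0 < \<epsilon>" "\<epsilon> \<le> 1"
    and F_large: "1 - \<epsilon> \<le> n * \<mu> F"
    and \<A>: "finite \<A>" "\<A> \<subseteq> \<B>"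
  shows "\<exists>f\<in>mpt. \<mu> (disagree (inv01 f \<circ> W \<circ> f) T) \<le> \<epsilon> + 1 / n \<and>
    (\<forall>A\<in>\<A>. \<forall>k. \<mu> (preim (inv01 f) A \<inter> lev c k) = \<mu> A * \<mu> (lev c k))"
proof -
  \<comment> \<open>Both bases are trimmed to this common measure, the one of \<open>W\<close> even
    proportionally inside each component.\<close>
  define \<tau> where "\<tau> = (1 - \<epsilon>) / n"
  have n\<tau>: "n * \<tau> = 1 - \<epsilon>" and \<tau>0: "0 \<le> \<tau>"
    using n e by (auto simp: \<tau>_def)
  obtain F1 where F1: "F1 \<in> \<B>" "F1 \<subseteq> F" "\<mu> F1 = \<tau>"
  proof -
    have "\<tau> \<le> \<mu> F"
      using F_large n by (simp add: \<tau>_def field_simps)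
    then show thesis
      using subset_of_measure[of F \<tau>] F \<tau>0 that by (auto simp: tower_def)
  qed
  have tow1: "tower T n F1"
    by (rule tower_subset[OF F F1(2,1)])
  have lev_inv: "ae_inv W (\<lambda>x. x \<in> lev c k)" for k
    using c_inv AE_in_01 by eventually_elim (use mpt_in[OF W] in \<open>simp del: atLeastAtMost_iff\<close>)
  obtain G0 where G0: "tower W n G0"
    "\<And>I. I \<in> \<B> \<Longrightarrow> ae_inv W (\<lambda>x. x \<in> I) \<Longrightarrow> (1 - \<epsilon>) * \<mu> I \<le> n * \<mu> (G0 \<inter> I)"
    using rokhlin[OF W aper n e(1)] by blast
  have G0s: "G0 \<in> \<B>"
    using G0(1) by (simp add: tower_def)
  have "\<tau> * \<mu> (lev c k) \<le> \<mu> (G0 \<inter> lev c k)" for k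
    using G0(2)[OF lev_sets[OF c] lev_inv, of k] n by (simp add: \<tau>_def field_simps)
  then obtain G where G: "G \<in> \<B>" "G \<subseteq> G0" "\<And>k. \<mu> (G \<inter> lev c k) = \<tau> * \<mu> (lev c k)"
    using subset_of_lev_measure[OF G0s c, of "\<lambda>k. \<tau> * \<mu> (lev c k)"] \<tau>0 by auto
  have tow2: "tower W n G"
    by (rule tower_subset[OF G0(1) G(2,1)])
  let ?U = "inv01 T"
  define p where "p = level T n F1"
  define p' where "p' = level W n G"
  have p: "label p" and p': "label p'"
    unfolding p_def p'_def by (auto intro: label_level T tow1 W tow2)
  note Tm = funpow_meas(1)[OF T] and Um = funpow_meas(2)[OF T]
  have p_meas: "\<mu> (lev p i) = (if i < n then \<tau> else if i = n then 1 - n * \<tau> else 0)" for i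
  proof -
    have "ae_inv T (\<lambda>x. x \<in> {0..1})"
      using AE_in_01 by eventually_elim (use mpt_in[OF T] in blast)
    moreover have "lev p i \<inter> {0..1} = lev p i" "F1 \<inter> {0..1} = F1"
      using F1(1) by (auto simp: sets_leb01)
    ultimately show ?thesis
      using measure_lev_level_Int[OF T tow1 top_sets01, of i] F1(3) by (simp add: p_def)
  qed
  \<comment> \<open>For \<open>W\<close>, level and component are independent because its base meets
    all components in proportion. The label \<open>d\<close> below is chosen to give the same joint
    law on the side of \<open>T\<close>.\<close>
  have p'_meas: "\<mu> (lev p' i \<inter> lev c k) = \<mu> (lev p i) * \<mu> (lev c k)" for i k
    unfolding p_meas using measure_lev_level_Int[OF W tow2 lev_sets[OF c] lev_inv, of i k] G(3)
    by (simp add: p'_def algebra_simps)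
  \<comment> \<open>The base points whose \<open>i\<close>-th iterate lies in \<open>A\<close>, for
    each level, and the trace of \<open>A\<close> on the remainder. The levels themselves are
    included for the joint law of \<open>p\<close> and \<open>d\<close>.\<close>
  define \<C> where "\<C> = lev p ` {..n} \<union> (\<lambda>(i, A). F1 \<inter> preim (T ^^ i) A) ` ({..<n} \<times> \<A>)
    \<union> (\<lambda>A. lev p n \<inter> A) ` \<A>"
  have "finite \<C>"
    using \<A> by (simp add: \<C>_def)
  moreover have "\<C> \<subseteq> \<B>"
    unfolding \<C>_def using \<A>(2) preim_sets[OF Tm]
    by (auto intro!: lev_sets p F1 sets.Int simp del: atLeastAtMost_iff)
  ultimately obtain Z where Z: "Z \<in> meas01"
    and Z_ind: "\<And>C B. C \<in> \<C> \<Longrightarrow> B \<in> \<B> \<Longrightarrow> \<mu> (C \<inter> preim Z B) = \<mu> C * \<mu> B"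
    using independent_uniform[of \<C>] by blast
  \<comment> \<open>\<open>Z\<close> is uniform given each set in \<open>\<C>\<close>, so on these
    sets \<open>d\<close> has the law of \<open>c\<close>.\<close>
  define d where "d x = c (Z x)" for x
  have d: "label d"
    unfolding d_def by (rule label_comp[OF c Z])
  have d_ind: "\<mu> (C \<inter> lev d k) = \<mu> C * \<mu> (lev c k)" if "C \<in> \<C>" for C k
  proof -
    have "lev d k = preim Z (lev c k)"
      using meas_in_01[OF Z] by (auto simp: d_def simp del: atLeastAtMost_iff)
    then show ?thesis
      using Z_ind[OF that lev_sets[OF c]] by simp
  qed
  obtain \<Phi> where \<Phi>: "\<Phi> \<in> mpt"
    and \<Phi>_eq: "AE x in leb01. prod_encode (p' (\<Phi> x), c (\<Phi> x)) = prod_encode (p x, d x)"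
  proof -
    have "\<mu> (lev (\<lambda>x. prod_encode (p x, d x)) j) = \<mu> (lev (\<lambda>x. prod_encode (p' x, c x)) j)" for j
    proof (cases "fst (prod_decode j) \<le> n")
      case True
      then have "lev p (fst (prod_decode j)) \<in> \<C>"
        by (simp add: \<C>_def)
      then show ?thesis
        unfolding lev_prod_encode p'_meas by (rule d_ind)
    next
      case False
      then have "lev p (fst (prod_decode j)) = {}"
        unfolding p_def by (intro lev_level_above T tow1) simp
      then show ?thesis
        unfolding lev_prod_encode p'_meas by simp
    qed
    from mpt_glue[where S = "\<lambda>_ x. x", OF label_prod[OF p d] label_prod[OF p' c] this id_in_mpt]
    show thesis
      using that by (auto elim: AE_mp)
  qed
  \<comment> \<open>On level \<open>i\<close>: descend to the base along \<open>T\<close>, cross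
    over by \<open>\<Phi>\<close>, climb again along \<open>W\<close>. Thus \<open>\<Phi>\<close>
    acts only on the base and on the remainder.\<close>
  define f where "f i = (if i < n then (W ^^ i) \<circ> \<Phi> \<circ> (?U ^^ i) else \<Phi>)" for i
  have f: "f i \<in> mpt" for i
    by (auto simp: f_def intro!: mpt_comp mpt_funpow mpt_inv W \<Phi> T)
  have AE_U: "AE x in leb01. \<forall>i. p' (\<Phi> ((?U ^^ i) x)) = p ((?U ^^ i) x) \<and> c (\<Phi> ((?U ^^ i) x)) = d ((?U ^^ i) x)"
    unfolding AE_all_countable
  proof
    fix i
    have "AE x in leb01. p' (\<Phi> x) = p x \<and> c (\<Phi> x) = d x"
      using \<Phi>_eq by eventually_elim simp
    then show "AE x in leb01. p' (\<Phi> ((?U ^^ i) x)) = p ((?U ^^ i) x) \<and> c (\<Phi> ((?U ^^ i) x)) = d ((?U ^^ i) x)"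
      by (rule pres_AE[OF mpt_pres[OF mpt_funpow[OF mpt_inv[OF T]]]])
  qed
  have p_base: "p ((?U ^^ p x) x) = 0" if "x \<in> {0..1}" "p x < n" for x
    unfolding p_def
    by (rule level_eq[OF T tow1 mpt_inv_funpow_in[OF T that(1)]])
       (use level_mem that n in \<open>auto simp: p_def\<close>)
  have "AE x in leb01. p' (f (p x) x) = p x"
    using AE_U AE_in_01
  proof eventually_elim
    case (elim x)
    show ?case
    proof (cases "p x < n")
      case True
      let ?y = "\<Phi> ((?U ^^ p x) x)"
      have y: "?y \<in> {0..1}"
        by (rule mpt_in[OF \<Phi> mpt_inv_funpow_in[OF T elim(2)]])
      have "p' ?y = 0"
        using elim(1) p_base[OF elim(2) True] by simp
      then have "?y \<in> G"
        using level_mem[of W n G ?y] n by (simp add: p'_def)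
      then have "level W n G ((W ^^ p x) ?y) = p x"
        using inv_funpow_left[OF W y]
        by (intro level_eq[OF W tow2 mpt_funpow_in[OF W y] True]) simp
      then show ?thesis
        using True by (simp add: f_def p'_def)
    next
      case False
      then show ?thesis
        using elim(1)[THEN spec, of 0] by (simp add: f_def)
    qed
  qed
  from mpt_piecewise[OF p p' f this] obtain g where g: "g \<in> mpt" and
    g_eq: "AE x in leb01. g x = f (p x) x" by blast
  \<comment> \<open>Below the top level, one more step of \<open>T\<close> leads to the next level
    and one more climb by \<open>W\<close>, so the conjugacy is exact there. What is left is the
    remainder, of measure \<open>\<epsilon>\<close>, and the top level, of measure
    \<open>\<tau>\<close>.\<close>
  have bad: "AE x in leb01. x \<in> disagree (inv01 g \<circ> W \<circ> g) T \<longrightarrow> x \<in> lev p n \<union> lev p (n - 1)"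
    using g_eq pres_AE[OF mpt_pres[OF T] g_eq] AE_in_01
  proof eventually_elim
    case (elim x)
    show ?case
    proof (cases "p x + 1 < n")
      case True
      let ?i = "p x"
      have i: "?i < n" using True by simp
      have U1: "(?U ^^ Suc ?i) (T x) = (?U ^^ ?i) x"
        by (simp only: funpow_Suc_right comp_apply mpt_inv_left[OF T elim(3)])
      have "p (T x) = Suc ?i"
        unfolding p_def
      proof (rule level_eq[OF T tow1 mpt_in[OF T elim(3)]])
        show "Suc (level T n F1 x) < n"
          using True by (simp add: p_def)
        show "(?U ^^ Suc (level T n F1 x)) (T x) \<in> F1"
          using level_mem[of T n F1 x] i U1 by (simp only: p_def)
      qed
      then have "g (T x) = (W ^^ Suc ?i) (\<Phi> ((?U ^^ ?i) x))"
        using elim(2) True U1 by (simp only: f_def Suc_eq_plus1 if_True comp_apply)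
      also have "\<dots> = W (g x)"
        using elim(1) i by (simp add: f_def)
      finally have "(inv01 g \<circ> W \<circ> g) x = inv01 g (g (T x))"
        by simp
      then show ?thesis
        by (simp only: mpt_inv_left[OF g mpt_in[OF T elim(3)]]) simp
    next
      case False
      moreover have "p x \<le> n"
        unfolding p_def by (rule level_le)
      ultimately have "p x = n \<or> p x = n - 1"
        by linarith
      with elim(3) show ?thesis by auto
    qed
  qed
  have "\<mu> (disagree (inv01 g \<circ> W \<circ> g) T) \<le> \<mu> (lev p n \<union> lev p (n - 1))"
    by (rule measure_mono_AE01[OF bad])
       (intro sets.Un lev_sets p neq_sets mpt_meas conj_mpt g W T)+
  also have "\<dots> \<le> \<mu> (lev p n) + \<mu> (lev p (n - 1))"
    by (intro measure_Un_le lev_sets p)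
  also have "\<dots> = \<epsilon> + \<tau>"
    using n n\<tau> by (simp add: p_meas)
  also have "\<tau> \<le> 1 / n"
    using e n by (simp add: \<tau>_def divide_right_mono)
  finally have close: "\<mu> (disagree (inv01 g \<circ> W \<circ> g) T) \<le> \<epsilon> + 1 / n"
    by simp
  \<comment> \<open>Climbing does not change \<open>c\<close>, so the component of
    \<open>g x\<close> is decided by \<open>d\<close> at the base point under \<open>x\<close>; on
    the remainder it is decided at \<open>x\<close> itself.\<close>
  have cg: "AE x in leb01. c (g x) = d ((?U ^^ (if p x < n then p x else 0)) x)"
  proof -
    have "AE x in leb01. \<forall>i. c ((W ^^ i) x) = c x"
      unfolding AE_all_countable using ae_inv_funpow[OF mpt_pres[OF W] c_inv] by blast
    then have "AE x in leb01. \<forall>j. \<forall>i. c ((W ^^ i) (\<Phi> ((?U ^^ j) x))) = c (\<Phi> ((?U ^^ j) x))"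
      unfolding AE_all_countable[where P = "\<lambda>j x. \<forall>i. c ((W ^^ i) (\<Phi> ((?U ^^ j) x))) = c (\<Phi> ((?U ^^ j) x))"]
    proof (intro allI)
      fix j assume "AE x in leb01. \<forall>i. c ((W ^^ i) x) = c x"
      from pres_AE[OF mpt_pres[OF mpt_comp[OF \<Phi> mpt_funpow[OF mpt_inv[OF T]]]] this, of j]
      show "AE x in leb01. \<forall>i. c ((W ^^ i) (\<Phi> ((?U ^^ j) x))) = c (\<Phi> ((?U ^^ j) x))"
        by simp
    qed
    with AE_U g_eq show ?thesis
    proof eventually_elim
      case (elim x)
      then show ?case
        using elim(1)[THEN spec, of 0] elim(1)[THEN spec, of "p x"] by (simp add: f_def)
    qed
  qed
  have "\<mu> (preim (inv01 g) A \<inter> lev c k) = \<mu> A * \<mu> (lev c k)" if A: "A \<in> \<A>" for A k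
  proof -
    have As: "A \<in> \<B>" using A \<A> by blast
    define H where "H = {x \<in> {0..1}. c (g x) = k}"
    have H: "H \<in> \<B>"
      unfolding H_def by (rule lev_Collect[OF label_comp[OF c mpt_meas[OF g]]])
    have gA: "preim (inv01 g) A \<inter> lev c k \<in> \<B>"
      by (intro sets.Int lev_sets c preim_sets mpt_inv_meas g As)
    have "preim g (preim (inv01 g) A \<inter> lev c k) = A \<inter> H"
      using mpt_inv_left[OF g] mpt_in[OF g] As
      by (auto simp: H_def sets_leb01 simp del: atLeastAtMost_iff)
    then have 1: "\<mu> (preim (inv01 g) A \<inter> lev c k) = \<mu> (A \<inter> H)"
      using pres_measure[OF mpt_pres[OF g] gA] by simp
    \<comment> \<open>Carried down to the base, the part of \<open>A\<close> on level
      \<open>i\<close> becomes a member of \<open>\<C>\<close> and \<open>H\<close> a level set of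
      \<open>d\<close>.\<close>
    have "\<mu> (A \<inter> H \<inter> lev p i) = \<mu> (A \<inter> lev p i) * \<mu> (lev c k)" for i
    proof -
      consider "i < n" | "i = n" | "n < i" by linarith
      then show ?thesis
      proof cases
        case 1
        let ?C = "F1 \<inter> preim (T ^^ i) A"
        have C: "?C \<in> \<C>"
          using 1 A by (auto simp: \<C>_def intro!: image_eqI[of _ _ "(i, A)"])
        have Cs: "?C \<in> \<B>"
          by (intro sets.Int F1 preim_sets Tm As)
        have pi: "lev p i = preim (?U ^^ i) F1"
          unfolding p_def by (rule lev_level[OF T tow1 1])
        have mem: "x \<in> A \<inter> lev p i \<longleftrightarrow> x \<in> preim (?U ^^ i) ?C" for x
          unfolding pi using inv_funpow_right[OF T, of x i] mpt_inv_funpow_in[OF T, of x i] As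
          by (auto simp: sets_leb01 subset_iff simp del: atLeastAtMost_iff)
        have AE_H: "AE x in leb01. (x \<in> A \<inter> H \<inter> lev p i) = (x \<in> preim (?U ^^ i) (?C \<inter> lev d k))"
          using cg AE_in_01
        proof eventually_elim
          case (elim x)
          have "x \<in> A \<inter> H \<inter> lev p i \<longleftrightarrow> x \<in> A \<inter> lev p i \<and> c (g x) = k"
            by (auto simp: H_def)
          also have "\<dots> \<longleftrightarrow> x \<in> A \<inter> lev p i \<and> d ((?U ^^ i) x) = k"
            using elim(1) 1 by auto
          also have "\<dots> \<longleftrightarrow> x \<in> preim (?U ^^ i) (?C \<inter> lev d k)"
            unfolding mem using mpt_inv_funpow_in[OF T elim(2), of i]
            by (auto simp del: atLeastAtMost_iff)
          finally show ?case .
        qed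
        have "\<mu> (A \<inter> H \<inter> lev p i) = \<mu> (preim (?U ^^ i) (?C \<inter> lev d k))"
          by (rule leb01.finite_measure_eq_AE[OF AE_H])
             (intro sets.Int As H lev_sets p preim_sets[OF Um] Cs d F1(1)
               preim_sets[OF Tm])+
        also have "\<dots> = \<mu> (?C \<inter> lev d k)"
          by (intro pres_measure[OF mpt_pres[OF mpt_funpow[OF mpt_inv[OF T]]]] sets.Int[OF Cs] lev_sets d)
        also have "\<dots> = \<mu> ?C * \<mu> (lev c k)"
          by (rule d_ind[OF C])
        also have "\<mu> ?C = \<mu> (preim (?U ^^ i) ?C)"
          by (rule pres_measure[OF mpt_pres[OF mpt_funpow[OF mpt_inv[OF T]]] Cs, symmetric])
        also have "preim (?U ^^ i) ?C = A \<inter> lev p i"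
          using mem by blast
        finally show ?thesis .
      next
        case 2
        have C: "lev p n \<inter> A \<in> \<C>"
          using A by (simp add: \<C>_def)
        have AE_H: "AE x in leb01. (x \<in> A \<inter> H \<inter> lev p n) = (x \<in> (lev p n \<inter> A) \<inter> lev d k)"
          using cg by eventually_elim (auto simp: H_def)
        have "\<mu> (A \<inter> H \<inter> lev p n) = \<mu> ((lev p n \<inter> A) \<inter> lev d k)"
          by (rule leb01.finite_measure_eq_AE[OF AE_H]) (intro sets.Int As H lev_sets p d)+
        then show ?thesis
          using d_ind[OF C] 2 by (simp add: Int_commute)
      next
        case 3
        then have "lev p i = {}"
          unfolding p_def by (rule lev_level_above[OF T tow1])
        then show ?thesis by simp
      qed
    qed
    then have "(\<lambda>i. \<mu> (A \<inter> lev p i) * \<mu> (lev c k)) sums \<mu> (A \<inter> H)"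
      using measure_sums_lev[OF p sets.Int[OF As H]] by simp
    moreover have "(\<lambda>i. \<mu> (A \<inter> lev p i) * \<mu> (lev c k)) sums (\<mu> A * \<mu> (lev c k))"
      by (intro sums_mult2 measure_sums_lev p As)
    ultimately show ?thesis
      unfolding 1 by (rule sums_unique2)
  qed
  with close g show ?thesis by blast
qed

end

text \<open>The limit on a pair requires independence of the two sets and of their intersection from
  the components; this is why \<open>\<A>\<close> is closed under intersections. The limits then
  transfer from \<open>W\<close> to its conjugate.\<close>

lemma (in disjoint_union) approximating_conjugate:
  assumes K: "\<And>x. x \<in> {0..1} \<Longrightarrow> c x < K"
    and aper: "\<And>k. 0 < \<mu> (lev c k) \<Longrightarrow> aperiodic_map (S k)"
    and mix: "\<And>j k. j \<in> J \<Longrightarrow> 0 < \<mu> (lev c k) \<Longrightarrow> mixes_map (S k) (m j) (\<xi> k j)"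
    and p: "\<And>j. j \<in> J \<Longrightarrow> p j = (\<Sum>k<K. \<mu> (lev c k) * \<xi> k j)"
    and T: "T \<in> mpt" and F: "tower T n F" and n: "1 \<le> n" and e: "0 < \<epsilon>" "\<epsilon> \<le> 1"
    and F_large: "1 - \<epsilon> \<le> n * \<mu> F"
    and \<A>: "finite \<A>" "\<A> \<subseteq> \<B>" "\<And>A B. A \<in> \<A> \<Longrightarrow> B \<in> \<A> \<Longrightarrow> A \<inter> B \<in> \<A>"
  shows "\<exists>T'\<in>mpt. aperiodic_map T' \<and> \<mu> (disagree T' T) \<le> \<epsilon> + 1 / n \<and>
    (\<forall>j\<in>J. \<forall>A\<in>\<A>. \<forall>B\<in>\<A>. corr_limit T' (m j) (p j) A B)"
proof -
  have aW: "aperiodic_map W"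
    by (rule aperiodic_union[OF aper])
  obtain f where f: "f \<in> mpt" and close: "\<mu> (disagree (inv01 f \<circ> W \<circ> f) T) \<le> \<epsilon> + 1 / n"
    and ind: "\<forall>A\<in>\<A>. \<forall>k. \<mu> (preim (inv01 f) A \<inter> lev c k) = \<mu> A * \<mu> (lev c k)"
    using matching_conjugacy[OF aW T F n e F_large \<A>(1,2)] by blast
  let ?f = "\<lambda>A. preim (inv01 f) A"
  have fs: "?f A \<in> \<B>" if "A \<in> \<A>" for A
    by (rule preim_sets[OF mpt_inv_meas[OF f]]) (use \<A>(2) that in blast)
  have fm: "\<mu> (?f A) = \<mu> A" if "A \<in> \<A>" for A
    by (rule pres_measure[OF mpt_inv_pres[OF f]]) (use \<A>(2) that in blast)
  have "corr_limit (inv01 f \<circ> W \<circ> f) (m j) (p j) A B" if j: "j \<in> J" and A: "A \<in> \<A>" and B: "B \<in> \<A>" for j A B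
  proof -
    have AB: "?f A \<inter> ?f B = ?f (A \<inter> B)"
      by blast
    have As: "A \<in> \<B>" and Bs: "B \<in> \<B>"
      using A B \<A>(2) by auto
    have "corr_limit W (m j) (p j) (?f A) (?f B)"
    proof (rule corr_tendsto[OF K fs[OF A] fs[OF B] _ _ _ mix[OF j] p[OF j]])
      show "\<mu> (?f A \<inter> lev c k) = \<mu> (?f A) * \<mu> (lev c k)" for k
        using ind[rule_format, OF A] by (simp only: fm[OF A])
      show "\<mu> (?f B \<inter> lev c k) = \<mu> (?f B) * \<mu> (lev c k)" for k
        using ind[rule_format, OF B] by (simp only: fm[OF B])
      show "\<mu> (?f A \<inter> ?f B \<inter> lev c k) = \<mu> (?f A \<inter> ?f B) * \<mu> (lev c k)" for k
        using ind[rule_format, OF \<A>(3)[OF A B]] by (simp only: AB fm[OF \<A>(3)[OF A B]])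
    qed
    then show ?thesis
      by (simp only: AB fm[OF \<A>(3)[OF A B]] fm[OF A] fm[OF B] measure_corr_conj[OF f W As Bs])
  qed
  then show ?thesis
    using conj_mpt[OF f W] aperiodic_conj[OF f W aW] close by blast
qed

subsection \<open>An approximation with an exact tower\<close>

lemma measure_lev_floor:
  fixes q :: nat
  assumes q: "1 \<le> q"
  shows "label (\<lambda>x. nat \<lfloor>q * x\<rfloor>)" and "\<mu> (lev (\<lambda>x. nat \<lfloor>q * x\<rfloor>) k) = (if k < q then 1 / q else 0)"
proof -
  let ?h = "\<lambda>x::real. nat \<lfloor>q * x\<rfloor>"
  have "?h \<in> measurable borel (count_space UNIV)"
    by measurable
  then show l: "label ?h"
    unfolding leb01_def by (simp add: measurable_restrict_space1)
  have fl: "x \<in> lev ?h k \<longleftrightarrow> x \<in> {0..1} \<and> k / q \<le> x \<and> x < (k + 1) / q" for x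
  proof -
    have "x \<in> {0..1} \<Longrightarrow> ?h x = k \<longleftrightarrow> k \<le> q * x \<and> q * x < k + 1"
      by (subst nat_eq_iff) (auto simp: floor_eq_iff)
    then show ?thesis
      using q by (auto simp: field_simps)
  qed
  show "\<mu> (lev ?h k) = (if k < q then 1 / q else 0)"
  proof (cases "k < q")
    case True
    then have "(k + 1) / q \<le> (1::real)"
      using q by (simp add: field_simps)
    moreover have "0 \<le> k / q" by simp
    ultimately have "lev ?h k = {k / q..<(k + 1) / q}"
      unfolding set_eq_iff fl atLeastAtMost_iff atLeastLessThan_iff by linarith
    then have "\<mu> (lev ?h k) = measure lborel {k / q..<(k + 1) / q}"
      using measure_leb01_eq[OF lev_sets[OF l], of k] by (simp only:)
    also have "\<dots> = (k + 1) / q - k / q"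
      using q by (subst measure_lborel_Ico) (auto simp: field_simps)
    also have "\<dots> = 1 / q"
      by (simp add: add_divide_distrib)
    finally show ?thesis using True by simp
  next
    case False
    \<comment> \<open>A label from \<open>q\<close> on can occur only at the right end
      point.\<close>
    have "lev ?h k \<subseteq> {1}"
    proof
      fix x assume "x \<in> lev ?h k"
      then have "x \<le> 1" "k / q \<le> x"
        unfolding fl by simp_all
      moreover have "1 \<le> k / q"
        using False q by (simp add: field_simps)
      ultimately show "x \<in> {1}"
        by simp
    qed
    moreover have s: "{1} \<in> \<B>"
      by (simp add: sets_leb01)
    ultimately have "\<mu> (lev ?h k) = 0"
      using measure_zero_subset[of _ "{1}"] measure_leb01_eq[OF s] by simp
    then show ?thesis using False by simp
  qed
qed

lemma dyadic_le: "x \<in> {0..1} \<Longrightarrow> dyadic m x \<le> 2 ^ m"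
proof -
  assume "x \<in> {0..1}"
  then have "2 ^ m * x \<le> 2 ^ m"
    by simp
  then have "\<lfloor>2 ^ m * x\<rfloor> \<le> 2 ^ m"
    unfolding floor_le_iff by (rule le_less_trans) simp
  then show ?thesis
    by (simp add: dyadic_def nat_le_iff)
qed

text \<open>The height is an additional random digit, advanced cyclically.\<close>

lemma exact_tower_approx:
  fixes q :: nat
  assumes S: "S \<in> mpt" and q: "1 \<le> q"
  shows "\<exists>T\<in>mpt. \<exists>F. tower T q F \<and> q * \<mu> F = 1 \<and> (AE x in leb01. dyadic m (T x) = dyadic m (S x))"
proof -
  let ?dS = "\<lambda>x. dyadic m (S x)"
  note dS = label_comp[OF label_dyadic[of m] mpt_meas[OF S]]
  define \<C> where "\<C> = insert {0..1} (lev (dyadic m) ` {..2 ^ m} \<union> lev ?dS ` {..2 ^ m})"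
  have "finite \<C>" "\<C> \<subseteq> \<B>"
    unfolding \<C>_def using lev_sets[OF label_dyadic[of m]] lev_sets[OF dS] top_sets01 by auto
  then obtain U where U: "U \<in> meas01"
    and U_ind: "\<And>C B. C \<in> \<C> \<Longrightarrow> B \<in> \<B> \<Longrightarrow> \<mu> (C \<inter> preim U B) = \<mu> C * \<mu> B"
    using independent_uniform[of \<C>] by blast
  let ?h = "\<lambda>x::real. nat \<lfloor>q * x\<rfloor>"
  define H where "H x = ?h (U x)" for x
  have H: "label H"
    unfolding H_def by (rule label_comp[OF measure_lev_floor(1)[OF q] U])
  have lev_H: "lev H k = preim U (lev ?h k)" for k
    using meas_in_01[OF U] by (auto simp: H_def simp del: atLeastAtMost_iff)
  have H_ind: "\<mu> (C \<inter> lev H k) = \<mu> C * (if k < q then 1 / q else 0)" if "C \<in> \<C>" for C k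
    unfolding lev_H U_ind[OF that lev_sets[OF measure_lev_floor(1)[OF q]]] measure_lev_floor(2)[OF q] ..
  let ?w = "\<lambda>k. if k < q then 1 / q else 0 :: real"
  have d_ind: "\<mu> (lev (dyadic m) j \<inter> lev H k) = \<mu> (lev (dyadic m) j) * ?w k"
    "\<mu> (lev ?dS j \<inter> lev H k) = \<mu> (lev (dyadic m) j) * ?w k" for j k
  proof -
    have S_lev: "lev ?dS j = preim S (lev (dyadic m) j)"
      using mpt_in[OF S] by (auto simp del: atLeastAtMost_iff)
    have S_meas: "\<mu> (lev ?dS j) = \<mu> (lev (dyadic m) j)"
      unfolding S_lev by (rule pres_measure[OF mpt_pres[OF S] lev_sets[OF label_dyadic]])
    have "j \<le> 2 ^ m \<or> lev (dyadic m) j = {} \<and> lev ?dS j = {}"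
      using dyadic_le mpt_in[OF S] by (auto simp del: atLeastAtMost_iff)
    then show "\<mu> (lev (dyadic m) j \<inter> lev H k) = \<mu> (lev (dyadic m) j) * ?w k"
      "\<mu> (lev ?dS j \<inter> lev H k) = \<mu> (lev (dyadic m) j) * ?w k"
      using H_ind[of "lev (dyadic m) j" k] H_ind[of "lev ?dS j" k] S_meas by (auto simp: \<C>_def)
  qed
  \<comment> \<open>The cyclic shift of \<open>{..<q}\<close> and its inverse. Larger values, which
    \<open>H\<close> takes only on a null set, stay fixed.\<close>
  define \<sigma> where "\<sigma> k = (if k + 1 < q then k + 1 else if k + 1 = q then 0 else k)" for k
  define \<sigma>' where "\<sigma>' k = (if k = 0 then q - 1 else if k < q then k - 1 else k)" for k
  have \<sigma>: "\<sigma> k = j \<longleftrightarrow> k = \<sigma>' j" for k j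
    using q by (auto simp: \<sigma>_def \<sigma>'_def)
  have \<sigma>'q: "\<sigma>' k < q \<longleftrightarrow> k < q" for k
    using q by (auto simp: \<sigma>'_def)
  have \<sigma>H: "lev (\<lambda>x. \<sigma> (H x)) k = lev H (\<sigma>' k)" for k
    by (auto simp: \<sigma>)
  \<comment> \<open>The digit is independent of the cell of \<open>x\<close> and of the cell of
    \<open>S x\<close>, and the cells of \<open>x\<close> and \<open>S x\<close> have equal laws as
    \<open>S\<close> preserves the measure. Hence a rearrangement can advance the digit and at the
    same time move \<open>x\<close> into the cell of \<open>S x\<close>.\<close>
  have eq: "\<mu> (lev (\<lambda>x. prod_encode (\<sigma> (H x), ?dS x)) j) = \<mu> (lev (\<lambda>x. prod_encode (H x, dyadic m x)) j)" for j
    unfolding lev_prod_encode \<sigma>H by (subst (1 2) Int_commute) (simp only: d_ind \<sigma>'q)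
  obtain T where T: "T \<in> mpt" and T_eq: "AE x in leb01. H (T x) = \<sigma> (H x) \<and> dyadic m (T x) = ?dS x"
  proof -
    have l1: "label (\<lambda>x. prod_encode (\<sigma> (H x), ?dS x))"
      by (rule label_prod[OF H dS, of "\<lambda>a b. prod_encode (\<sigma> a, b)"])
    have l2: "label (\<lambda>x. prod_encode (H x, dyadic m x))"
      by (rule label_prod[OF H label_dyadic])
    obtain T where "T \<in> mpt" and *: "AE x in leb01. prod_encode (H (T x), dyadic m (T x)) = prod_encode (\<sigma> (H x), ?dS x)"
      using mpt_glue[where S = "\<lambda>_ x. x", OF l1 l2 eq id_in_mpt] by (auto elim: AE_mp)
    moreover from * have "AE x in leb01. H (T x) = \<sigma> (H x) \<and> dyadic m (T x) = ?dS x"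
      by eventually_elim simp
    ultimately show thesis
      using that by blast
  qed
  \<comment> \<open>\<open>T\<close> advances the digit only almost everywhere, whereas
    \<open>tower\<close> demands disjointness at every point. So the correct digits are imposed
    along the first \<open>q\<close> iterates, at the cost of a null set.\<close>
  define F where "F = (\<Inter>a\<in>{..<q}. {x \<in> {0..1}. H ((T ^^ a) x) = a})"
  have Fs: "F \<in> \<B>"
    unfolding F_def using q
    by (intro sets.finite_INT lev_Collect[OF label_comp[OF H mpt_meas[OF mpt_funpow[OF T]]]])
       (auto simp: lessThan_empty_iff)
  have F_sub: "F \<subseteq> lev H 0"
  proof
    fix x assume "x \<in> F"
    then have "x \<in> {x \<in> {0..1}. H ((T ^^ 0) x) = 0}"
      unfolding F_def by (rule INT_D) (use q in simp)
    then show "x \<in> lev H 0" by simp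
  qed
  have "AE x in leb01. \<forall>a. H (T ((T ^^ a) x)) = \<sigma> (H ((T ^^ a) x))"
    unfolding AE_all_countable
  proof
    fix a
    have "AE x in leb01. H (T x) = \<sigma> (H x)"
      using T_eq by eventually_elim simp
    then show "AE x in leb01. H (T ((T ^^ a) x)) = \<sigma> (H ((T ^^ a) x))"
      by (rule pres_AE[OF mpt_pres[OF mpt_funpow[OF T]]])
  qed
  then have "AE x in leb01. x \<in> lev H 0 \<longrightarrow> x \<in> F"
  proof eventually_elim
    case (elim x)
    show ?case
    proof
      assume x: "x \<in> lev H 0"
      have "a < q \<Longrightarrow> H ((T ^^ a) x) = a" for a
        by (induction a) (use x elim in \<open>auto simp: \<sigma>_def\<close>)
      with x show "x \<in> F" by (auto simp: F_def)
    qed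
  qed
  then have "\<mu> (lev H 0) \<le> \<mu> F"
    by (rule measure_mono_AE01[OF _ Fs lev_sets[OF H]])
  moreover have "\<mu> F \<le> \<mu> (lev H 0)"
    by (rule measure_mono01[OF F_sub lev_sets[OF H]])
  moreover have "\<mu> (lev H 0) = 1 / q"
  proof -
    have "{0..1} \<inter> lev H 0 = lev H 0" by auto
    then show ?thesis
      using H_ind[of "{0..1}" 0] q by (simp add: \<C>_def)
  qed
  ultimately have "q * \<mu> F = 1"
    using q by simp
  moreover have "tower T q F"
    unfolding tower_def
  proof (intro conjI ballI allI impI Fs)
    fix x i assume "x \<in> F" and i: "0 < i \<and> i < q"
    then have "H ((T ^^ i) x) = i"
      by (auto simp: F_def)
    with i F_sub show "(T ^^ i) x \<notin> F"
      by auto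
  qed
  moreover have "AE x in leb01. dyadic m (T x) = dyadic m (S x)"
    using T_eq by eventually_elim simp
  ultimately show ?thesis
    using T by blast
qed

subsection \<open>The uniform metric\<close>

lemma measure_neq_triangle:
  assumes "f \<in> meas01" "g \<in> meas01" "h \<in> meas01"
  shows "\<mu> (disagree f h) \<le> \<mu> (disagree f g) + \<mu> (disagree g h)"
proof -
  have "\<mu> (disagree f h) \<le> \<mu> (disagree f g \<union> disagree g h)"
    by (rule measure_mono01) (auto intro!: sets.Un neq_sets assms simp del: atLeastAtMost_iff)
  also have "\<dots> \<le> \<mu> (disagree f g) + \<mu> (disagree g h)"
    by (intro measure_Un_le neq_sets assms)
  finally show ?thesis .
qed

lemma measure_neq_comp:
  assumes "pres h" "f \<in> meas01" "g \<in> meas01"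
  shows "\<mu> {x \<in> {0..1}. f (h x) \<noteq> g (h x)} = \<mu> (disagree f g)"
proof -
  have "{x \<in> {0..1}. f (h x) \<noteq> g (h x)} = preim h (disagree f g)"
    using meas_in_01[OF pres_meas[OF assms(1)]] by blast
  then show ?thesis
    using pres_measure[OF assms(1) neq_sets[OF assms(2,3)]] by simp
qed

text \<open>The two inverses differ at \<open>T x\<close> exactly if \<open>S x\<close> and
  \<open>T x\<close> differ, and \<open>T\<close> preserves the measure.\<close>

lemma measure_neq_inv:
  assumes S: "S \<in> mpt" and T: "T \<in> mpt"
  shows "\<mu> (disagree (inv01 S) (inv01 T)) = \<mu> (disagree S T)"
proof -
  have "inv01 S (T x) \<noteq> inv01 T (T x) \<longleftrightarrow> S x \<noteq> T x" if "x \<in> {0..1}" for x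
    using mpt_inv_left[OF T that] mpt_inv_left[OF S that] mpt_inv_right[OF S mpt_in[OF T that]] by metis
  then have "{x \<in> {0..1}. inv01 S (T x) \<noteq> inv01 T (T x)} = disagree S T"
    by blast
  then show ?thesis
    using measure_neq_comp[OF mpt_pres[OF T] mpt_inv_meas[OF S] mpt_inv_meas[OF T]] by simp
qed

lemma measure_neq_funpow:
  assumes S: "S \<in> mpt" and T: "T \<in> mpt"
  shows "\<mu> (disagree (S ^^ n) (T ^^ n)) \<le> n * \<mu> (disagree S T)"
proof (induction n)
  case (Suc n)
  note m = mpt_meas[OF S] mpt_meas[OF T] mpt_meas[OF mpt_funpow[OF S, of n]]
    mpt_meas[OF mpt_funpow[OF T, of n]]
  have "\<mu> (disagree (S ^^ Suc n) (T ^^ Suc n)) \<le>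
      \<mu> (disagree (S ^^ Suc n) (S \<circ> T ^^ n)) + \<mu> (disagree (S \<circ> T ^^ n) (T ^^ Suc n))"
    using m by (intro measure_neq_triangle mpt_meas mpt_funpow mpt_comp S T)
  also have "\<mu> (disagree (S ^^ Suc n) (S \<circ> T ^^ n)) \<le> \<mu> (disagree (S ^^ n) (T ^^ n))"
    by (rule measure_mono01) (auto intro!: neq_sets m simp del: atLeastAtMost_iff)
  also have "\<mu> (disagree (S \<circ> T ^^ n) (T ^^ Suc n)) = \<mu> (disagree S T)"
    using measure_neq_comp[OF mpt_pres[OF mpt_funpow[OF T, of n]] m(1,2)] by simp
  finally show ?case
    using Suc.IH by (simp add: algebra_simps)
qed simp

lemma measure_neq_int_iter:
  assumes S: "S \<in> mpt" and T: "T \<in> mpt"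
  shows "\<mu> (disagree (int_iter S m) (int_iter T m)) \<le> \<bar>m\<bar> * \<mu> (disagree S T)"
  using measure_neq_funpow[OF S T, of "nat m"] measure_neq_funpow[OF mpt_inv[OF S] mpt_inv[OF T], of "nat (- m)"]
    measure_neq_inv[OF S T]
  by (auto simp: int_iter_def)

text \<open>Each further power adds at most the measure of one disagreement set, and where the two
  powers agree so do the preimages.\<close>

lemma corr_diff_le:
  assumes S: "S \<in> mpt" and T: "T \<in> mpt" and A: "A \<in> \<B>" and B: "B \<in> \<B>"
  shows "\<bar>\<mu> (A \<inter> preimage_iter S m B) - \<mu> (A \<inter> preimage_iter T m B)\<bar> \<le> \<bar>m\<bar> * \<mu> (disagree S T)"
proof -
  have *: "\<mu> (A \<inter> preimage_iter S m B) \<le> \<mu> (A \<inter> preimage_iter T m B) + \<bar>m\<bar> * \<mu> (disagree S T)"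
    if S: "S \<in> mpt" and T: "T \<in> mpt" for S T
  proof -
    have n: "disagree (int_iter S m) (int_iter T m) \<in> \<B>"
      by (intro neq_sets mpt_meas mpt_int_iter S T)
    have t: "A \<inter> preimage_iter T m B \<in> \<B>"
      by (intro sets.Int A preimage_iter_sets T B)
    have "\<mu> (A \<inter> preimage_iter S m B) \<le>
        \<mu> ((A \<inter> preimage_iter T m B) \<union> disagree (int_iter S m) (int_iter T m))"
      by (rule measure_mono01[OF _ sets.Un[OF t n]]) (auto simp: preimage_iter_def)
    also have "\<dots> \<le> \<mu> (A \<inter> preimage_iter T m B) + \<mu> (disagree (int_iter S m) (int_iter T m))"
      by (rule measure_Un_le[OF t n])
    finally show ?thesis
      using measure_neq_int_iter[OF S T, of m] by simp
  qed
  have "disagree T S = disagree S T"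
    by auto
  then show ?thesis
    using *[OF S T] *[OF T S] by (simp only: abs_le_iff) linarith
qed

text \<open>A point outside all disagreement sets from index \<open>l\<close> on has constant images
  from there on. The measures of these sets are dominated by a geometric series with sum
  \<open>2 * e l\<close>.\<close>

lemma stabilising_limit:
  assumes Y: "\<And>l. Y l \<in> meas01"
    and close: "\<And>l. \<mu> (disagree (Y (Suc l)) (Y l)) \<le> e l" and half: "\<And>l. e (Suc l) \<le> e l / 2"
  shows "\<exists>f\<in>meas01. \<forall>l. \<mu> (disagree f (Y l)) \<le> 2 * e l"
proof -
  \<comment> \<open>Clipping keeps the values in the unit interval where the images diverge and
    \<open>lim\<close> is unspecified.\<close>
  define f where "f x = max 0 (min 1 (lim (\<lambda>l. Y l x)))" for x
  have [measurable]: "Y l \<in> borel_measurable leb01" for l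
    by (rule borel_measurable_leb01[OF Y])
  have f: "f \<in> meas01"
    unfolding measurable_leb01_iff f_def by (auto intro!: borel_measurable_lim_metric)
  have e: "e (l + i) \<le> e l * (1/2) ^ i" for l i
  proof (induction i)
    case (Suc i)
    then show ?case using half[of "l + i"] by simp
  qed simp
  have sums: "(\<lambda>i. e l * (1/2) ^ i) sums (2 * e l)" for l
    using sums_mult[OF geometric_sums[of "1/2::real"], of "e l"] by (simp add: mult.commute)
  have "\<mu> (disagree f (Y l)) \<le> 2 * e l" for l
  proof -
    let ?D = "\<lambda>i. disagree (Y (Suc (l + i))) (Y (l + i))"
    have D: "?D i \<in> \<B>" for i
      by (intro neq_sets Y)
    have le: "\<mu> (?D i) \<le> e l * (1/2) ^ i" for i
      using close[of "l + i"] e[of l i] by simp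
    have sm: "summable (\<lambda>i. \<mu> (?D i))"
      by (rule summable_comparison_test'[OF sums_summable[OF sums[of l]], of 0]) (use le in simp)
    have "disagree f (Y l) \<subseteq> (\<Union>i. ?D i)"
    proof
      fix x assume x: "x \<in> disagree f (Y l)"
      show "x \<in> (\<Union>i. ?D i)"
      proof (rule ccontr)
        assume "x \<notin> (\<Union>i. ?D i)"
        then have s: "Y (Suc (l + i)) x = Y (l + i) x" for i
          using x by blast
        have "Y (l + i) x = Y l x" for i
          by (induction i) (use s in auto)
        then have "eventually (\<lambda>k. Y k x = Y l x) sequentially"
          unfolding eventually_sequentially by (metis le_add_diff_inverse)
        then have "(\<lambda>k. Y k x) \<longlonglongrightarrow> Y l x"
          by (rule tendsto_eventually)
        then have "lim (\<lambda>k. Y k x) = Y l x"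
          by (rule limI)
        then have "f x = Y l x"
          using meas_in_01[OF Y[of l], of x] x by (simp add: f_def)
        with x show False by simp
      qed
    qed
    then have "\<mu> (disagree f (Y l)) \<le> \<mu> (\<Union>i. ?D i)"
      by (rule measure_mono01) (intro sets.countable_UN image_subsetI D)
    also have "\<dots> \<le> (\<Sum>i. \<mu> (?D i))"
      by (rule leb01.finite_measure_subadditive_countably[OF _ sm]) (use D in blast)
    also have "\<dots> \<le> (\<Sum>i. e l * (1/2) ^ i)"
      by (rule suminf_le[OF le sm sums_summable[OF sums]])
    also have "\<dots> = 2 * e l"
      using sums_unique[OF sums] by simp
    finally show ?thesis .
  qed
  with f show ?thesis by blast
qed

lemma le_of_tendsto_0:
  fixes a b :: real
  assumes "\<And>l. a \<le> b + c * e l" "e \<longlonglongrightarrow> 0"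
  shows "a \<le> b"
proof (rule LIMSEQ_le_const)
  show "(\<lambda>l. b + c * e l) \<longlonglongrightarrow> b"
    using tendsto_add[OF tendsto_const[of b] tendsto_mult[OF tendsto_const[of c] assms(2)]] by simp
qed (use assms(1) in blast)

text \<open>Maps and inverses disagree on sets of equal measure, so both sequences stabilise. The
  limit \<open>g\<close> of the inverses is a left inverse of the limit \<open>f\<close>, which
  makes \<open>f\<close> invertible after a change on a null set.\<close>

lemma uniform_limit_mpt:
  assumes X: "\<And>l. X l \<in> mpt"
    and close: "\<And>l. \<mu> (disagree (X (Suc l)) (X l)) \<le> e l" and half: "\<And>l. e (Suc l) \<le> e l / 2"
  shows "\<exists>T\<in>mpt. \<forall>l. \<mu> (disagree T (X l)) \<le> 2 * e l"
proof -
  obtain f where f: "f \<in> meas01" and fX: "\<And>l. \<mu> (disagree f (X l)) \<le> 2 * e l"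
    using stabilising_limit[of X e] mpt_meas[OF X] close half by blast
  obtain g where g: "g \<in> meas01"
    and gX: "\<And>l. \<mu> (disagree g (inv01 (X l))) \<le> 2 * e l"
    using stabilising_limit[of "\<lambda>l. inv01 (X l)" e] mpt_inv_meas[OF X] close half
    unfolding measure_neq_inv[OF X X] by blast
  have e0: "0 \<le> e l" for l
    using close[of l] measure_nonneg[of leb01] by (meson order_trans)
  have "e l \<le> e 0 * (1/2) ^ l" for l
    by (induction l) (use half in \<open>auto intro: order_trans\<close>)
  moreover have "(\<lambda>l. e 0 * (1/2) ^ l) \<longlonglongrightarrow> e 0 * 0"
    by (intro tendsto_mult tendsto_const LIMSEQ_realpow_zero) auto
  ultimately have lim: "e \<longlonglongrightarrow> 0"
    by (intro tendsto_sandwich[of "\<lambda>_. 0" e _ "\<lambda>l. e 0 * (1/2) ^ l"]) (auto simp: e0)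
  have "pres f"
  proof (rule presI_le[OF f])
    fix B assume B: "B \<in> \<B>"
    show "\<mu> (preim f B) \<le> \<mu> B"
    proof (rule le_of_tendsto_0[OF _ lim, where c = 2])
      fix l
      note s = preim_sets[OF mpt_meas[OF X] B, of l] neq_sets[OF f mpt_meas[OF X[of l]]]
      have "\<mu> (preim f B) \<le> \<mu> (preim (X l) B \<union> disagree f (X l))"
        by (rule measure_mono01[OF _ sets.Un[OF s]]) auto
      also have "\<dots> \<le> \<mu> (preim (X l) B) + \<mu> (disagree f (X l))"
        by (rule measure_Un_le[OF s])
      finally show "\<mu> (preim f B) \<le> \<mu> B + 2 * e l"
        using pres_measure[OF mpt_pres[OF X] B, of l] fX[of l] by simp
    qed
  qed
  moreover have "AE x in leb01. g (f x) = x"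
  proof (rule AE_leb01_I)
    have n: "{x \<in> {0..1}. (g \<circ> h) x \<noteq> x} \<in> \<B>" if "h \<in> meas01" for h
      using neq_sets[OF measurable_comp[OF that g] measurable_ident[of leb01]] by simp
    from n[OF f] show "{x \<in> {0..1}. g (f x) \<noteq> x} \<in> \<B>" by simp
    have "\<mu> {x \<in> {0..1}. g (f x) \<noteq> x} \<le> 0"
    \<comment> \<open>One error of \<open>2 * e l\<close> for replacing \<open>f\<close> by
      \<open>X l\<close>, another for replacing \<open>g\<close> by the inverse of
      \<open>X l\<close>.\<close>
    proof (rule le_of_tendsto_0[OF _ lim, where c = 4])
      fix l
      have s: "disagree f (X l) \<in> \<B>"
        by (intro neq_sets f mpt_meas X)
      have "{x \<in> {0..1}. g (X l x) \<noteq> x} = {x \<in> {0..1}. g (X l x) \<noteq> inv01 (X l) (X l x)}"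
        using mpt_inv_left[OF X] by (auto simp del: atLeastAtMost_iff)
      then have "\<mu> {x \<in> {0..1}. g (X l x) \<noteq> x} \<le> 2 * e l"
        using measure_neq_comp[OF mpt_pres[OF X] g mpt_inv_meas[OF X], of l l] gX[of l] by simp
      moreover have "\<mu> {x \<in> {0..1}. g (f x) \<noteq> x} \<le> \<mu> (disagree f (X l) \<union> {x \<in> {0..1}. (g \<circ> X l) x \<noteq> x})"
        by (rule measure_mono01[OF _ sets.Un[OF s n[OF mpt_meas[OF X]]]]) auto
      moreover have "\<dots> \<le> \<mu> (disagree f (X l)) + \<mu> {x \<in> {0..1}. (g \<circ> X l) x \<noteq> x}"
        by (rule measure_Un_le[OF s n[OF mpt_meas[OF X]]])
      ultimately show "\<mu> {x \<in> {0..1}. g (f x) \<noteq> x} \<le> 0 + 4 * e l"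
        using fX[of l] by simp
    qed
    then show "\<mu> {x \<in> {0..1}. g (f x) \<noteq> x} = 0"
      using measure_nonneg[of leb01 "{x \<in> {0..1}. g (f x) \<noteq> x}"] by linarith
  qed
  ultimately obtain T where T: "T \<in> mpt" and Tf: "AE x in leb01. T x = f x"
    using mpt_of_left_inverse g by blast
  have "\<mu> (disagree T (X l)) = \<mu> (disagree f (X l))" for l
  proof (rule leb01.finite_measure_eq_AE)
    show "AE x in leb01. (x \<in> disagree T (X l)) = (x \<in> disagree f (X l))"
      using Tf by eventually_elim auto
  qed (intro neq_sets mpt_meas T X f)+
  with fX T show ?thesis
    by (intro bexI[of _ T]) (simp_all only: simp_thms)
qed

subsection \<open>Approximation by unions of dyadic intervals\<close>

lemma sym_diff_sets: "A \<in> \<B> \<Longrightarrow> B \<in> \<B> \<Longrightarrow> sym_diff A B \<in> \<B>"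
  by auto

lemma sym_diff_triangle:
  assumes "A \<in> \<B>" "B \<in> \<B>" "C \<in> \<B>"
  shows "\<mu> (sym_diff A C) \<le> \<mu> (sym_diff A B) + \<mu> (sym_diff B C)"
proof -
  have "\<mu> (sym_diff A C) \<le> \<mu> (sym_diff A B \<union> sym_diff B C)"
    by (rule measure_mono01) (use assms in auto)
  also have "\<dots> \<le> \<mu> (sym_diff A B) + \<mu> (sym_diff B C)"
    by (intro measure_Un_le sym_diff_sets assms)
  finally show ?thesis .
qed

lemma abs_diff_le_sym_diff:
  assumes "A \<in> \<B>" "B \<in> \<B>"
  shows "\<bar>\<mu> A - \<mu> B\<bar> \<le> \<mu> (sym_diff A B)"
proof -
  have *: "\<mu> A \<le> \<mu> B + \<mu> (sym_diff A B)" if "A \<in> \<B>" "B \<in> \<B>" for A B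
  proof -
    have "\<mu> A \<le> \<mu> (B \<union> sym_diff A B)"
      by (rule measure_mono01) (use that in auto)
    also have "\<dots> \<le> \<mu> B + \<mu> (sym_diff A B)"
      by (intro measure_Un_le sym_diff_sets that)
    finally show ?thesis .
  qed
  show ?thesis
    using *[OF assms] *[OF assms(2,1)] by (simp add: Un_commute abs_le_iff)
qed

lemma sym_diff_Int:
  assumes "A \<in> \<B>" "B \<in> \<B>" "C \<in> \<B>" "D \<in> \<B>"
  shows "\<mu> (sym_diff (A \<inter> B) (C \<inter> D)) \<le> \<mu> (sym_diff A C) + \<mu> (sym_diff B D)"
proof -
  have "\<mu> (sym_diff (A \<inter> B) (C \<inter> D)) \<le> \<mu> (sym_diff A C \<union> sym_diff B D)"
    by (rule measure_mono01) (use assms in auto)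
  also have "\<dots> \<le> \<mu> (sym_diff A C) + \<mu> (sym_diff B D)"
    by (intro measure_Un_le sym_diff_sets assms)
  finally show ?thesis .
qed

definition dyadics :: "nat \<Rightarrow> real set set" where
  "dyadics m = (\<lambda>J. preim (dyadic m) J) ` Pow {..2 ^ m}"

lemma finite_dyadics: "finite (dyadics m)"
  by (simp add: dyadics_def)

lemma dyadicsI: "{x \<in> {0..1}. P (dyadic m x)} \<in> dyadics m"
proof -
  have "{x \<in> {0..1}. P (dyadic m x)} = {x \<in> {0..1}. dyadic m x \<in> {i. i \<le> 2 ^ m \<and> P i}}"
    using dyadic_le by (auto simp del: atLeastAtMost_iff)
  then show ?thesis
    unfolding dyadics_def by (intro image_eqI[of _ _ "{i. i \<le> 2 ^ m \<and> P i}"]) auto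
qed

lemma dyadicsE:
  assumes "A \<in> dyadics m"
  obtains P where "A = {x \<in> {0..1}. P (dyadic m x)}"
proof -
  obtain J where "A = preim (dyadic m) J"
    using assms unfolding dyadics_def by blast
  then show thesis by (rule that[of "\<lambda>i. i \<in> J"])
qed

lemma dyadics_leb01: "dyadics m \<subseteq> \<B>"
proof
  fix A assume "A \<in> dyadics m"
  then show "A \<in> \<B>"
    by (rule dyadicsE) (simp only: lev_Collect[OF label_dyadic])
qed

lemma dyadics_combine:
  assumes A: "A \<in> dyadics m" and B: "B \<in> dyadics m"
  shows "{x \<in> {0..1}. h (x \<in> A) (x \<in> B)} \<in> dyadics m"
proof -
  obtain P where P: "A = {x \<in> {0..1}. P (dyadic m x)}"
    using A by (rule dyadicsE)
  obtain Q where Q: "B = {x \<in> {0..1}. Q (dyadic m x)}"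
    using B by (rule dyadicsE)
  have "{x \<in> {0..1}. h (x \<in> A) (x \<in> B)} = {x \<in> {0..1}. h (P (dyadic m x)) (Q (dyadic m x))}"
    unfolding P Q by auto
  then show ?thesis
    using dyadicsI[of "\<lambda>i. h (P i) (Q i)"] by simp
qed

lemma dyadics_Int: "A \<in> dyadics m \<Longrightarrow> B \<in> dyadics m \<Longrightarrow> A \<inter> B \<in> dyadics m"
  and dyadics_Un: "A \<in> dyadics m \<Longrightarrow> B \<in> dyadics m \<Longrightarrow> A \<union> B \<in> dyadics m"
proof -
  assume AB: "A \<in> dyadics m" "B \<in> dyadics m"
  then have "A \<subseteq> {0..1}" "B \<subseteq> {0..1}"
    unfolding dyadics_def by auto
  then have "{x \<in> {0..1}. x \<in> A \<and> x \<in> B} = A \<inter> B" "{x \<in> {0..1}. x \<in> A \<or> x \<in> B} = A \<union> B"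
    by blast+
  then show "A \<inter> B \<in> dyadics m" "A \<union> B \<in> dyadics m"
    using dyadics_combine[OF AB, of "(\<and>)"] dyadics_combine[OF AB, of "(\<or>)"] by simp_all
qed

lemma dyadic_Suc: "x \<in> {0..1} \<Longrightarrow> dyadic m x = dyadic (Suc m) x div 2"
proof -
  assume x: "x \<in> {0..1}"
  have "\<lfloor>2 ^ m * x\<rfloor> = \<lfloor>2 ^ Suc m * x / real_of_int 2\<rfloor>"
    by simp
  also have "\<dots> = \<lfloor>2 ^ Suc m * x\<rfloor> div 2"
    by (rule floor_divide_real_eq_div) simp
  finally show ?thesis
    using x by (simp add: dyadic_def nat_div_distrib)
qed

lemma dyadics_mono: "m \<le> m' \<Longrightarrow> dyadics m \<subseteq> dyadics m'"
proof (rule lift_Suc_mono_le[of dyadics])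
  fix m
  show "dyadics m \<subseteq> dyadics (Suc m)"
  proof
    fix A assume "A \<in> dyadics m"
    then obtain P where "A = {x \<in> {0..1}. P (dyadic m x)}"
      by (rule dyadicsE)
    also have "\<dots> = {x \<in> {0..1}. P (dyadic (Suc m) x div 2)}"
      using dyadic_Suc[of _ m] by (auto simp del: atLeastAtMost_iff)
    finally show "A \<in> dyadics (Suc m)"
      using dyadicsI[of "\<lambda>i. P (i div 2)"] by simp
  qed
qed

lemma measure_lev_dyadic: "\<mu> (lev (dyadic m) k) \<le> (1/2) ^ m"
proof -
  have "\<mu> (lev (\<lambda>x. nat \<lfloor>real (2 ^ m) * x\<rfloor>) k) \<le> 1 / real (2 ^ m)"
    by (subst measure_lev_floor(2)) auto
  then show ?thesis
    by (simp add: dyadic_def[abs_def] power_divide)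
qed

definition dyadic_approx :: "real set \<Rightarrow> bool" where
  "dyadic_approx A \<longleftrightarrow> (\<forall>e>0. \<exists>m. \<exists>D\<in>dyadics m. \<mu> (sym_diff A D) < e)"

lemma dyadic_approx_limit:
  assumes A: "A \<in> \<B>"
    and lim: "\<And>e. 0 < e \<Longrightarrow> \<exists>B\<in>\<B>. dyadic_approx B \<and> \<mu> (sym_diff A B) < e"
  shows "dyadic_approx A"
  unfolding dyadic_approx_def
proof (intro allI impI)
  fix e :: real assume "0 < e"
  then have "0 < e / 2" by simp
  then obtain B where B: "B \<in> \<B>" "dyadic_approx B" "\<mu> (sym_diff A B) < e / 2"
    using lim by blast
  obtain m D where D: "D \<in> dyadics m" "\<mu> (sym_diff B D) < e / 2"
    using B(2) \<open>0 < e / 2\<close> unfolding dyadic_approx_def by blast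
  then have "D \<in> \<B>"
    using dyadics_leb01 by blast
  from sym_diff_triangle[OF A B(1) this] B D have "\<mu> (sym_diff A D) < e"
    by simp
  with D show "\<exists>m. \<exists>D\<in>dyadics m. \<mu> (sym_diff A D) < e"
    by blast
qed

lemma dyadic_approx_Un:
  assumes A: "A \<in> \<B>" "dyadic_approx A" and B: "B \<in> \<B>" "dyadic_approx B"
  shows "dyadic_approx (A \<union> B)"
  unfolding dyadic_approx_def
proof (intro allI impI)
  fix e :: real assume "0 < e"
  then have e: "0 < e / 2" by simp
  obtain m D where D: "D \<in> dyadics m" "\<mu> (sym_diff A D) < e / 2"
    using A(2) e unfolding dyadic_approx_def by blast
  obtain k E where E: "E \<in> dyadics k" "\<mu> (sym_diff B E) < e / 2"
    using B(2) e unfolding dyadic_approx_def by blast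
  have DE: "D \<in> \<B>" "E \<in> \<B>"
    using D E dyadics_leb01 by blast+
  have "D \<union> E \<in> dyadics (max m k)"
    using D(1) E(1) dyadics_mono[of m "max m k"] dyadics_mono[of k "max m k"]
    by (intro dyadics_Un) auto
  moreover have "\<mu> (sym_diff (A \<union> B) (D \<union> E)) \<le> \<mu> (sym_diff A D \<union> sym_diff B E)"
    by (rule measure_mono01) (use A B DE in auto)
  moreover have "\<dots> \<le> \<mu> (sym_diff A D) + \<mu> (sym_diff B E)"
    by (intro measure_Un_le sym_diff_sets A B DE)
  ultimately show "\<exists>m. \<exists>D\<in>dyadics m. \<mu> (sym_diff (A \<union> B) D) < e"
    using D(2) E(2) by (intro exI[of _ "max m k"] bexI[of _ "D \<union> E"]) auto
qed

lemma dyadic_approx_dyadic: "D \<in> dyadics m \<Longrightarrow> dyadic_approx D"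
  unfolding dyadic_approx_def by (intro allI impI exI[of _ m] bexI[of _ D]) simp_all

text \<open>The half-line differs from the union of the cells with labels below that of
  \<open>a\<close> only inside a single cell.\<close>

lemma dyadic_approx_Iic:
  "dyadic_approx ({..a} \<inter> {0..1})"
proof (rule dyadic_approx_limit)
  show A: "{..a} \<inter> {0..1} \<in> \<B>"
    by (intro sets_leb01_I) simp
  fix e :: real assume "0 < e"
  then obtain m where m: "(1/2) ^ m < e"
    using real_arch_pow_inv[of e "1/2"] by auto
  let ?D = "{x \<in> {0..1}. dyadic m x < dyadic m a}"
  have D: "?D \<in> dyadics m"
    by (rule dyadicsI)
  have mono: "dyadic m x \<le> dyadic m y" if "x \<le> y" for x y
    unfolding dyadic_def using that by (intro nat_mono floor_mono) simp
  have "sym_diff ({..a} \<inter> {0..1}) ?D \<subseteq> lev (dyadic m) (dyadic m a)"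
  proof
    fix x assume x: "x \<in> sym_diff ({..a} \<inter> {0..1}) ?D"
    then have x01: "x \<in> {0..1}" by blast
    consider "x \<le> a" "\<not> dyadic m x < dyadic m a" | "a \<le> x" "dyadic m x < dyadic m a"
      using x by (cases "x \<le> a") auto
    then have "dyadic m x = dyadic m a"
    proof cases
      case 1
      with mono[OF 1(1)] show ?thesis by linarith
    next
      case 2
      with mono[OF 2(1)] show ?thesis by linarith
    qed
    with x01 show "x \<in> lev (dyadic m) (dyadic m a)" by simp
  qed
  then have "\<mu> (sym_diff ({..a} \<inter> {0..1}) ?D) \<le> \<mu> (lev (dyadic m) (dyadic m a))"
    by (rule measure_mono01) (rule lev_sets[OF label_dyadic])
  also have "\<dots> < e"
    using measure_lev_dyadic[of m "dyadic m a"] m by simp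
  finally show "\<exists>B\<in>\<B>. dyadic_approx B \<and> \<mu> (sym_diff ({..a} \<inter> {0..1}) B) < e"
    using D dyadic_approx_dyadic[OF D] dyadics_leb01 by blast
qed

text \<open>Induction over the sigma-algebra generated by half-lines. A countable union is first
  replaced by a finite one, using continuity of the measure from below.\<close>

lemma dyadic_approx_borel: "A \<in> sets borel \<Longrightarrow> dyadic_approx (A \<inter> {0..1})"
proof -
  assume "A \<in> sets borel"
  then have "A \<in> sigma_sets UNIV (range (\<lambda>a::real. {..a}))"
    by (simp add: borel_eq_atMost)
  then show "dyadic_approx (A \<inter> {0..1})"
  proof induction
    case (Basic A)
    then show ?case
      using dyadic_approx_Iic by auto
  next
    case Empty
    then show ?case
      using dyadic_approx_dyadic[OF dyadicsI[of "\<lambda>_. False"]] by simp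
  next
    case (Compl A)
    show ?case
      unfolding dyadic_approx_def
    proof (intro allI impI)
      fix e :: real assume "0 < e"
      then obtain m D where D: "D \<in> dyadics m" "\<mu> (sym_diff (A \<inter> {0..1}) D) < e"
        using Compl.IH unfolding dyadic_approx_def by blast
      obtain P where P: "D = {x \<in> {0..1}. P (dyadic m x)}"
        using D(1) by (rule dyadicsE)
      have "sym_diff ((UNIV - A) \<inter> {0..1}) {x \<in> {0..1}. \<not> P (dyadic m x)} = sym_diff (A \<inter> {0..1}) D"
        unfolding P by blast
      then show "\<exists>m. \<exists>D\<in>dyadics m. \<mu> (sym_diff ((UNIV - A) \<inter> {0..1}) D) < e"
        using D(2) dyadicsI[of "\<lambda>i. \<not> P i" m]
        by (intro exI[of _ m] bexI[of _ "{x \<in> {0..1}. \<not> P (dyadic m x)}"]) simp_all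
    qed
  next
    case (Union A)
    have A: "A i \<inter> {0..1} \<in> \<B>" for i
      using Union.hyps by (intro sets_leb01_I) (simp add: borel_eq_atMost)
    define BB where "BB n = (\<Union>i<n. A i \<inter> {0..1})" for n
    have B: "BB n \<in> \<B>" for n
      unfolding BB_def by (intro sets.finite_UN A finite_lessThan)
    have fin: "dyadic_approx (BB n)" for n
    proof (induction n)
      case 0
      show ?case
        using dyadic_approx_dyadic[OF dyadicsI[of "\<lambda>_. False"]] by (simp add: BB_def)
    next
      case (Suc n)
      have "BB (Suc n) = BB n \<union> (A n \<inter> {0..1})"
        by (auto simp: BB_def less_Suc_eq)
      then show ?case
        using dyadic_approx_Un[OF B Suc A Union.IH] by (simp only:)
    qed
    have un: "(\<Union>i. A i) \<inter> {0..1} = (\<Union>n. BB n)"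
      by (auto simp: BB_def)
    have unS: "(\<Union>n. BB n) \<in> \<B>"
      using B by blast
    have lim: "(\<lambda>n. \<mu> (BB n)) \<longlonglongrightarrow> \<mu> (\<Union>n. BB n)"
      by (rule leb01.finite_Lim_measure_incseq)
         (use B in \<open>auto simp: incseq_def BB_def intro: order_less_le_trans\<close>)
    show ?case
      unfolding un
    proof (rule dyadic_approx_limit[OF unS])
      fix e :: real assume "0 < e"
      then have "eventually (\<lambda>n. \<mu> (\<Union>n. BB n) - e < \<mu> (BB n)) sequentially"
        by (intro order_tendstoD(1)[OF lim]) simp
      then obtain n where n: "\<mu> (\<Union>n. BB n) - e < \<mu> (BB n)"
        unfolding eventually_sequentially by blast
      have "sym_diff (\<Union>n. BB n) (BB n) = (\<Union>n. BB n) - BB n"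
        by blast
      also have "\<mu> \<dots> = \<mu> (\<Union>n. BB n) - \<mu> (BB n)"
        by (rule leb01.finite_measure_Diff[OF unS B]) blast
      finally have "\<mu> (sym_diff (\<Union>n. BB n) (BB n)) < e"
        using n by simp
      then show "\<exists>B\<in>\<B>. dyadic_approx B \<and> \<mu> (sym_diff (\<Union>n. BB n) B) < e"
        using B fin by blast
    qed
  qed
qed

lemma dyadic_dense:
  assumes "A \<in> \<B>" "0 < e"
  obtains m D where "D \<in> dyadics m" "D \<in> \<B>" "\<mu> (sym_diff A D) < e"
proof -
  have "A \<inter> {0..1} = A"
    using assms by (auto simp: sets_leb01)
  then have "dyadic_approx A"
    using dyadic_approx_borel[of A] assms by (simp add: sets_leb01)
  then show thesis
    using assms(2) that dyadics_leb01 unfolding dyadic_approx_def by blast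
qed

text \<open>Correlations depend continuously on both sets, uniformly in the transformation.\<close>

lemma mixes_map_of_dyadic:
  assumes T: "T \<in> mpt" and p: "p \<in> {0..1}"
    and lim: "\<And>k A B. A \<in> dyadics k \<Longrightarrow> B \<in> dyadics k \<Longrightarrow>
      corr_limit T m p A B"
  shows "mixes_map T m p"
proof (intro ballI)
  fix A B assume A: "A \<in> \<B>" and B: "B \<in> \<B>"
  let ?t = "\<lambda>A B. (1 - p) * \<mu> (A \<inter> B) + p * (\<mu> A * \<mu> B)"
  show "(\<lambda>l. \<mu> (A \<inter> preimage_iter T (m l) B)) \<longlonglongrightarrow> ?t A B"
    unfolding LIMSEQ_iff
  proof (intro allI impI)
    fix r :: real assume "0 < r"
    \<comment> \<open>Two fifths for exchanging both sets in the correlation, two for exchanging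
      them in the limit, one for the convergence itself.\<close>
    then have e: "0 < r / 5" by simp
    obtain k1 D where D: "D \<in> dyadics k1" "D \<in> \<B>" "\<mu> (sym_diff A D) < r / 5"
      using dyadic_dense[OF A e] .
    obtain k2 E where E: "E \<in> dyadics k2" "E \<in> \<B>" "\<mu> (sym_diff B E) < r / 5"
      using dyadic_dense[OF B e] .
    have "D \<in> dyadics (max k1 k2)" "E \<in> dyadics (max k1 k2)"
      using D(1) E(1) dyadics_mono[of k1 "max k1 k2"] dyadics_mono[of k2 "max k1 k2"] by auto
    from lim[OF this] obtain L where
      L: "\<And>l. l \<ge> L \<Longrightarrow> \<bar>\<mu> (D \<inter> preimage_iter T (m l) E) - ?t D E\<bar> < r / 5"
      using e unfolding LIMSEQ_iff real_norm_def by blast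
    have corr: "\<bar>\<mu> (A \<inter> preimage_iter T (m l) B) - \<mu> (D \<inter> preimage_iter T (m l) E)\<bar> < 2 * r / 5" for l
    proof -
      have pB: "preimage_iter T (m l) B \<in> \<B>" and pE: "preimage_iter T (m l) E \<in> \<B>"
        using preimage_iter_sets[OF T] B E(2) by auto
      have "sym_diff (preimage_iter T (m l) B) (preimage_iter T (m l) E) =
          preim (int_iter T (m l)) (sym_diff B E)"
        by (auto simp: preimage_iter_def)
      then have "\<mu> (sym_diff (preimage_iter T (m l) B) (preimage_iter T (m l) E)) = \<mu> (sym_diff B E)"
        using pres_measure[OF mpt_int_iter_pres[OF T] sym_diff_sets[OF B E(2)]] by simp
      then show ?thesis
        using abs_diff_le_sym_diff[OF sets.Int[OF A pB] sets.Int[OF D(2) pE]]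
          sym_diff_Int[OF A pB D(2) pE] D(3) E(3) by simp
    qed
    have t: "\<bar>?t D E - ?t A B\<bar> \<le> 2 * r / 5"
    proof -
      have AB: "\<bar>\<mu> (D \<inter> E) - \<mu> (A \<inter> B)\<bar> \<le> 2 * r / 5"
        using abs_diff_le_sym_diff[OF sets.Int[OF A B] sets.Int[OF D(2) E(2)]]
          sym_diff_Int[OF A B D(2) E(2)] D(3) E(3) by (simp add: abs_minus_commute)
      have le1: "\<mu> X \<le> 1" if "X \<in> \<B>" for X
        using measure_mono01[of X "{0..1}"] that sets.top[of leb01] by (simp add: sets_leb01)
      have "\<mu> D * \<mu> E - \<mu> A * \<mu> B = \<mu> D * (\<mu> E - \<mu> B) + (\<mu> D - \<mu> A) * \<mu> B"
        by (simp add: algebra_simps)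
      also have "\<bar>\<dots>\<bar> \<le> \<mu> D * \<bar>\<mu> E - \<mu> B\<bar> + \<bar>\<mu> D - \<mu> A\<bar> * \<mu> B"
        by (rule order_trans[OF abs_triangle_ineq]) (simp add: abs_mult)
      also have "\<dots> \<le> 1 * \<bar>\<mu> E - \<mu> B\<bar> + \<bar>\<mu> D - \<mu> A\<bar> * 1"
        by (intro add_mono mult_left_mono mult_right_mono le1 D(2) B) auto
      also have "\<dots> \<le> 2 * r / 5"
        using abs_diff_le_sym_diff[OF A D(2)] abs_diff_le_sym_diff[OF B E(2)] D(3) E(3)
        by (simp add: abs_minus_commute)
      finally have prod: "\<bar>\<mu> D * \<mu> E - \<mu> A * \<mu> B\<bar> \<le> 2 * r / 5" .
      have "?t D E - ?t A B = (1 - p) * (\<mu> (D \<inter> E) - \<mu> (A \<inter> B)) + p * (\<mu> D * \<mu> E - \<mu> A * \<mu> B)"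
        by (simp add: algebra_simps)
      also have "\<bar>\<dots>\<bar> \<le> (1 - p) * \<bar>\<mu> (D \<inter> E) - \<mu> (A \<inter> B)\<bar> + p * \<bar>\<mu> D * \<mu> E - \<mu> A * \<mu> B\<bar>"
        using p by (intro order_trans[OF abs_triangle_ineq]) (simp add: abs_mult)
      also have "\<dots> \<le> (1 - p) * (2 * r / 5) + p * (2 * r / 5)"
        using p by (intro add_mono mult_left_mono AB prod) auto
      also have "\<dots> = 2 * r / 5"
        by (simp add: field_simps)
      finally show ?thesis .
    qed
    show "\<exists>L. \<forall>l\<ge>L. norm (\<mu> (A \<inter> preimage_iter T (m l) B) - ?t A B) < r"
    proof (intro exI[of _ L] allI impI)
      fix l assume "L \<le> l"
      with L[OF this] corr[of l] t show "norm (\<mu> (A \<inter> preimage_iter T (m l) B) - ?t A B) < r"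
        unfolding real_norm_def by linarith
    qed
  qed
qed

subsection \<open>The weak topology\<close>

lemma rep_aut_mpt: "rep_aut X \<in> mpt"
  using Quotient_rep_reflp[OF Quotient_aut, of X] by (simp add: mpt_eq_def)

lemma mpt_eq_refl: "T \<in> mpt \<Longrightarrow> mpt_eq T T"
  by (simp add: mpt_eq_def)

lemma rep_abs_aut: "T \<in> mpt \<Longrightarrow> AE x in leb01. rep_aut (abs_aut T) x = T x"
  using Quotient_rep_abs[OF Quotient_aut mpt_eq_refl] by (simp add: mpt_eq_def)

lemma koopman_dist_rep: "koopman_dist f X Y = L2norm (\<lambda>x. f (rep_aut X x) - f (rep_aut Y x))"
  by (simp add: koopman_dist_def)

lemma mixes_along_rep: "mixes_along X m p \<longleftrightarrow> mixes_map (rep_aut X) m p"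
  by (simp add: mixes_along_def)

lemma mixes_along_abs: "T \<in> mpt \<Longrightarrow> mixes_along (abs_aut T) m p \<longleftrightarrow> mixes_map T m p"
  by (simp add: mixes_along.abs_eq mpt_eq_refl)

lemma aperiodic_rep:
  assumes "aperiodic X"
  shows "aperiodic_map (rep_aut X)"
proof -
  have "{x \<in> {0..1}. \<exists>n\<ge>1. (rep_aut X ^^ n) x = x} \<in> null_sets leb01"
    using assms by (simp add: aperiodic_def)
  from AE_not_in[OF this] AE_in_01 show ?thesis
    by eventually_elim auto
qed

lemma tendsto_0_mono:
  fixes f g :: "'i \<Rightarrow> real"
  assumes "\<And>i. 0 \<le> f i" "\<And>i. f i \<le> g i" "(g \<longlongrightarrow> 0) F"
  shows "(f \<longlongrightarrow> 0) F"
  by (rule tendsto_sandwich[OF _ _ tendsto_const assms(3)]) (simp_all add: assms)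

text \<open>Weak convergence read in the measure algebra; inverses and powers are easier to treat in
  this form than with the norm. The filter is arbitrary so that continuity at a point is included,
  not only convergence of sequences.\<close>

definition pre_conv :: "('i \<Rightarrow> real \<Rightarrow> real) \<Rightarrow> (real \<Rightarrow> real) \<Rightarrow> 'i filter \<Rightarrow> bool" where
  "pre_conv Y T F \<longleftrightarrow> (\<forall>B\<in>\<B>.
    ((\<lambda>i. \<mu> (sym_diff (preim (Y i) B) (preim T B))) \<longlongrightarrow> 0) F)"

lemma L2norm_indicator:
  assumes S: "S \<in> mpt" and T: "T \<in> mpt" and B: "B \<in> \<B>"
  shows "L2norm (\<lambda>x. indicator B (S x) - indicator B (T x)) =
    sqrt (\<mu> (sym_diff (preim S B) (preim T B)))"
proof -
  let ?D = "sym_diff (preim S B) (preim T B)"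
  have D: "?D \<in> \<B>"
    by (intro sym_diff_sets preim_sets mpt_meas S T B)
  have "(\<integral>\<^sup>+ x. ennreal ((indicator B (S x) - indicator B (T x))\<^sup>2) \<partial>leb01) = (\<integral>\<^sup>+ x. indicator ?D x \<partial>leb01)"
    by (rule nn_integral_cong) (auto simp: indicator_def)
  also have "\<dots> = ennreal (\<mu> ?D)"
    using D by (simp add: leb01.emeasure_eq_measure)
  finally show ?thesis
    by (simp add: L2norm_def)
qed

lemma indicator_L2: "B \<in> \<B> \<Longrightarrow> indicator B \<in> L2"
proof -
  assume [measurable]: "B \<in> \<B>"
  have "(\<lambda>x. (indicator B x)\<^sup>2) = (indicator B :: real \<Rightarrow> real)"
    by (auto simp: indicator_def)
  then show ?thesis
    by (simp add: L2_def leb01.emeasure_eq_measure)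
qed

lemma pre_conv_of_tendsto:
  assumes "(Y \<longlongrightarrow> X) F"
  shows "pre_conv (\<lambda>i. rep_aut (Y i)) (rep_aut X) F"
  unfolding pre_conv_def
proof
  fix B assume B: "B \<in> \<B>"
  have "((\<lambda>i. koopman_dist (indicator B) (Y i) X) \<longlongrightarrow> 0) F"
    using assms indicator_L2[OF B] unfolding tendsto_aut_iff by blast
  then have "((\<lambda>i. (koopman_dist (indicator B) (Y i) X)\<^sup>2) \<longlongrightarrow> 0\<^sup>2) F"
    by (rule tendsto_power)
  then show "((\<lambda>i. \<mu> (sym_diff (preim (rep_aut (Y i)) B) (preim (rep_aut X) B))) \<longlongrightarrow> 0) F"
    by (simp only: koopman_dist_rep L2norm_indicator[OF rep_aut_mpt rep_aut_mpt B]
        real_sqrt_pow2[OF measure_nonneg] zero_power2)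
qed

text \<open>With \<open>C\<close> the preimage of \<open>B\<close> under the inverse of
  \<open>T\<close>, the error at \<open>B\<close> for the inverses is moved by \<open>Y i\<close> to
  the error at the fixed set \<open>C\<close> for the maps themselves.\<close>

lemma pre_conv_inv:
  assumes Y: "\<And>i. Y i \<in> mpt" and T: "T \<in> mpt" and conv: "pre_conv Y T F"
  shows "pre_conv (\<lambda>i. inv01 (Y i)) (inv01 T) F"
  unfolding pre_conv_def
proof
  fix B assume B: "B \<in> \<B>"
  let ?C = "preim (inv01 T) B"
  have C: "?C \<in> \<B>"
    by (intro preim_sets mpt_inv_meas T B)
  have BT: "preim T ?C = B"
    using mpt_in[OF T] mpt_inv_left[OF T] B by (auto simp: sets_leb01 subset_iff simp del: atLeastAtMost_iff)
  have "\<mu> (sym_diff (preim (inv01 (Y i)) B) ?C) = \<mu> (sym_diff (preim (Y i) ?C) (preim T ?C))" for i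
  proof -
    let ?Ci = "preim (inv01 (Y i)) B"
    have Ci: "?Ci \<in> \<B>"
      by (intro preim_sets mpt_inv_meas Y B)
    have BY: "preim (Y i) ?Ci = B"
      using mpt_in[OF Y] mpt_inv_left[OF Y] B by (auto simp: sets_leb01 subset_iff simp del: atLeastAtMost_iff)
    have "\<mu> (sym_diff ?Ci ?C) = \<mu> (preim (Y i) (sym_diff ?Ci ?C))"
      by (rule pres_measure[OF mpt_pres[OF Y] sym_diff_sets[OF Ci C], symmetric])
    also have "preim (Y i) (sym_diff ?Ci ?C) =
        sym_diff (preim (Y i) ?Ci) (preim (Y i) ?C)"
      by blast
    also have "\<dots> = sym_diff (preim (Y i) ?C) (preim T ?C)"
      unfolding BY BT by (rule Un_commute)
    finally show ?thesis .
  qed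
  moreover have "((\<lambda>i. \<mu> (sym_diff (preim (Y i) ?C) (preim T ?C))) \<longlongrightarrow> 0) F"
    using conv C unfolding pre_conv_def by blast
  ultimately show "((\<lambda>i. \<mu> (sym_diff (preim (inv01 (Y i)) B) ?C)) \<longlongrightarrow> 0) F"
    by (simp only:)
qed

text \<open>Between the two preimages under power \<open>n + 1\<close> stands the preimage under
  \<open>Y i\<close> of the fixed set \<open>preim (T ^^ n) B\<close>. Its distance to the first is
  the error for power \<open>n\<close>, because \<open>Y i\<close> preserves the measure; its
  distance to the second is an error for power 1.\<close>

lemma pre_conv_funpow:
  assumes Y: "\<And>i. Y i \<in> mpt" and T: "T \<in> mpt" and conv: "pre_conv Y T F"
  shows "pre_conv (\<lambda>i. Y i ^^ n) (T ^^ n) F"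
proof (induction n)
  case 0
  then show ?case by (simp add: pre_conv_def)
next
  case (Suc n)
  show ?case
    unfolding pre_conv_def
  proof
    fix B assume B: "B \<in> \<B>"
    let ?P = "\<lambda>i. preim (Y i ^^ n) B" and ?Q = "preim (T ^^ n) B"
    have P: "?P i \<in> \<B>" for i
      by (intro preim_sets mpt_meas mpt_funpow Y B)
    have Q: "?Q \<in> \<B>"
      by (intro preim_sets mpt_meas mpt_funpow T B)
    let ?a = "\<lambda>i. \<mu> (sym_diff (?P i) ?Q)"
    let ?b = "\<lambda>i. \<mu> (sym_diff (preim (Y i) ?Q) (preim T ?Q))"
    have le: "\<mu> (sym_diff (preim (Y i ^^ Suc n) B) (preim (T ^^ Suc n) B)) \<le> ?a i + ?b i" for i
    proof -
      have eqY: "preim (Y i ^^ Suc n) B = preim (Y i) (?P i)"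
        using mpt_in[OF Y] by (auto simp: funpow_swap1 simp del: atLeastAtMost_iff)
      have eqT: "preim (T ^^ Suc n) B = preim T ?Q"
        using mpt_in[OF T] by (auto simp: funpow_swap1 simp del: atLeastAtMost_iff)
      have s: "preim (Y i) (?P i) \<in> \<B>" "preim (Y i) ?Q \<in> \<B>"
        "preim T ?Q \<in> \<B>"
        by (intro preim_sets mpt_meas Y T P Q)+
      have "sym_diff (preim (Y i) (?P i)) (preim (Y i) ?Q) = preim (Y i) (sym_diff (?P i) ?Q)"
        by blast
      then have "\<mu> (sym_diff (preim (Y i) (?P i)) (preim (Y i) ?Q)) = ?a i"
        using pres_measure[OF mpt_pres[OF Y] sym_diff_sets[OF P Q]] by simp
      with sym_diff_triangle[OF s] show ?thesis
        unfolding eqY eqT by simp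
    qed
    have "(?a \<longlongrightarrow> 0) F" "(?b \<longlongrightarrow> 0) F"
      using Suc.IH conv B Q unfolding pre_conv_def by blast+
    then have "((\<lambda>i. ?a i + ?b i) \<longlongrightarrow> 0) F"
      by (rule tendsto_add_zero)
    then show "((\<lambda>i. \<mu> (sym_diff (preim (Y i ^^ Suc n) B) (preim (T ^^ Suc n) B))) \<longlongrightarrow> 0) F"
      by (rule tendsto_0_mono[OF measure_nonneg le])
  qed
qed

lemma pre_conv_int_iter:
  assumes Y: "\<And>i. Y i \<in> mpt" and T: "T \<in> mpt" and conv: "pre_conv Y T F"
  shows "pre_conv (\<lambda>i. int_iter (Y i) m) (int_iter T m) F"
  using pre_conv_funpow[OF Y T conv, of "nat m"]
    pre_conv_funpow[OF mpt_inv[OF Y] mpt_inv[OF T] pre_conv_inv[OF Y T conv], of "nat (- m)"]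
  by (simp add: int_iter_def)

lemma tendsto_corr:
  assumes Y: "(Y \<longlongrightarrow> X) F" and A: "A \<in> \<B>" and B: "B \<in> \<B>"
  shows "((\<lambda>i. \<mu> (A \<inter> preimage_iter (rep_aut (Y i)) m B)) \<longlongrightarrow> \<mu> (A \<inter> preimage_iter (rep_aut X) m B)) F"
proof -
  let ?d = "\<lambda>i. \<mu> (sym_diff (preimage_iter (rep_aut (Y i)) m B) (preimage_iter (rep_aut X) m B))"
  have "(?d \<longlongrightarrow> 0) F"
    using pre_conv_int_iter[OF rep_aut_mpt rep_aut_mpt pre_conv_of_tendsto[OF Y], of m] B
    unfolding pre_conv_def preimage_iter_def by blast
  moreover have "\<bar>\<mu> (A \<inter> preimage_iter (rep_aut (Y i)) m B) - \<mu> (A \<inter> preimage_iter (rep_aut X) m B)\<bar> \<le> ?d i" for i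
  proof -
    note s = preimage_iter_sets[OF rep_aut_mpt B, of "Y i" m] preimage_iter_sets[OF rep_aut_mpt B, of X m]
    show ?thesis
      using abs_diff_le_sym_diff[OF sets.Int[OF A s(1)] sets.Int[OF A s(2)]] sym_diff_Int[OF A s(1) A s(2)]
      by simp
  qed
  ultimately have "((\<lambda>i. \<mu> (A \<inter> preimage_iter (rep_aut (Y i)) m B) - \<mu> (A \<inter> preimage_iter (rep_aut X) m B)) \<longlongrightarrow> 0) F"
    by (rule_tac Lim_null_comparison[of _ ?d]) (auto simp: always_eventually)
  then show ?thesis
    by (rule LIM_zero_cancel)
qed

lemma open_corr:
  assumes "A \<in> \<B>" "B \<in> \<B>"
  shows "open {X. \<bar>\<mu> (A \<inter> preimage_iter (rep_aut X) m B) - t\<bar> < e}"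
proof -
  have "continuous_on UNIV (\<lambda>X. \<bar>\<mu> (A \<inter> preimage_iter (rep_aut X) m B) - t\<bar>)"
    by (intro continuous_intros) (simp add: continuous_on_def tendsto_corr[OF tendsto_ident_at assms])
  then show ?thesis
    by (intro open_Collect_less continuous_on_const)
qed

section \<open>From convergence of preimages back to convergence in the norm\<close>

lemma L2_comp: "g \<in> L2 \<Longrightarrow> T \<in> mpt \<Longrightarrow> (\<lambda>x. g (T x)) \<in> L2"
proof -
  assume g: "g \<in> L2" and T: "T \<in> mpt"
  note Tm = mpt_meas[OF T]
  have d: "distr leb01 leb01 T = leb01"
    using T by (simp add: mpt_def)
  have "integrable leb01 (\<lambda>x. (g (T x))\<^sup>2)"
    using g by (subst integrable_distr_eq[OF Tm, symmetric]) (auto simp: L2_def d)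
  then show ?thesis
    using g measurable_compose[OF Tm] by (auto simp: L2_def)
qed

lemma L2norm_comp: "g \<in> L2 \<Longrightarrow> T \<in> mpt \<Longrightarrow> L2norm (\<lambda>x. g (T x)) = L2norm g"
proof -
  assume g: "g \<in> L2" and T: "T \<in> mpt"
  have [measurable]: "g \<in> borel_measurable leb01"
    using g by (simp add: L2_def)
  have "(\<integral>\<^sup>+ x. ennreal ((g (T x))\<^sup>2) \<partial>leb01) = (\<integral>\<^sup>+ x. ennreal ((g x)\<^sup>2) \<partial>distr leb01 leb01 T)"
    by (rule nn_integral_distr[symmetric, OF mpt_meas[OF T]]) measurable
  then show ?thesis
    using T by (simp add: L2norm_def mpt_def)
qed

lemma L2_diff:
  assumes "g \<in> L2" "h \<in> L2"
  shows "(\<lambda>x. g x - h x) \<in> L2"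
proof -
  have [measurable]: "g \<in> borel_measurable leb01" "h \<in> borel_measurable leb01"
    using assms by (auto simp: L2_def)
  have "integrable leb01 (\<lambda>x. (g x - h x)\<^sup>2)"
  proof (rule Bochner_Integration.integrable_bound)
    show "integrable leb01 (\<lambda>x. 2 * (g x)\<^sup>2 + 2 * (h x)\<^sup>2)"
      using assms by (simp add: L2_def)
    have "(a - b)\<^sup>2 \<le> 2 * a\<^sup>2 + 2 * b\<^sup>2" for a b :: real
      using zero_le_power2[of "a + b"] unfolding power2_diff power2_sum by linarith
    then show "AE x in leb01. norm ((g x - h x)\<^sup>2) \<le> norm (2 * (g x)\<^sup>2 + 2 * (h x)\<^sup>2)"
      by simp
  qed measurable
  then show ?thesis
    by (simp add: L2_def)
qed

lemma simple_L2: "simple_function leb01 s \<Longrightarrow> s \<in> L2"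
proof -
  assume s: "simple_function leb01 s"
  have "integrable leb01 (\<lambda>x. (s x)\<^sup>2)"
    using integrable_simple_function[OF simple_function_compose[OF s, of "\<lambda>y. y\<^sup>2"]]
    by (simp add: comp_def)
  then show ?thesis
    using borel_measurable_simple_function[OF s] by (simp add: L2_def)
qed

lemma simple_dense_L2:
  assumes f: "f \<in> L2" and e: "0 < e"
  shows "\<exists>s. simple_function leb01 s \<and> L2norm (\<lambda>x. f x - s x) < e"
proof -
  have [measurable]: "f \<in> borel_measurable leb01"
    using f by (simp add: L2_def)
  obtain s where s': "\<forall>i. simple_function leb01 (s i)" "\<forall>x\<in>{0..1}. (\<lambda>i. s i x) \<longlonglongrightarrow> f x"
    "\<forall>i. \<forall>x\<in>{0..1}. dist (s i x) 0 \<le> 2 * dist (f x) 0"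
    using borel_measurable_implies_sequence_metric[of f leb01 0] unfolding space_leb01 by auto
  then have s: "\<And>i. simple_function leb01 (s i)" "\<And>x. x \<in> {0..1} \<Longrightarrow> (\<lambda>i. s i x) \<longlonglongrightarrow> f x"
    "\<And>i x. x \<in> {0..1} \<Longrightarrow> \<bar>s i x\<bar> \<le> 2 * \<bar>f x\<bar>"
    by (auto simp: dist_real_def)
  have [measurable]: "s i \<in> borel_measurable leb01" for i
    by (rule borel_measurable_simple_function[OF s(1)])
  have "(\<lambda>i. LINT x|leb01. (f x - s i x)\<^sup>2) \<longlonglongrightarrow> (LINT x|leb01. 0)"
  \<comment> \<open>The approximants satisfy \<open>|s i x| \<le> 2 * |f x|\<close>, so the
    difference is at most three times \<open>|f x|\<close>.\<close>
  proof (rule integral_dominated_convergence[where w = "\<lambda>x. 9 * (f x)\<^sup>2"])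
    show "integrable leb01 (\<lambda>x. 9 * (f x)\<^sup>2)"
      using f by (simp add: L2_def)
    show "AE x in leb01. (\<lambda>i. (f x - s i x)\<^sup>2) \<longlonglongrightarrow> 0"
      using AE_in_01
    proof eventually_elim
      case (elim x)
      have "(\<lambda>i. (f x - s i x)\<^sup>2) \<longlonglongrightarrow> (f x - f x)\<^sup>2"
        by (intro tendsto_intros s(2) elim)
      then show ?case by simp
    qed
    show "AE x in leb01. norm ((f x - s i x)\<^sup>2) \<le> 9 * (f x)\<^sup>2" for i
      using AE_in_01
    proof eventually_elim
      case (elim x)
      have "\<bar>f x - s i x\<bar> \<le> 3 * \<bar>f x\<bar>"
        using s(3)[OF elim, of i] by linarith
      from power_mono[OF this abs_ge_zero, of 2] show ?case
        by (simp add: power_mult_distrib)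
    qed
  qed measurable
  then have "(\<lambda>i. L2norm (\<lambda>x. f x - s i x)) \<longlonglongrightarrow> sqrt 0"
    unfolding L2norm_eq[OF L2_diff[OF f simple_L2[OF s(1)]]] by (intro tendsto_real_sqrt) simp
  then have "eventually (\<lambda>i. L2norm (\<lambda>x. f x - s i x) < e) sequentially"
    using e by (intro order_tendstoD) auto
  then obtain i where "L2norm (\<lambda>x. f x - s i x) < e"
    unfolding eventually_sequentially by blast
  with s(1) show ?thesis by blast
qed

text \<open>The two compositions differ only on the symmetric differences that belong to the
  finitely many values of \<open>s\<close>, and there by at most twice the bound of
  \<open>s\<close>.\<close>

lemma koopman_conv_simple:
  assumes Y: "\<And>i. Y i \<in> mpt" and T: "T \<in> mpt" and conv: "pre_conv Y T F"
    and s: "simple_function leb01 s"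
  shows "((\<lambda>i. L2norm (\<lambda>x. s (Y i x) - s (T x))) \<longlongrightarrow> 0) F"
proof -
  have fin: "finite (s ` {0..1})"
    using simple_functionD(1)[OF s] by simp
  then have "bounded (s ` {0..1})"
    by (rule finite_imp_bounded)
  then obtain C where "\<forall>y\<in>s ` {0..1}. norm y \<le> C"
    unfolding bounded_iff by blast
  then have C: "\<bar>s x\<bar> \<le> C" if "x \<in> {0..1}" for x
    using that by (metis imageI real_norm_def)
  let ?E = "\<lambda>v. {x \<in> {0..1}. s x = v}"
  let ?D = "\<lambda>i v. sym_diff (preim (Y i) (?E v)) (preim T (?E v))"
  have E: "?E v \<in> \<B>" for v
  proof -
    have "s -` {v} \<inter> space leb01 \<in> \<B>"
      by (rule simple_functionD(2)[OF s])
    moreover have "s -` {v} \<inter> space leb01 = ?E v" by auto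
    ultimately show ?thesis by simp
  qed
  have D: "?D i v \<in> \<B>" for i v
    by (intro sym_diff_sets preim_sets mpt_meas Y T E)
  have le: "L2norm (\<lambda>x. s (Y i x) - s (T x)) \<le> sqrt ((2 * C)\<^sup>2 * (\<Sum>v\<in>s ` {0..1}. \<mu> (?D i v)))" for i
  proof -
    let ?U = "\<Union>v\<in>s ` {0..1}. ?D i v"
    have U: "?U \<in> \<B>"
      by (intro sets.finite_UN fin D)
    have "(\<integral>\<^sup>+ x. ennreal ((s (Y i x) - s (T x))\<^sup>2) \<partial>leb01) \<le> (\<integral>\<^sup>+ x. ennreal ((2 * C)\<^sup>2) * indicator ?U x \<partial>leb01)"
    proof (rule nn_integral_mono)
      fix x assume "x \<in> space leb01"
      then have x: "x \<in> {0..1}" by simp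
      note Yx = mpt_in[OF Y x, of i] and Tx = mpt_in[OF T x]
      show "ennreal ((s (Y i x) - s (T x))\<^sup>2) \<le> ennreal ((2 * C)\<^sup>2) * indicator ?U x"
      proof (cases "s (Y i x) = s (T x)")
        case False
        then have "x \<in> ?D i (s (T x))"
          using x Yx Tx by simp
        then have "x \<in> ?U"
          using Tx by blast
        moreover have "\<bar>s (Y i x) - s (T x)\<bar> \<le> 2 * C"
          using C[OF Yx] C[OF Tx] by linarith
        then have "(s (Y i x) - s (T x))\<^sup>2 \<le> (2 * C)\<^sup>2"
          using power_mono[OF _ abs_ge_zero, of "s (Y i x) - s (T x)" "2 * C" 2] by simp
        ultimately show ?thesis
          by (simp add: ennreal_leI del: UN_iff)
      qed simp
    qed
    also have "\<dots> = ennreal ((2 * C)\<^sup>2 * \<mu> ?U)"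
      using U by (simp add: nn_integral_cmult_indicator leb01.emeasure_eq_measure ennreal_mult' del: UN_iff)
    finally have "enn2real (\<integral>\<^sup>+ x. ennreal ((s (Y i x) - s (T x))\<^sup>2) \<partial>leb01) \<le> (2 * C)\<^sup>2 * \<mu> ?U"
      by (intro enn2real_leI mult_nonneg_nonneg zero_le_power2 measure_nonneg)
    then have "L2norm (\<lambda>x. s (Y i x) - s (T x)) \<le> sqrt ((2 * C)\<^sup>2 * \<mu> ?U)"
      unfolding L2norm_def by (rule real_sqrt_le_mono)
    also have "\<mu> ?U \<le> (\<Sum>v\<in>s ` {0..1}. \<mu> (?D i v))"
      by (rule measure_UNION_le[OF fin D])
    finally show ?thesis
      by (simp add: mult_left_mono)
  qed
  have "((\<lambda>i. \<mu> (?D i v)) \<longlongrightarrow> 0) F" for v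
    using conv E[of v] unfolding pre_conv_def by blast
  then have "((\<lambda>i. sqrt ((2 * C)\<^sup>2 * (\<Sum>v\<in>s ` {0..1}. \<mu> (?D i v)))) \<longlongrightarrow> sqrt ((2 * C)\<^sup>2 * (\<Sum>v\<in>s ` {0..1}. 0))) F"
    by (intro tendsto_real_sqrt tendsto_mult tendsto_const tendsto_sum)
  then have "((\<lambda>i. sqrt ((2 * C)\<^sup>2 * (\<Sum>v\<in>s ` {0..1}. \<mu> (?D i v)))) \<longlongrightarrow> 0) F"
    by (simp only: sum.neutral_const mult_zero_right real_sqrt_zero)
  moreover have "0 \<le> L2norm (\<lambda>x. s (Y i x) - s (T x))" for i
    by (simp add: L2norm_def)
  ultimately show ?thesis
    using le by (intro tendsto_0_mono[where f = "\<lambda>i. L2norm (\<lambda>x. s (Y i x) - s (T x))"])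
qed

lemma koopman_conv:
  assumes Y: "\<And>i. Y i \<in> mpt" and T: "T \<in> mpt" and conv: "pre_conv Y T F" and f: "f \<in> L2"
  shows "((\<lambda>i. L2norm (\<lambda>x. f (Y i x) - f (T x))) \<longlongrightarrow> 0) F"
proof (rule tendstoI)
  fix e :: real assume "0 < e"
  then have e: "0 < e / 3" by simp
  obtain s where s: "simple_function leb01 s" and fs: "L2norm (\<lambda>x. f x - s x) < e / 3"
    using simple_dense_L2[OF f e] by blast
  have g: "(\<lambda>x. f x - s x) \<in> L2"
    by (rule L2_diff[OF f simple_L2[OF s]])
  have g': "(\<lambda>x. s x - f x) \<in> L2"
    by (rule L2_diff[OF simple_L2[OF s] f])
  have fs': "L2norm (\<lambda>x. s x - f x) < e / 3"
    using fs by (simp add: L2norm_def power2_commute)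
  have "eventually (\<lambda>i. L2norm (\<lambda>x. s (Y i x) - s (T x)) < e / 3) F"
    using order_tendstoD(2)[OF koopman_conv_simple[OF Y T conv s] e] .
  then show "eventually (\<lambda>i. dist (L2norm (\<lambda>x. f (Y i x) - f (T x))) 0 < e) F"
  proof eventually_elim
    case (elim i)
    have sd: "(\<lambda>x. s (Y i x) - s (T x)) \<in> L2"
      by (rule L2_diff[OF L2_comp[OF simple_L2[OF s] Y] L2_comp[OF simple_L2[OF s] T]])
    have sf: "(\<lambda>x. s (Y i x) - f (T x)) \<in> L2"
      by (rule L2_diff[OF L2_comp[OF simple_L2[OF s] Y] L2_comp[OF f T]])
    have "L2norm (\<lambda>x. f (Y i x) - f (T x)) \<le> L2norm (\<lambda>x. f (Y i x) - s (Y i x)) + L2norm (\<lambda>x. s (Y i x) - f (T x))"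
      using L2_triangle[OF L2_comp[OF g Y[of i]] sf] by simp
    moreover have "L2norm (\<lambda>x. s (Y i x) - f (T x)) \<le> L2norm (\<lambda>x. s (Y i x) - s (T x)) + L2norm (\<lambda>x. s (T x) - f (T x))"
      using L2_triangle[OF sd L2_comp[OF g' T]] by simp
    ultimately have "L2norm (\<lambda>x. f (Y i x) - f (T x)) < e"
      using elim fs fs' L2norm_comp[OF g Y[of i]] L2norm_comp[OF g' T] by simp
    moreover have "0 \<le> L2norm (\<lambda>x. f (Y i x) - f (T x))"
      by (simp add: L2norm_def)
    ultimately show ?case
      by (simp add: dist_real_def)
  qed
qed

text \<open>The cell at scale \<open>i\<close> determines the cell at every coarser scale. So for a
  fixed dyadic set the two preimages eventually differ only where the labels at scale
  \<open>i\<close> do, and dyadic sets are dense.\<close>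

lemma tendsto_aut_of_dyadic:
  fixes X :: "nat \<Rightarrow> aut"
  assumes close: "\<And>i. \<mu> (dyadic_neq i (rep_aut (X i)) (rep_aut S)) \<le> (1/2) ^ i"
  shows "X \<longlonglongrightarrow> S"
proof -
  have mono: "dyadic m x = dyadic m y" if "m \<le> i" "x \<in> {0..1}" "y \<in> {0..1}" "dyadic i x = dyadic i y" for m i x y
    using that(1,4)
  proof (induction rule: inc_induct)
    case (step k)
    then show ?case
      using dyadic_Suc[OF that(2), of k] dyadic_Suc[OF that(3), of k] by simp
  qed simp
  have lim0: "(\<lambda>i. (1/2::real) ^ i) \<longlonglongrightarrow> 0"
    by (rule LIMSEQ_realpow_zero) auto
  have "pre_conv (\<lambda>i. rep_aut (X i)) (rep_aut S) sequentially"
    unfolding pre_conv_def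
  proof
    fix B assume B: "B \<in> \<B>"
    let ?p = "\<lambda>X C. preim (rep_aut X) C"
    let ?d = "\<lambda>i B. \<mu> (sym_diff (?p (X i) B) (?p S B))"
    show "(\<lambda>i. ?d i B) \<longlonglongrightarrow> 0"
    proof (rule tendstoI)
      fix e :: real assume "0 < e"
      then have e: "0 < e / 3" by simp
      obtain m D where D: "D \<in> dyadics m" "D \<in> \<B>" "\<mu> (sym_diff B D) < e / 3"
        using dyadic_dense[OF B e] .
      obtain P where P: "D = {x \<in> {0..1}. P (dyadic m x)}"
        using D(1) by (rule dyadicsE)
      have pre: "\<mu> (sym_diff (?p Z B) (?p Z D)) < e / 3" for Z
      proof -
        have "sym_diff (?p Z B) (?p Z D) =
            preim (rep_aut Z) (sym_diff B D)"
          by blast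
        then show ?thesis
          using pres_measure[OF mpt_pres[OF rep_aut_mpt] sym_diff_sets[OF B D(2)]] D(3) by simp
      qed
      have ps: "preim (rep_aut Z) C \<in> \<B>" if "C \<in> \<B>" for Z C
        by (intro preim_sets mpt_meas rep_aut_mpt that)
      have "eventually (\<lambda>i. (1/2) ^ i < e / 3) sequentially"
        using order_tendstoD(2)[OF lim0 e] .
      then show "eventually (\<lambda>i. dist (?d i B) 0 < e) sequentially"
        using eventually_ge_at_top[of m]
      proof eventually_elim
        case (elim i)
        let ?N = "dyadic_neq i (rep_aut (X i)) (rep_aut S)"
        have N: "?N \<in> \<B>"
          by (rule dyadic_neq_sets[OF rep_aut_mpt rep_aut_mpt])
        have sub: "sym_diff (?p (X i) D) (?p S D) \<subseteq> ?N"
        proof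
          fix x assume x: "x \<in> sym_diff (?p (X i) D) (?p S D)"
          then have x01: "x \<in> {0..1}" by blast
          have "dyadic i (rep_aut (X i) x) \<noteq> dyadic i (rep_aut S x)"
          proof
            assume "dyadic i (rep_aut (X i) x) = dyadic i (rep_aut S x)"
            from mono[OF elim(2) mpt_in[OF rep_aut_mpt x01] mpt_in[OF rep_aut_mpt x01] this] x
            show False
              using mpt_in[OF rep_aut_mpt x01] unfolding P by auto
          qed
          with x01 show "x \<in> ?N" by blast
        qed
        have "?d i D < e / 3"
          using measure_mono01[OF sub N] close[of i] elim(1) by linarith
        moreover have "?d i B \<le> \<mu> (sym_diff (?p (X i) B) (?p (X i) D)) +
            \<mu> (sym_diff (?p (X i) D) (?p S B))"
          by (rule sym_diff_triangle[OF ps[OF B] ps[OF D(2)] ps[OF B]])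
        moreover have "\<mu> (sym_diff (?p (X i) D) (?p S B)) \<le>
            ?d i D + \<mu> (sym_diff (?p S D) (?p S B))"
          by (rule sym_diff_triangle[OF ps[OF D(2)] ps[OF D(2)] ps[OF B]])
        moreover have "\<mu> (sym_diff (?p S D) (?p S B)) < e / 3"
          using pre[of S] by (subst Un_commute)
        ultimately have "?d i B < e"
          using pre[of "X i"] by linarith
        moreover have "0 \<le> ?d i B"
          by (rule measure_nonneg)
        ultimately show ?case
          unfolding dist_real_def by linarith
      qed
    qed
  qed
  then show ?thesis
    unfolding tendsto_aut_iff koopman_dist_rep
    using koopman_conv[OF rep_aut_mpt rep_aut_mpt] by blast
qed

subsection \<open>Density and the Borel class\<close>

abbreviation corr_error :: "(real \<Rightarrow> real) \<Rightarrow> int \<Rightarrow> real \<Rightarrow> real set \<Rightarrow> real set \<Rightarrow> real" where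
  "corr_error T m p A B \<equiv>
    \<bar>\<mu> (A \<inter> preimage_iter T m B) - ((1 - p) * \<mu> (A \<inter> B) + p * (\<mu> A * \<mu> B))\<bar>"

text \<open>A pair of dyadic sets at scale \<open>k\<close> belongs to every finer algebra, so the
  bounds apply to it from \<open>l = k\<close> on.\<close>

lemma mixes_map_of_errors:
  assumes T: "T \<in> mpt" and p: "p \<in> {0..1}"
    and le: "\<And>l A B. A \<in> dyadics l \<Longrightarrow> B \<in> dyadics l \<Longrightarrow> corr_error T (m l) p A B \<le> C / Suc l"
  shows "mixes_map T m p"
proof (rule mixes_map_of_dyadic[OF T p])
  fix k A B assume A: "A \<in> dyadics k" and B: "B \<in> dyadics k"
  let ?t = "(1 - p) * \<mu> (A \<inter> B) + p * (\<mu> A * \<mu> B)"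
  have "eventually (\<lambda>l. norm (\<mu> (A \<inter> preimage_iter T (m l) B) - ?t) \<le> C / Suc l) sequentially"
    using eventually_ge_at_top[of k]
  proof eventually_elim
    case (elim l)
    then show ?case
      using le[of A l B] A B dyadics_mono[OF elim] by auto
  qed
  moreover have "(\<lambda>l. C / Suc l) \<longlonglongrightarrow> 0"
    using tendsto_mult[OF tendsto_const[of C] LIMSEQ_inverse_real_of_nat] by (simp add: divide_inverse)
  ultimately have "(\<lambda>l. \<mu> (A \<inter> preimage_iter T (m l) B) - ?t) \<longlonglongrightarrow> 0"
    by (rule Lim_null_comparison)
  then show "(\<lambda>l. \<mu> (A \<inter> preimage_iter T (m l) B)) \<longlonglongrightarrow> ?t"
    by (rule LIM_zero_cancel)
qed

definition corr_near where
  "corr_near J m p T l k r \<longleftrightarrow> (\<forall>j\<in>J. \<forall>A\<in>dyadics l. \<forall>B\<in>dyadics l.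
    corr_error T (m j k) (p j) A B < r)"

lemma corr_near_mono:
  "corr_near J m p T l' k r' \<Longrightarrow> l \<le> l' \<Longrightarrow> r' \<le> r \<Longrightarrow> corr_near J m p T l k r"
  using dyadics_mono[of l l'] unfolding corr_near_def by (meson less_le_trans subsetD)

lemma eventually_corr_error:
  assumes J: "finite J" and r: "0 < r"
    and lim: "\<And>j A B. j \<in> J \<Longrightarrow> A \<in> dyadics k \<Longrightarrow> B \<in> dyadics k \<Longrightarrow>
      corr_limit T (m j) (p j) A B"
  shows "eventually (\<lambda>l. corr_near J m p T k l r) sequentially"
  unfolding corr_near_def
proof (intro eventually_ball_finite J finite_dyadics ballI)
  fix j A B assume "j \<in> J" "A \<in> dyadics k" "B \<in> dyadics k"
  from tendstoD[OF lim[OF this] r]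
  show "eventually (\<lambda>l. corr_error T (m j l) (p j) A B < r) sequentially"
    by (simp add: dist_real_def)
qed

text \<open>At scale \<open>l\<close>, the open condition asks for a single time
  \<open>k \<ge> l\<close> at which all correlations of \<open>dyadics l\<close> are close to their
  targets. The intersection of these conditions suffices because the times can be picked in
  increasing order.\<close>

lemma gdelta_mixes_along:
  assumes J: "finite J" and p: "\<And>j. j \<in> J \<Longrightarrow> p j \<in> {0..1}"
  shows "gdelta_in euclidean {X :: aut. \<exists>s :: nat \<Rightarrow> nat. strict_mono s \<and>
    (\<forall>j\<in>J. mixes_along X (\<lambda>l. m j (s l)) (p j))}"
proof -
  define V where "V l = (\<Union>k\<in>{l..}. \<Inter>j\<in>J. \<Inter>A\<in>dyadics l. \<Inter>B\<in>dyadics l.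
    {X. corr_error (rep_aut X) (m j k) (p j) A B < 1 / Suc l})" for l
  have V_open: "open (V l)" for l
    unfolding V_def
    by (intro open_UN ballI open_INT J finite_dyadics open_corr)
       (use dyadics_leb01 in blast)+
  have V_iff: "X \<in> V l \<longleftrightarrow> (\<exists>k\<ge>l. corr_near J m p (rep_aut X) l k (1 / Suc l))" for X l
    by (simp add: V_def corr_near_def Bex_def)
  have "{X. \<exists>s. strict_mono s \<and> (\<forall>j\<in>J. mixes_along X (\<lambda>l. m j (s l)) (p j))} = (\<Inter>l. V l)"
  proof (intro set_eqI iffI)
    fix X assume "X \<in> {X. \<exists>s. strict_mono s \<and> (\<forall>j\<in>J. mixes_along X (\<lambda>l. m j (s l)) (p j))}"
    then obtain s :: "nat \<Rightarrow> nat" where s: "strict_mono s"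
      and mix: "\<And>j. j \<in> J \<Longrightarrow> mixes_map (rep_aut X) (\<lambda>l. m j (s l)) (p j)"
      unfolding mixes_along_rep by blast
    have "X \<in> V l" for l
    proof -
      have "eventually (\<lambda>i. corr_near J m p (rep_aut X) l (s i) (1 / Suc l)) sequentially"
        unfolding corr_near_def using mix dyadics_leb01[of l]
        by (intro eventually_corr_error[unfolded corr_near_def, where m = "\<lambda>j i. m j (s i)"] J) auto
      then obtain i0 where i0: "\<And>i. i0 \<le> i \<Longrightarrow> corr_near J m p (rep_aut X) l (s i) (1 / Suc l)"
        unfolding eventually_sequentially by blast
      have "l \<le> s (max i0 l)"
        using seq_suble[OF s, of "max i0 l"] by simp
      with i0[of "max i0 l"] show ?thesis
        unfolding V_iff by (intro exI[of _ "s (max i0 l)"] conjI) simp_all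
    qed
    then show "X \<in> (\<Inter>l. V l)" by blast
  next
    fix X assume "X \<in> (\<Inter>l. V l)"
    then have X: "\<exists>k\<ge>l. corr_near J m p (rep_aut X) l k (1 / Suc l)" for l
      unfolding V_iff[symmetric] by blast
    have "\<exists>s. \<forall>l. corr_near J m p (rep_aut X) l (s l) (1 / Suc l) \<and> s l < s (Suc l)"
    proof (rule dependent_nat_choice)
      show "\<exists>k. corr_near J m p (rep_aut X) 0 k (1 / Suc 0)"
        using X[of 0] by blast
      fix k l :: nat
      \<comment> \<open>The condition at a scale beyond \<open>k\<close> forces the new time past
        \<open>k\<close>; it is then weakened to scale \<open>Suc l\<close>.\<close>
      let ?l = "max (Suc l) (Suc k)"
      obtain k' where k': "?l \<le> k'" "corr_near J m p (rep_aut X) ?l k' (1 / Suc ?l)"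
        using X[of ?l] by blast
      have "corr_near J m p (rep_aut X) (Suc l) k' (1 / Suc (Suc l))"
        by (rule corr_near_mono[OF k'(2)]) (auto intro: divide_left_mono)
      with k'(1) show "\<exists>k'. corr_near J m p (rep_aut X) (Suc l) k' (1 / Suc (Suc l)) \<and> k < k'"
        by (intro exI[of _ k']) simp
    qed
    then obtain s where s: "\<And>l. corr_near J m p (rep_aut X) l (s l) (1 / Suc l)" "\<And>l. s l < s (Suc l)"
      by blast
    have "mixes_map (rep_aut X) (\<lambda>l. m j (s l)) (p j)" if "j \<in> J" for j
      by (rule mixes_map_of_errors[OF rep_aut_mpt p[OF that], where C = 1])
         (use s(1) that in \<open>auto simp: corr_near_def intro: less_imp_le\<close>)
    then show "X \<in> {X. \<exists>s. strict_mono s \<and> (\<forall>j\<in>J. mixes_along X (\<lambda>l. m j (s l)) (p j))}"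
      using s(2) unfolding mixes_along_rep by (blast intro: strict_mono_Suc_iff[THEN iffD2])
  qed
  moreover have "gdelta_in euclidean (\<Inter>l. V l)"
    using V_open by (intro gdelta_in_Inter) (auto intro: open_imp_gdelta_in)
  ultimately show ?thesis
    by simp
qed

text \<open>\<open>T\<close> has a tower good enough for \<open>approximating_conjugate\<close> to
  change it by at most \<open>e\<close>.\<close>

definition near_tower :: "(real \<Rightarrow> real) \<Rightarrow> real \<Rightarrow> bool" where
  "near_tower T e \<longleftrightarrow> (\<exists>n F d. tower T n F \<and> 1 \<le> n \<and> 0 < d \<and> d \<le> 1 \<and> 1 - d \<le> n * \<mu> F \<and> d + 1 / n \<le> e)"

text \<open>Half of \<open>e\<close> is spent on the uncovered part, half on the top level; the
  minimum keeps the uncovered part at most 1.\<close>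

lemma near_towerI:
  assumes "tower T n F" "1 \<le> n" "0 < e" "2 / e \<le> n" "1 - min 1 (e / 2) \<le> n * \<mu> F"
  shows "near_tower T e"
proof -
  have "1 / n \<le> e / 2"
    using assms(2-4) by (simp add: field_simps)
  then have "min 1 (e / 2) + 1 / n \<le> e"
    by linarith
  then show ?thesis
    unfolding near_tower_def using assms
    by (intro exI[of _ n] exI[of _ F] exI[of _ "min 1 (e / 2)"]) simp
qed

lemma large_height:
  fixes e :: real
  obtains n :: nat where "1 \<le> n" "2 / e \<le> n"
proof -
  obtain n0 where "2 / e \<le> real n0"
    using real_arch_simple by blast
  then show thesis
    by (intro that[of "Suc n0"]) auto
qed

lemma near_tower_aperiodic:
  assumes T: "T \<in> mpt" and aper: "aperiodic_map T" and e: "0 < e"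
  shows "near_tower T e"
proof -
  have inv: "ae_inv T (\<lambda>x. x \<in> {0..1})"
    using AE_in_01 by eventually_elim (use mpt_in[OF T] in blast)
  obtain n :: nat where n: "1 \<le> n" "2 / e \<le> n"
    by (rule large_height)
  obtain F where F: "tower T n F" "\<forall>I\<in>\<B>. ae_inv T (\<lambda>x. x \<in> I) \<longrightarrow>
      (1 - min 1 (e / 2)) * \<mu> I \<le> n * \<mu> (F \<inter> I)"
    using rokhlin[OF T aper n(1), of "min 1 (e / 2)"] e by auto
  have "F \<inter> {0..1} = F"
    using F(1) by (auto simp: tower_def sets_leb01)
  then show ?thesis
    using F(2)[rule_format, OF top_sets01 inv] by (intro near_towerI[OF F(1) n(1) e n(2)]) simp
qed

section \<open>The iteration and its limit\<close>

context disjoint_union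
begin

text \<open>Dependent choice on the stages. The invariant asks for a sufficient tower and not for
  aperiodicity, since the first map comes with such a tower but is not known to be
  aperiodic.\<close>

lemma exists_mixing_near:
  assumes K: "\<And>x. x \<in> {0..1} \<Longrightarrow> c x < K"
    and aper: "\<And>k. 0 < \<mu> (lev c k) \<Longrightarrow> aperiodic_map (S k)"
    and J: "finite J"
    and mix: "\<And>j k. j \<in> J \<Longrightarrow> 0 < \<mu> (lev c k) \<Longrightarrow> mixes_map (S k) (m j) (\<xi> k j)"
    and p: "\<And>j. j \<in> J \<Longrightarrow> p j = (\<Sum>k<K. \<mu> (lev c k) * \<xi> k j)" "\<And>j. j \<in> J \<Longrightarrow> p j \<in> {0..1}"
    and R: "R \<in> mpt"
  shows "\<exists>T\<in>mpt. \<mu> (dyadic_neq i T R) \<le> (1/2) ^ i \<and>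
    (\<exists>s :: nat \<Rightarrow> nat. strict_mono s \<and> (\<forall>j\<in>J. mixes_map T (\<lambda>l. m j (s l)) (p j)))"
proof -
  \<comment> \<open>The limit will agree with the first map \<open>T0\<close> off a set of measure
    at most \<open>2 * e0\<close>.\<close>
  define e0 :: real where "e0 = (1/2) ^ i / 2"
  have e0: "0 < e0" by (simp add: e0_def)
  obtain T0 where T0: "T0 \<in> mpt" and T0_R: "AE x in leb01. dyadic i (T0 x) = dyadic i (R x)"
    and T0_tower: "near_tower T0 e0"
  proof -
    obtain q :: nat where q: "1 \<le> q" "2 / e0 \<le> q"
      by (rule large_height)
    obtain T F where T: "T \<in> mpt" and F: "tower T q F" "q * \<mu> F = 1"
      and TR: "AE x in leb01. dyadic i (T x) = dyadic i (R x)"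
      using exact_tower_approx[OF R q(1), of i] by blast
    have "near_tower T e0"
      using F(2) e0 by (intro near_towerI[OF F(1) q(1) e0 q(2)]) simp
    with T TR show thesis by (rule that)
  qed
  \<comment> \<open>A state consists of a map, the last time chosen and the tolerance for the next
    change. Tolerances at least halve, so all later changes together stay within twice the current
    one.\<close>
  define Q where "Q x \<longleftrightarrow> fst x \<in> mpt \<and> near_tower (fst x) (snd (snd x)) \<and> 0 < snd (snd x)"
    for x :: "(real \<Rightarrow> real) \<times> nat \<times> real"
  define step where "step l x y \<longleftrightarrow> \<mu> (disagree (fst y) (fst x)) \<le> snd (snd x) \<and>
      fst (snd x) < fst (snd y) \<and> snd (snd y) \<le> snd (snd x) / 2 \<and>
      (\<forall>j\<in>J. snd (snd y) * \<bar>m j (fst (snd y))\<bar> \<le> 1 / Suc l) \<and>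
      (corr_near J m p (fst y) l (fst (snd y)) (1 / Suc l))"
    for l :: nat and x y :: "(real \<Rightarrow> real) \<times> nat \<times> real"
  have "\<exists>f. \<forall>l. (Q (f l) \<and> (l = 0 \<longrightarrow> f l = (T0, 0, e0))) \<and> step l (f l) (f (Suc l))"
  proof (rule dependent_nat_choice)
    show "\<exists>x. Q x \<and> (0 = (0::nat) \<longrightarrow> x = (T0, 0, e0))"
      using T0 T0_tower e0 by (auto simp: Q_def)
  next
    fix x :: "(real \<Rightarrow> real) \<times> nat \<times> real" and l :: nat
    assume "Q x \<and> (l = 0 \<longrightarrow> x = (T0, 0, e0))"
    moreover obtain T k e where x: "x = (T, k, e)"
      by (cases x) auto
    ultimately have T: "T \<in> mpt" and e: "0 < e" and "near_tower T e"
      by (auto simp: Q_def)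
    then obtain n F d where tow: "tower T n F" "1 \<le> n" "0 < d" "d \<le> 1" "1 - d \<le> n * \<mu> F"
      and de: "d + 1 / n \<le> e"
      unfolding near_tower_def by blast
    from approximating_conjugate[OF K aper mix p(1) T tow
        finite_dyadics[of l] dyadics_leb01 dyadics_Int]
    obtain T' where T'1: "T' \<in> mpt" and T'2: "aperiodic_map T' \<and> \<mu> (disagree T' T) \<le> d + 1 / n \<and>
      (\<forall>j\<in>J. \<forall>A\<in>dyadics l. \<forall>B\<in>dyadics l. corr_limit T' (m j) (p j) A B)"
      by (rule bexE)
    note T' = T'1 T'2[THEN conjunct1] and close = T'2[THEN conjunct2, THEN conjunct1]
      and lim = T'2[THEN conjunct2, THEN conjunct2]
    have "eventually (\<lambda>i. corr_near J m p T' l i (1 / Suc l)) sequentially"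
      using lim by (intro eventually_corr_error J) auto
    then obtain i0 where i0: "\<And>i. i0 \<le> i \<Longrightarrow> corr_near J m p T' l i (1 / Suc l)"
      unfolding eventually_sequentially by blast
    define k' where "k' = max i0 (Suc k)"
    define M :: real where "M = 1 + (\<Sum>j\<in>J. \<bar>m j k'\<bar>)"
    have M: "1 \<le> M" "\<And>j. j \<in> J \<Longrightarrow> \<bar>m j k'\<bar> \<le> M"
      unfolding M_def using member_le_sum[of _ J "\<lambda>j. real_of_int \<bar>m j k'\<bar>"] J
      by (auto intro: sum_nonneg add_increasing)
    \<comment> \<open>Later changes of the transformation, of total size at most \<open>2 * e'\<close>, keep the correlations along \<open>m j k'\<close>.\<close>
    define e' where "e' = min (e / 2) (1 / (Suc l * M))"
    have e': "0 < e'" "e' \<le> e / 2" "e' \<le> 1 / (Suc l * M)"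
      using e M(1) by (auto simp: e'_def)
    have "e' * \<bar>m j k'\<bar> \<le> 1 / Suc l" if "j \<in> J" for j
    proof -
      have "e' * \<bar>m j k'\<bar> \<le> 1 / (Suc l * M) * M"
        using e' M(1) M(2)[OF that] by (intro mult_mono) auto
      also have "\<dots> = 1 / Suc l"
        using M(1) by simp
      finally show ?thesis .
    qed
    then have "step l x (T', k', e')"
      using close de e'(2) i0[of k'] by (auto simp: step_def x k'_def)
    moreover have "Q (T', k', e')"
      using T' near_tower_aperiodic[OF T' e'(1)] e'(1) by (simp add: Q_def)
    ultimately show "\<exists>y. (Q y \<and> (Suc l = 0 \<longrightarrow> y = (T0, 0, e0))) \<and> step l x y"
      by blast
  qed
  then obtain f where Qf: "\<And>l. Q (f l)" and f0: "f 0 = (T0, 0, e0)" and sf: "\<And>l. step l (f l) (f (Suc l))"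
    by blast
  define X where "X l = fst (f l)" for l
  define k where "k l = fst (snd (f l))" for l
  define e where "e l = snd (snd (f l))" for l
  have X: "X l \<in> mpt" for l
    using Qf[of l] by (simp add: Q_def X_def)
  have st: "\<mu> (disagree (X (Suc l)) (X l)) \<le> e l" "k l < k (Suc l)" "e (Suc l) \<le> e l / 2"
    "\<And>j. j \<in> J \<Longrightarrow> e (Suc l) * \<bar>m j (k (Suc l))\<bar> \<le> 1 / Suc l"
    "\<And>j A B. j \<in> J \<Longrightarrow> A \<in> dyadics l \<Longrightarrow> B \<in> dyadics l \<Longrightarrow>
      corr_error (X (Suc l)) (m j (k (Suc l))) (p j) A B < 1 / Suc l" for l
    using sf[of l] unfolding step_def corr_near_def X_def[symmetric] k_def[symmetric] e_def[symmetric] by blast+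
  obtain T where T: "T \<in> mpt" and TX: "\<And>l. \<mu> (disagree T (X l)) \<le> 2 * e l"
    using uniform_limit_mpt[of X e, OF X st(1,3)] by blast
  have near: "\<mu> (dyadic_neq i T R) \<le> (1/2) ^ i"
  proof -
    have "AE x in leb01. x \<in> dyadic_neq i T R \<longrightarrow> x \<in> {x \<in> {0..1}. T x \<noteq> X 0 x}"
      using T0_R by eventually_elim (auto simp: X_def f0)
    moreover have "dyadic_neq i T R \<in> \<B>"
      by (rule dyadic_neq_sets[OF T R])
    ultimately have "\<mu> (dyadic_neq i T R) \<le> \<mu> {x \<in> {0..1}. T x \<noteq> X 0 x}"
      by (intro measure_mono_AE01 neq_sets mpt_meas T X)
    also have "\<dots> \<le> (1/2) ^ i"
      using TX[of 0] by (simp add: e_def f0 e0_def)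
    finally show ?thesis .
  qed
  have "mixes_map T (\<lambda>l. m j (k (Suc l))) (p j)" if j: "j \<in> J" for j
  \<comment> \<open>One unit for the error of the map at stage \<open>l\<close>, two for all later
    changes.\<close>
  proof (rule mixes_map_of_errors[OF T p(2)[OF j], where C = 3])
    fix l A B assume AB: "A \<in> dyadics l" "B \<in> dyadics l"
    then have s: "A \<in> \<B>" "B \<in> \<B>"
      using dyadics_leb01 by blast+
    let ?m = "m j (k (Suc l))"
    have "\<bar>\<mu> (A \<inter> preimage_iter T ?m B) - \<mu> (A \<inter> preimage_iter (X (Suc l)) ?m B)\<bar> \<le> \<bar>?m\<bar> * (2 * e (Suc l))"
      using corr_diff_le[OF T X s, of ?m "Suc l"] mult_left_mono[OF TX[of "Suc l"], of "\<bar>?m\<bar>"] by simp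
    also have "\<dots> = 2 * (e (Suc l) * \<bar>?m\<bar>)"
      by simp
    also have "\<dots> \<le> 2 * (1 / Suc l)"
      by (intro mult_left_mono st(4) j) simp
    finally show "corr_error T ?m (p j) A B \<le> 3 / Suc l"
      using st(5)[OF j AB] by linarith
  qed
  moreover have "strict_mono (\<lambda>l. k (Suc l))"
    using st(2) by (simp add: strict_mono_Suc_iff)
  ultimately show ?thesis
    using T near by blast
qed

end

section \<open>Coding of the patterns and conclusion\<close>

lemma label_sum:
  assumes "finite J" "\<And>j. j \<in> J \<Longrightarrow> label (h j)"
  shows "label (\<lambda>x. \<Sum>j\<in>J. h j x)"
  using assms
proof (induction J)
  case (insert j J)
  have "label (\<lambda>x. h j x + (\<Sum>j\<in>J. h j x))"
    by (rule label_prod[of "h j" _ "(+)"]) (use insert in auto)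
  then show ?case
    using insert by simp
qed simp

theorem theorem1p3:
  fixes N :: nat
    and lam :: "nat \<Rightarrow> real"
    and \<phi> :: "nat \<Rightarrow> nat \<Rightarrow> int"
    and n :: "nat \<Rightarrow> nat"
  assumes "N \<ge> 1"
    and "\<And>j. j \<in> {1..N} \<Longrightarrow> lam j \<in> {0..1}"
    and "strict_mono n"
    and "\<And>k. n k \<ge> 1"
    and "\<And>\<xi> :: nat \<Rightarrow> real. \<xi> \<in> {1..N} \<rightarrow>\<^sub>E {0, 1} \<Longrightarrow>
           \<exists>T. aperiodic T \<and> (\<forall>j\<in>{1..N}. mixes_along T (\<lambda>k. \<phi> j (n k)) (\<xi> j))"
  shows "let G = {T. \<exists>s :: nat \<Rightarrow> nat. strict_mono s \<and>
                    (\<forall>j\<in>{1..N}. mixes_along T (\<lambda>l. \<phi> j (n (s l))) (lam j))}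
         in closure G = UNIV \<and> gdelta_in euclidean G"
proof -
  define G where "G = {T. \<exists>s :: nat \<Rightarrow> nat. strict_mono s \<and>
                    (\<forall>j\<in>{1..N}. mixes_along T (\<lambda>l. \<phi> j (n (s l))) (lam j))}"
  \<comment> \<open>Components are labelled by natural numbers, and the binary digits of a label
    spell out its pattern.\<close>
  define \<xi> :: "nat \<Rightarrow> nat \<Rightarrow> real" where
    "\<xi> k = (\<lambda>j\<in>{1..N}. if j \<in> set_decode k then 1 else 0)" for k
  have "\<exists>T. aperiodic T \<and> (\<forall>j\<in>{1..N}. mixes_along T (\<lambda>k. \<phi> j (n k)) (\<xi> k' j))" for k'
    by (rule assms(5)) (auto simp: \<xi>_def split: if_splits)
  then obtain Z where Z: "\<And>k. aperiodic (Z k)"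
    "\<And>k j. j \<in> {1..N} \<Longrightarrow> mixes_along (Z k) (\<lambda>k. \<phi> j (n k)) (\<xi> k j)"
    by metis
  define S where "S k = rep_aut (Z k)" for k
  \<comment> \<open>A uniform \<open>x\<close> draws the pattern of those \<open>j\<close> with \<open>x < lam j\<close>, which contains \<open>j\<close> with probability \<open>lam j\<close>.\<close>
  define c :: "real \<Rightarrow> nat" where "c x = set_encode {j \<in> {1..N}. x < lam j}" for x
  have dec: "set_decode (c x) = {j \<in> {1..N}. x < lam j}" for x
    unfolding c_def by (rule set_encode_inverse) simp
  have lam_set: "{x \<in> {0..1}. x < lam j} \<in> \<B>" for j
    unfolding sets_leb01 by auto
  have c_sum: "c x = (\<Sum>j\<in>{1..N}. if x \<in> {x \<in> {0..1}. x < lam j} then 2 ^ j else 0)" if "x \<in> {0..1}" for x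
    unfolding c_def set_encode_def using that by (simp add: sum.inter_filter del: atLeastAtMost_iff)
  have "label (\<lambda>x. \<Sum>j\<in>{1..N}. if x \<in> {x \<in> {0..1}. x < lam j} then 2 ^ j else 0)"
    by (intro label_sum label_If lam_set) auto
  then have c: "label c"
    by (subst measurable_cong[of _ _ "\<lambda>x. \<Sum>j\<in>{1..N}. if x \<in> {x \<in> {0..1}. x < lam j} then 2 ^ j else 0"])
       (use c_sum in auto)
  define K :: nat where "K = Suc (\<Sum>j\<in>{1..N}. 2 ^ j)"
  have K: "c x < K" for x
    unfolding c_def set_encode_def K_def by (intro le_imp_less_Suc sum_mono2) auto
  obtain W where "disjoint_union c S W"
    using disjoint_union_exists[OF c, of S] rep_aut_mpt c unfolding disjoint_union_def S_def by blast
  then interpret disjoint_union c S W .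
  have weights: "lam j = (\<Sum>k<K. \<mu> (lev c k) * \<xi> k j)" if j: "j \<in> {1..N}" for j
  proof -
    have l: "lam j \<in> {0..1}"
      by (rule assms(2)[OF j])
    have "{x \<in> {0..1}. x < lam j} = {0..<lam j}"
      using l by auto
    then have "lam j = \<mu> {x \<in> {0..1}. x < lam j}"
      using l measure_leb01_eq[OF lam_set[of j]] by simp
    also have "\<dots> = (\<Sum>k<K. \<mu> ({x \<in> {0..1}. x < lam j} \<inter> lev c k))"
      by (rule measure_sum_lev[OF c K lam_set])
    also have "\<dots> = (\<Sum>k<K. \<mu> (lev c k) * \<xi> k j)"
    proof (rule sum.cong[OF refl])
      fix k
      have "x < lam j \<longleftrightarrow> j \<in> set_decode k" if "x \<in> lev c k" for x
        using that dec[of x] j by auto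
      then have "{x \<in> {0..1}. x < lam j} \<inter> lev c k = (if j \<in> set_decode k then lev c k else {})"
        by auto
      then show "\<mu> ({x \<in> {0..1}. x < lam j} \<inter> lev c k) = \<mu> (lev c k) * \<xi> k j"
        using j by (simp add: \<xi>_def)
    qed
    finally show ?thesis .
  qed
  have "R \<in> closure G" for R
  proof -
    have "\<exists>X. X \<in> G \<and> \<mu> (dyadic_neq i (rep_aut X) (rep_aut R)) \<le> (1/2) ^ i" for i
    proof -
      have mix: "mixes_map (S k) (\<lambda>k. \<phi> j (n k)) (\<xi> k j)" if "j \<in> {1..N}" for j k
        using Z(2)[OF that] by (simp only: mixes_along_rep S_def)
      have aper: "aperiodic_map (S k)" for k
        using aperiodic_rep[OF Z(1)] by (simp only: S_def)
      from exists_mixing_near[where m = "\<lambda>j k. \<phi> j (n k)" and J = "{1..N}",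
          OF K aper finite_atLeastAtMost mix weights assms(2) rep_aut_mpt, of i R]
      obtain T where T: "T \<in> mpt" and *: "\<mu> (dyadic_neq i T (rep_aut R)) \<le> (1/2) ^ i \<and>
          (\<exists>s :: nat \<Rightarrow> nat. strict_mono s \<and> (\<forall>j\<in>{1..N}. mixes_map T (\<lambda>l. \<phi> j (n (s l))) (lam j)))"
        by (rule bexE)
      have "\<mu> (dyadic_neq i (rep_aut (abs_aut T)) (rep_aut R)) = \<mu> (dyadic_neq i T (rep_aut R))"
      proof (rule leb01.finite_measure_eq_AE)
        show "AE x in leb01. (x \<in> dyadic_neq i (rep_aut (abs_aut T)) (rep_aut R)) =
            (x \<in> dyadic_neq i T (rep_aut R))"
          using rep_abs_aut[OF T] by eventually_elim simp
      qed (intro dyadic_neq_sets rep_aut_mpt T)+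
      moreover have "abs_aut T \<in> G"
        unfolding G_def using *[THEN conjunct2] by (simp add: mixes_along_abs[OF T])
      ultimately show ?thesis
        using *[THEN conjunct1] by (intro exI[of _ "abs_aut T"]) simp
    qed
    then obtain X where X: "\<And>i. X i \<in> G"
      "\<And>i. \<mu> (dyadic_neq i (rep_aut (X i)) (rep_aut R)) \<le> (1/2) ^ i"
      by metis
    have "X \<longlonglongrightarrow> R"
      by (rule tendsto_aut_of_dyadic[OF X(2)])
    moreover have "X i \<in> closure G" for i
      using X(1) closure_subset by blast
    ultimately show ?thesis
      by (intro Lim_in_closed_set[of "closure G" X sequentially R]) simp_all
  qed
  moreover have "gdelta_in euclidean G"
    unfolding G_def using gdelta_mixes_along[of "{1..N}" lam "\<lambda>j k. \<phi> j (n k)"] assms(2) by simp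
  ultimately show ?thesis
    unfolding G_def[symmetric] Let_def by blast
qed

end
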